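(* Let $T>0$ and let $\mathbf Z:[-T,T]\to\mathbb R^{2N}$ be a solution of $\dot{\mathbf Z}\in\operatorname{co}F(\mathbf Z)$, $\mathbf Z(0)=\mathbf Z_0$, where $\mathbf Z_0\in\mathcal D(F)$. Assume that there exist $t_1\in[-T,T)$ and $\mathbf Z_1\in\mathcal I_\ell$, for some $\ell\in\{1,\dots,N\}$, such that $\mathbf Z(t_1)=\mathbf Z_1$ and $$\widehat{\mathbf f}^-(\mathbf Z_1)\cdot\mathbf n(\mathbf Z_1)>0\qquad\text{or}\qquad\widehat{\mathbf f}^+(\mathbf Z_1)\cdot\mathbf n(\mathbf Z_1)<0,$$ where $\widehat{\mathbf f}^\pm$ and $\mathbf n$ are the vector fields and the unit normal to $\mathcal A_\ell$ associated with the base point $\hat{\mathbf Z}=\mathbf Z_1$ (see context). Then right uniqueness holds for $\dot{\mathbf Z}\in\operatorname{co}F(\mathbf Z)$ at the point $(t_1,\mathbf Z_1)$.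
   Context: Setting. $\Omega\subset\mathbb R^2$ is a bounded simply connected open set with $C^{2,\gamma}$ boundary for some $\gamma\in(0,1)$, with outer unit normal $\mathbf n_\Omega$; $N\ge1$ is an integer, and $b_1,\dots,b_N\in\mathbb R$ are the Burgers moduli. Let $\mu>0$, $\lambda\neq0$ and $$\mathbf L=\begin{pmatrix}\mu&0\\0&\mu\lambda^2\end{pmatrix},\quad \mathbf J=\begin{pmatrix}0&1\\-1&0\end{pmatrix},\quad \boldsymbol\Lambda=\begin{pmatrix}\lambda&0\\0&1\end{pmatrix},\quad \mathbf k_i(\mathbf x;\mathbf y)=\frac{b_i}{2\pi}\frac{\lambda\mathbf J^T(\mathbf x-\mathbf y)}{|\boldsymbol\Lambda(\mathbf x-\mathbf y)|^2}\ (\mathbf x\ne\mathbf y).$$ Set $\mathcal D(F)=\{\mathbf Z=(\mathbf z_1,\dots,\mathbf z_N)\in\Omega^N:\ \mathbf z_j\neq\mathbf z_k\text{ for all }j\ne k\}\subset\mathbb R^{2N}$. For $\mathbf Z\in\mathcal D(F)$ let $u_0(\cdot;\mathbf z_1,\dots,\mathbf z_N)$ be the solution (unique up to an additive constant) of the Neumann problem $\operatorname{div}(\mathbf L\nabla_{\mathbf x}u_0)=0$ in $\Omega$, $\mathbf L(\nabla_{\mathbf x}u_0+\sum_{i=1}^N\mathbf k_i(\mathbf x;\mathbf z_i))\cdot\mathbf n_\Omega(\mathbf x)=0$ on $\partial\Omega$. The Peach-Köhler force on the $\ell$-th dislocation is $$\mathbf j_\ell(\mathbf Z)=b_\ell\,\mathbf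 J\mathbf L\Big[\sum_{i\ne\ell}\mathbf k_i(\mathbf z_\ell;\mathbf z_i)+\nabla_{\mathbf x}u_0(\mathbf z_\ell;\mathbf z_1,\dots,\mathbf z_N)\Big].$$ The set of glide directions $\mathcal G\subset S^1$ is a finite set of unit vectors of $\mathbb R^2$ with $-\mathbf g\in\mathcal G$ whenever $\mathbf g\in\mathcal G$ and $\operatorname{span}\mathcal G=\mathbb R^2$. Set $\mathcal G_\ell(\mathbf Z)=\arg\max_{\mathbf g\in\mathcal G}\{\mathbf j_\ell(\mathbf Z)\cdot\mathbf g\}$, $F_\ell(\mathbf Z)=\{(\mathbf j_\ell(\mathbf Z)\cdot\mathbf g)\mathbf g:\mathbf g\in\mathcal G_\ell(\mathbf Z)\}$, $F(\mathbf Z)=F_1(\mathbf Z)\times\cdots\times F_N(\mathbf Z)\subset\mathbb R^{2N}$. $\operatorname{co}$ denotes the convex hull. A solution of $\dot{\mathbf Z}\in\operatorname{co}F(\mathbf Z)$ on an interval $I$ is an absolutely continuous function $\mathbf Z$ on $I$ with $\mathbf Z(t)\in\mathcal D(F)$ for $t\in I$ and $\dot{\mathbf Z}(t)\in\operatorname{co}F(\mathbf Z(t))$ for a.e. $t\in I$. Ambiguity sets. $\mathcal A_\ell=\{\mathbf Z\in\mathcal D(F):\operatorname{card}\mathcal G_\ell(\mathbf Z)=2\}$; for $\mathbf Z\in\mathcal A_\ell$ write $\mathcal G_\ell(\mathbf Z)=\{\mathbf g_\ell^+(\mathbf Z),\mathbf g_\ell^-(\mathbf Z)\}$. If $\mathcal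 G_k(\mathbf Z)$ is a singleton, its element is denoted $\mathbf g_k(\mathbf Z)$. The singular set $\mathcal S_\ell$ is the set of $\mathbf Z^*\in\mathcal A_\ell$ such that, with the constant vector $\mathbf g_0=\mathbf g_\ell^+(\mathbf Z^* )-\mathbf g_\ell^-(\mathbf Z^* )$, the function $\mathbf Z\mapsto\mathbf j_\ell(\mathbf Z)\cdot\mathbf g_0$ and its full gradient in $\mathbb R^{2N}$ both vanish at $\mathbf Z^*$. Further, $\mathcal E_{\rm int}=\{\mathbf Z:\mathbf Z\in\mathcal A_\ell\cap\mathcal A_j\text{ for some }\ell\ne j\}$, $\mathcal E_{\rm zero}=\{\mathbf Z\in\mathcal D(F):\mathbf j_k(\mathbf Z)=\mathbf 0\text{ for some }k\}$, and $\mathcal I_\ell=\mathcal A_\ell\setminus(\mathcal S_\ell\cup\mathcal E_{\rm int}\cup\mathcal E_{\rm zero})$. Local fields. Let $\hat{\mathbf Z}\in\mathcal I_\ell$. For $r>0$ small, $\mathcal A_\ell\cap B_r(\hat{\mathbf Z})$ is a smooth $(2N-1)$-dimensional manifold dividing $B_r(\hat{\mathbf Z})\subset\mathcal D(F)$ into two disjoint open sets $V^\pm$ such that $\mathcal G_\ell(\mathbf Z)=\{\mathbf g_\ell^\pm(\hat{\mathbf Z})\}$ for $\mathbf Z\in V^\pm$ (respectively), and $\mathcal G_k(\mathbf Z)=\{\mathbf g_k(\hat{\mathbf Z})\}$ on $B_r(\hat{\mathbf Z})$ for $k\neq\ell$. On $B_r(\hat{\mathbf Z})$ define $\widehat{\mathbf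 f}^\pm=(\widehat{\mathbf f}^\pm_1,\dots,\widehat{\mathbf f}^\pm_N)$ by $\widehat{\mathbf f}^\pm_k(\mathbf Z)=(\mathbf j_k(\mathbf Z)\cdot\mathbf g_k(\hat{\mathbf Z}))\mathbf g_k(\hat{\mathbf Z})$ for $k\ne\ell$ and $\widehat{\mathbf f}^\pm_\ell(\mathbf Z)=(\mathbf j_\ell(\mathbf Z)\cdot\mathbf g^\pm_\ell(\hat{\mathbf Z}))\mathbf g^\pm_\ell(\hat{\mathbf Z})$. $\mathbf n(\mathbf Z)$ is the unit normal to $\mathcal A_\ell$ at $\mathbf Z\in\mathcal A_\ell\cap B_r(\hat{\mathbf Z})$ directed from $V^-$ to $V^+$. Right uniqueness for $\dot{\mathbf Z}\in\operatorname{co}F(\mathbf Z)$ at $(t_1,\mathbf Z_1)$ means: there exists $t_2>t_1$ such that any two solutions of the inclusion taking the value $\mathbf Z_1$ at time $t_1$ coincide on the subset of $[t_1,t_2]$ on which they are both defined. *)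

theory Defs
  imports "HOL-Analysis.Analysis"
begin

section \<open>Gradient and divergence\<close>

definition grad :: "('a::real_inner \<Rightarrow> real) \<Rightarrow> 'a \<Rightarrow> 'a" where
  "grad f x = (THE D. GDERIV f x :> D)"

definition divergence :: "(real^2 \<Rightarrow> real^2) \<Rightarrow> real^2 \<Rightarrow> real" where
  "divergence V x = trace (jacobian V (at x))"

section \<open>Normals to hypersurfaces and regular boundaries\<close>

text \<open>For a differentiable hypersurface \<open>M\<close> the velocities at \<open>p\<close> of the curves lying in \<open>M\<close>
  form the tangent space of \<open>M\<close> at \<open>p\<close>.\<close>

definition tangent_vectors :: "'a::euclidean_space set \<Rightarrow> 'a \<Rightarrow> 'a set" where
  "tangent_vectors M p =
     {v. \<exists>c :: real \<Rightarrow> 'a. c 0 = p \<and> (\<forall>\<^sub>F t in nhds 0. c t \<in> M) \<and>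
           (c has_vector_derivative v) (at 0)}"

text \<open>\<open>unit_normal M V W p n\<close>: \<open>n\<close> is the unit normal to \<open>M\<close> at \<open>p\<close> directed from \<open>V\<close> to \<open>W\<close>.\<close>

definition unit_normal ::
  "'a::euclidean_space set \<Rightarrow> 'a set \<Rightarrow> 'a set \<Rightarrow> 'a \<Rightarrow> 'a \<Rightarrow> bool" where
  "unit_normal M V W p n \<longleftrightarrow>
     norm n = 1 \<and> (\<forall>v\<in>tangent_vectors M p. v \<bullet> n = 0) \<and>
     (\<forall>\<^sub>F s in at_right 0. p - s *\<^sub>R n \<in> V \<and> p + s *\<^sub>R n \<in> W)"

definition outer_unit_normal :: "(real^2) set \<Rightarrow> real^2 \<Rightarrow> real^2 \<Rightarrow> bool" where
  "outer_unit_normal \<Omega> p n \<longleftrightarrow> unit_normal (frontier \<Omega>) \<Omega> (- closure \<Omega>) p n"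

definition holder_on :: "real \<Rightarrow> real set \<Rightarrow> (real \<Rightarrow> real) \<Rightarrow> bool" where
  "holder_on \<gamma> S f \<longleftrightarrow> (\<exists>C. \<forall>x\<in>S. \<forall>y\<in>S. \<bar>f x - f y\<bar> \<le> C * \<bar>x - y\<bar> powr \<gamma>)"

text \<open>Near each boundary point \<open>p\<close>, in orthonormal coordinates \<open>(\<tau>, \<nu>)\<close> centred at \<open>p\<close>, the set
  is the strict subgraph of a function \<open>h\<close> that is twice differentiable with
  \<open>\<gamma>\<close>-Hoelder continuous second derivative.\<close>

definition C2_holder_boundary :: "real \<Rightarrow> (real^2) set \<Rightarrow> bool" where
  "C2_holder_boundary \<gamma> \<Omega> \<longleftrightarrow>
     (\<forall>p\<in>frontier \<Omega>. \<exists>r>0. \<exists>\<tau> \<nu> h h' h''.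
        norm \<tau> = 1 \<and> norm \<nu> = 1 \<and> \<tau> \<bullet> \<nu> = 0 \<and> h 0 = 0 \<and>
        (\<forall>s\<in>{-r<..<r}. (h has_real_derivative h' s) (at s) \<and>
                        (h' has_real_derivative h'' s) (at s)) \<and>
        holder_on \<gamma> {-r<..<r} h'' \<and>
        \<Omega> \<inter> ball p r = {x \<in> ball p r. (x - p) \<bullet> \<nu> < h ((x - p) \<bullet> \<tau>)})"

section \<open>Screw dislocations: Neumann problem and Peach-Koehler force\<close>

text \<open>A configuration of \<open>N = CARD('n)\<close> dislocations is a vector of type \<open>(real^2)^'n\<close>, whose
  norm and inner product are the Euclidean ones of the space of dimension \<open>2 * N\<close>.\<close>

definition matL :: "real \<Rightarrow> real \<Rightarrow> real^2^2" where
  "matL \<mu> lam = vector [vector [\<mu>, 0], vector [0, \<mu> * lam\<^sup>2]]"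

definition matJ :: "real^2^2" where
  "matJ = vector [vector [0, 1], vector [-1, 0]]"

definition matLambda :: "real \<Rightarrow> real^2^2" where
  "matLambda lam = vector [vector [lam, 0], vector [0, 1]]"

text \<open>The singular field of one dislocation with Burgers modulus \<open>\<beta>\<close> located at \<open>y\<close>;
  only its values at \<open>x \<noteq> y\<close> are meaningful.\<close>

definition kfield :: "real \<Rightarrow> real \<Rightarrow> real^2 \<Rightarrow> real^2 \<Rightarrow> real^2" where
  "kfield lam \<beta> x y =
     (\<beta> / (2 * pi)) *\<^sub>R ((lam / (norm (matLambda lam *v (x - y)))\<^sup>2) *\<^sub>R (transpose matJ *v (x - y)))"

definition configs :: "(real^2) set \<Rightarrow> ((real^2)^'n::finite) set" where
  "configs \<Omega> = {Z. (\<forall>i. Z $ i \<in> \<Omega>) \<and> (\<forall>j k. j \<noteq> k \<longrightarrow> Z $ j \<noteq> Z $ k)}"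

text \<open>Classical solutions: \<open>u\<close> is twice continuously differentiable in \<open>\<Omega>\<close>, and its gradient
  extends to a continuous field \<open>G\<close> on the closure, in terms of which the boundary
  condition is stated. The values of \<open>u\<close> outside \<open>\<Omega>\<close> are irrelevant.\<close>

definition neumann_solution ::
  "(real^2) set \<Rightarrow> real \<Rightarrow> real \<Rightarrow> ('n \<Rightarrow> real) \<Rightarrow> (real^2)^'n::finite \<Rightarrow> (real^2 \<Rightarrow> real) \<Rightarrow> bool" where
  "neumann_solution \<Omega> \<mu> lam b Z u \<longleftrightarrow>
     (\<exists>G. (\<forall>x\<in>\<Omega>. GDERIV u x :> G x) \<and> continuous_on (closure \<Omega>) G \<and>
          (\<forall>x\<in>\<Omega>. G differentiable (at x)) \<and> continuous_on \<Omega> (\<lambda>x. jacobian G (at x)) \<and>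
          (\<forall>x\<in>\<Omega>. divergence (\<lambda>y. matL \<mu> lam *v G y) x = 0) \<and>
          (\<forall>x\<in>frontier \<Omega>. \<forall>n. outer_unit_normal \<Omega> x n \<longrightarrow>
             (matL \<mu> lam *v (G x + (\<Sum>i\<in>UNIV. kfield lam (b i) x (Z $ i)))) \<bullet> n = 0))"

text \<open>\<open>u0 Z\<close> is the solution of the Neumann problem for the configuration \<open>Z\<close>; only its
  gradient is used, so the free additive constant does not matter.\<close>

definition peach_koehler_force ::
  "real \<Rightarrow> real \<Rightarrow> ('n \<Rightarrow> real) \<Rightarrow> ((real^2)^'n::finite \<Rightarrow> real^2 \<Rightarrow> real) \<Rightarrow> 'n \<Rightarrow> (real^2)^'n \<Rightarrow> real^2"
  where
  "peach_koehler_force \<mu> lam b u0 l Z =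
     b l *\<^sub>R (matJ *v (matL \<mu> lam *v
       ((\<Sum>i\<in>UNIV - {l}. kfield lam (b i) (Z $ l) (Z $ i)) + grad (u0 Z) (Z $ l))))"

section \<open>The differential inclusion\<close>

definition glide_directions :: "(real^2) set \<Rightarrow> bool" where
  "glide_directions \<G> \<longleftrightarrow>
     finite \<G> \<and> (\<forall>g\<in>\<G>. norm g = 1) \<and> (\<forall>g\<in>\<G>. - g \<in> \<G>) \<and> span \<G> = UNIV"

text \<open>From here on \<open>D\<close> is the set of admissible configurations, \<open>\<G>\<close> the set of glide directions
  and \<open>j l Z\<close> the force on the dislocation \<open>l\<close>.\<close>

type_synonym 'n force = "'n \<Rightarrow> (real^2)^'n \<Rightarrow> real^2"

definition max_dirs :: "(real^2) set \<Rightarrow> 'n::finite force \<Rightarrow> 'n \<Rightarrow> (real^2)^'n \<Rightarrow> (real^2) set" where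
  "max_dirs \<G> j l Z = {g. is_arg_max (\<lambda>g. j l Z \<bullet> g) (\<lambda>g. g \<in> \<G>) g}"

definition glide_velocities ::
  "(real^2) set \<Rightarrow> 'n::finite force \<Rightarrow> (real^2)^'n \<Rightarrow> ((real^2)^'n) set" where
  "glide_velocities \<G> j Z = {V. \<forall>l. V $ l \<in> {(j l Z \<bullet> g) *\<^sub>R g | g. g \<in> max_dirs \<G> j l Z}}"

definition absolutely_continuous_on_interval :: "real set \<Rightarrow> (real \<Rightarrow> 'a::real_normed_vector) \<Rightarrow> bool"
  where
  "absolutely_continuous_on_interval I f \<longleftrightarrow>
     (\<forall>\<epsilon>>0. \<exists>\<delta>>0. \<forall>P :: (real \<times> real) set.
        finite P \<and> (\<forall>(a, c)\<in>P. a \<le> c \<and> {a..c} \<subseteq> I) \<and>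
        pairwise (\<lambda>(a, c) (a', c'). {a<..<c} \<inter> {a'<..<c'} = {}) P \<and>
        (\<Sum>(a, c)\<in>P. c - a) < \<delta> \<longrightarrow>
        (\<Sum>(a, c)\<in>P. norm (f c - f a)) < \<epsilon>)"

definition inclusion_solution ::
  "((real^2)^'n::finite) set \<Rightarrow> (real^2) set \<Rightarrow> 'n force \<Rightarrow> real set \<Rightarrow> (real \<Rightarrow> (real^2)^'n) \<Rightarrow> bool" where
  "inclusion_solution D \<G> j I Z \<longleftrightarrow>
     is_interval I \<and> absolutely_continuous_on_interval I Z \<and> (\<forall>t\<in>I. Z t \<in> D) \<and>
     (AE t in lebesgue. t \<in> I \<longrightarrow>
        (\<exists>v \<in> convex hull (glide_velocities \<G> j (Z t)). (Z has_vector_derivative v) (at t within I)))"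

definition right_uniqueness ::
  "((real^2)^'n::finite) set \<Rightarrow> (real^2) set \<Rightarrow> 'n force \<Rightarrow> real \<Rightarrow> (real^2)^'n \<Rightarrow> bool" where
  "right_uniqueness D \<G> j t1 Z1 \<longleftrightarrow>
     (\<exists>t2>t1. \<forall>I I' X Y.
        inclusion_solution D \<G> j I X \<and> t1 \<in> I \<and> X t1 = Z1 \<and>
        inclusion_solution D \<G> j I' Y \<and> t1 \<in> I' \<and> Y t1 = Z1 \<longrightarrow>
        (\<forall>t \<in> {t1..t2} \<inter> I \<inter> I'. X t = Y t))"

section \<open>Ambiguity sets and local fields\<close>

definition ambiguity_set ::
  "((real^2)^'n::finite) set \<Rightarrow> (real^2) set \<Rightarrow> 'n force \<Rightarrow> 'n \<Rightarrow> ((real^2)^'n) set" where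
  "ambiguity_set D \<G> j l = {Z \<in> D. card (max_dirs \<G> j l Z) = 2}"

text \<open>Exchanging the labels \<open>gp\<close> and \<open>gm\<close> of the two maximizers changes the sign of
  \<open>gp - gm\<close> only.\<close>

definition singular_set ::
  "((real^2)^'n::finite) set \<Rightarrow> (real^2) set \<Rightarrow> 'n force \<Rightarrow> 'n \<Rightarrow> ((real^2)^'n) set" where
  "singular_set D \<G> j l =
     {Z \<in> ambiguity_set D \<G> j l. \<exists>gp gm. max_dirs \<G> j l Z = {gp, gm} \<and>
        j l Z \<bullet> (gp - gm) = 0 \<and> GDERIV (\<lambda>Y. j l Y \<bullet> (gp - gm)) Z :> 0}"

definition E_int ::
  "((real^2)^'n::finite) set \<Rightarrow> (real^2) set \<Rightarrow> 'n force \<Rightarrow> ((real^2)^'n) set" where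
  "E_int D \<G> j = {Z. \<exists>l k. l \<noteq> k \<and> Z \<in> ambiguity_set D \<G> j l \<inter> ambiguity_set D \<G> j k}"

definition E_zero :: "((real^2)^'n::finite) set \<Rightarrow> 'n force \<Rightarrow> ((real^2)^'n) set" where
  "E_zero D j = {Z \<in> D. \<exists>k. j k Z = 0}"

definition regular_ambiguity_set ::
  "((real^2)^'n::finite) set \<Rightarrow> (real^2) set \<Rightarrow> 'n force \<Rightarrow> 'n \<Rightarrow> ((real^2)^'n) set" where
  "regular_ambiguity_set D \<G> j l =
     ambiguity_set D \<G> j l - (singular_set D \<G> j l \<union> E_int D \<G> j \<union> E_zero D j)"

text \<open>The part of the ball around \<open>Zhat\<close> in which \<open>g\<close> is the only maximizer for the dislocation
  \<open>l\<close>. With \<open>g\<close> one of the two maximizers at \<open>Zhat\<close> and \<open>r\<close> small, these are the two sides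
  into which the ambiguity set divides the ball.\<close>

definition side ::
  "((real^2)^'n::finite) set \<Rightarrow> (real^2) set \<Rightarrow> 'n force \<Rightarrow> 'n \<Rightarrow> (real^2)^'n \<Rightarrow> real \<Rightarrow> real^2 \<Rightarrow>
     ((real^2)^'n) set" where
  "side D \<G> j l Zhat r g = {Z \<in> ball Zhat r \<inter> D. max_dirs \<G> j l Z = {g}}"

text \<open>The local field with base point \<open>Zhat\<close> and direction \<open>g\<close> for the dislocation \<open>l\<close>; the
  other dislocations move along their unique maximizing direction at \<open>Zhat\<close>.\<close>

definition local_field ::
  "(real^2) set \<Rightarrow> 'n::finite force \<Rightarrow> 'n \<Rightarrow> (real^2)^'n \<Rightarrow> real^2 \<Rightarrow> (real^2)^'n \<Rightarrow> (real^2)^'n" where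
  "local_field \<G> j l Zhat g Z =
     (\<chi> k. let d = (if k = l then g else the_elem (max_dirs \<G> j k Zhat)) in (j k Z \<bullet> d) *\<^sub>R d)"

end

theory Submission
  imports Defs "HOL-Complex_Analysis.Riemann_Mapping"
begin

text \<open>
  The proof has two independent halves.

  \<^emph>\<open>Uniqueness for the inclusion, given a force that is strictly differentiable at the starting
  configuration.\<close> Near \<open>Z1\<close> every admissible velocity lies on the segment between the two local
  fields \<open>fm\<close> and \<open>fp\<close>, with the weight of \<open>fp\<close> equal to \<open>0\<close> where \<open>\<phi> < 0\<close> and to \<open>1\<close> where
  \<open>\<phi> > 0\<close>; here \<open>\<phi> Z = j l Z \<bullet> (gp - gm)\<close>. The two fields differ by
  \<open>m E + \<phi> e\<close>, where \<open>E\<close> is the constant vector with \<open>l\<close>-th component \<open>gp - gm\<close> and \<open>m > 0\<close>. The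
  product of the weight and \<open>\<phi>\<close> is \<open>max \<phi> 0\<close>, a Lipschitz function, so the velocity is discontinuous
  only along the constant direction \<open>E\<close>. Let \<open>\<nu>\<close> be the gradient of \<open>\<phi>\<close> at \<open>Z1\<close>; it is a positive
  multiple of the given normal. By the hypothesis at least one of the fields points towards the surface.
  If \<open>\<nu> \<bullet> E < 0\<close>, the jump pushes two solutions together: with \<open>P\<close> the projection along \<open>E\<close>
  onto the orthogonal complement of \<open>\<nu>\<close>, the quantity \<open>max ((\<nu> \<bullet> w)\<^sup>2) ((norm (P w))\<^sup>2)\<close>
  of the difference \<open>w\<close> of two solutions satisfies Gronwall's inequality (\<open>sliding_uniqueness\<close>).
  Otherwise both fields cross the surface in the same direction, each solution leaves it at once, and on
  the far side the field is Lipschitz (\<open>crossing_uniqueness\<close>). Derivatives of absolutely continuous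
  functions are used through the growth estimate \<open>growth_le_of_upper_slope\<close>.

  \<^emph>\<open>Regularity of the force.\<close> After the linear change of variables \<open>stretch\<close> the gradient
  of a solution of the Neumann problem becomes a holomorphic function, and the singular field of a
  dislocation becomes a simple pole. The Neumann condition says that the conjugate potential has no
  tangential derivative on the boundary. Since the boundary is connected, that potential has a constant
  boundary value (\<open>constant_boundary_values\<close>). The logarithms of the Blaschke factors built from
  a Riemann map \<open>f\<close> have the same singularities and vanish on the boundary, so by the maximum principle
  the two potentials differ by a constant (\<open>neumann_gradient_formula\<close>). The force is therefore an explicit
  expression in \<open>f\<close> and its first two derivatives at the positions of the dislocations
  (\<open>peach_koehler_force_formula\<close>), which is strictly differentiable in the configuration. The Riemann
  map is used only in the interior; on the boundary it is enough that its modulus tends to \<open>1\<close>.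
\<close>

section \<open>Strict differentiability\<close>

text \<open>The linear approximation is uniform over pairs of points near \<open>a\<close>. This property of a single point
  is stable under composition, implies a Lipschitz bound near \<open>a\<close>, and gives the level set
  of a real function with nonzero gradient a tangent hyperplane at \<open>a\<close>; a continuous derivative implies it.\<close>
definition has_strict_derivative ::
  "('a::real_normed_vector \<Rightarrow> 'b::real_normed_vector) \<Rightarrow> ('a \<Rightarrow> 'b) \<Rightarrow> 'a \<Rightarrow> bool" where
  "has_strict_derivative f f' a \<longleftrightarrow> bounded_linear f' \<and>
     (\<forall>\<eta>>0. \<exists>\<rho>>0. \<forall>x\<in>ball a \<rho>. \<forall>y\<in>ball a \<rho>. norm (f x - f y - f' (x - y)) \<le> \<eta> * norm (x - y))"

definition strictly_differentiable_at ::
  "('a::real_normed_vector \<Rightarrow> 'b::real_normed_vector) \<Rightarrow> 'a \<Rightarrow> bool" where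
  "strictly_differentiable_at f a \<longleftrightarrow> (\<exists>f'. has_strict_derivative f f' a)"

lemma has_strict_derivativeI:
  assumes "bounded_linear f'"
    and "\<And>\<eta>. 0 < \<eta> \<Longrightarrow> \<exists>\<rho>>0. \<forall>x\<in>ball a \<rho>. \<forall>y\<in>ball a \<rho>. norm (f x - f y - f' (x - y)) \<le> \<eta> * norm (x - y)"
  shows "has_strict_derivative f f' a"
  using assms by (simp add: has_strict_derivative_def)

lemma has_strict_derivativeE:
  assumes "has_strict_derivative f f' a" "0 < \<eta>"
  obtains \<rho> where "0 < \<rho>" "\<forall>x\<in>ball a \<rho>. \<forall>y\<in>ball a \<rho>. norm (f x - f y - f' (x - y)) \<le> \<eta> * norm (x - y)"
proof -
  have "\<exists>\<rho>>0. \<forall>x\<in>ball a \<rho>. \<forall>y\<in>ball a \<rho>. norm (f x - f y - f' (x - y)) \<le> \<eta> * norm (x - y)"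
    using assms by (simp add: has_strict_derivative_def)
  then show ?thesis using that by blast
qed

lemma has_strict_derivative_lipschitz:
  assumes "has_strict_derivative f f' a"
  obtains L \<rho> where "0 < \<rho>" "0 \<le> L" "\<forall>x\<in>ball a \<rho>. \<forall>y\<in>ball a \<rho>. norm (f x - f y) \<le> L * norm (x - y)"
proof -
  obtain \<rho> where "0 < \<rho>" and \<rho>: "\<forall>x\<in>ball a \<rho>. \<forall>y\<in>ball a \<rho>. norm (f x - f y - f' (x - y)) \<le> 1 * norm (x - y)"
    using has_strict_derivativeE[OF assms, of 1] by auto
  have bl: "bounded_linear f'" using assms by (simp add: has_strict_derivative_def)
  obtain K where K: "0 \<le> K" "\<And>h. norm (f' h) \<le> norm h * K"
    using bounded_linear.nonneg_bounded[OF bl] by blast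
  have "norm (f x - f y) \<le> (1 + K) * norm (x - y)" if "x \<in> ball a \<rho>" "y \<in> ball a \<rho>" for x y
  proof -
    have "norm (f x - f y - f' (x - y)) \<le> norm (x - y)" using \<rho> that by simp
    then show ?thesis
      using K(2)[of "x - y"] norm_triangle_ineq[of "f x - f y - f' (x - y)" "f' (x - y)"]
      by (simp add: algebra_simps)
  qed
  then show ?thesis using that[of \<rho> "1 + K"] \<open>0 < \<rho>\<close> K(1) by simp
qed

lemma has_strict_derivative_continuous:
  assumes "has_strict_derivative f f' a"
  shows "continuous (at a) f"
proof -
  obtain L \<rho> where L: "0 < \<rho>" "0 \<le> L" "\<forall>x\<in>ball a \<rho>. \<forall>y\<in>ball a \<rho>. norm (f x - f y) \<le> L * norm (x - y)"
    by (rule has_strict_derivative_lipschitz[OF assms])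
  have "((\<lambda>x. L * norm (x - a)) \<longlongrightarrow> L * norm (a - a)) (at a)" by (intro tendsto_intros)
  then have "((\<lambda>x. L * norm (x - a)) \<longlongrightarrow> 0) (at a)" by simp
  moreover have "\<forall>\<^sub>F x in at a. norm (f x - f a) \<le> L * norm (x - a)"
    using L unfolding eventually_at by (intro exI[of _ \<rho>]) (auto simp: dist_commute)
  ultimately have "((\<lambda>x. f x - f a) \<longlongrightarrow> 0) (at a)" by (rule Lim_null_comparison[rotated])
  then show ?thesis by (simp add: continuous_at LIM_zero_iff)
qed

lemma has_strict_derivative_linear:
  assumes "bounded_linear f"
  shows "has_strict_derivative f f a"
proof (rule has_strict_derivativeI[OF assms])
  fix \<eta> :: real assume "0 < \<eta>"
  interpret bounded_linear f by fact
  show "\<exists>\<rho>>0. \<forall>x\<in>ball a \<rho>. \<forall>y\<in>ball a \<rho>. norm (f x - f y - f (x - y)) \<le> \<eta> * norm (x - y)"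
    using \<open>0 < \<eta>\<close> by (intro exI[of _ 1]) (simp add: diff)
qed

lemma has_strict_derivative_const: "has_strict_derivative (\<lambda>x. c) (\<lambda>h. 0) a"
  by (rule has_strict_derivativeI) (auto intro!: exI[of _ 1])

lemma has_strict_derivative_add:
  assumes f: "has_strict_derivative f f' a" and g: "has_strict_derivative g g' a"
  shows "has_strict_derivative (\<lambda>x. f x + g x) (\<lambda>h. f' h + g' h) a"
proof (rule has_strict_derivativeI)
  show "bounded_linear (\<lambda>h. f' h + g' h)"
    using f g by (auto simp: has_strict_derivative_def intro: bounded_linear_add)
  fix \<eta> :: real assume "0 < \<eta>"
  then have "0 < \<eta> / 2" by simp
  obtain \<rho>1 where 1: "0 < \<rho>1" "\<forall>x\<in>ball a \<rho>1. \<forall>y\<in>ball a \<rho>1. norm (f x - f y - f' (x - y)) \<le> \<eta> / 2 * norm (x - y)"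
    by (rule has_strict_derivativeE[OF f \<open>0 < \<eta> / 2\<close>])
  obtain \<rho>2 where 2: "0 < \<rho>2" "\<forall>x\<in>ball a \<rho>2. \<forall>y\<in>ball a \<rho>2. norm (g x - g y - g' (x - y)) \<le> \<eta> / 2 * norm (x - y)"
    by (rule has_strict_derivativeE[OF g \<open>0 < \<eta> / 2\<close>])
  show "\<exists>\<rho>>0. \<forall>x\<in>ball a \<rho>. \<forall>y\<in>ball a \<rho>. norm (f x + g x - (f y + g y) - (f' (x - y) + g' (x - y))) \<le> \<eta> * norm (x - y)"
  proof (intro exI[of _ "min \<rho>1 \<rho>2"] conjI ballI)
    fix x y assume "x \<in> ball a (min \<rho>1 \<rho>2)" "y \<in> ball a (min \<rho>1 \<rho>2)"
    then have le: "norm (f x - f y - f' (x - y)) \<le> \<eta> / 2 * norm (x - y)" "norm (g x - g y - g' (x - y)) \<le> \<eta> / 2 * norm (x - y)"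
      using 1(2) 2(2) by auto
    have eq: "f x + g x - (f y + g y) - (f' (x - y) + g' (x - y)) = (f x - f y - f' (x - y)) + (g x - g y - g' (x - y))"
      by simp
    show "norm (f x + g x - (f y + g y) - (f' (x - y) + g' (x - y))) \<le> \<eta> * norm (x - y)"
      unfolding eq using norm_triangle_ineq[of "f x - f y - f' (x - y)" "g x - g y - g' (x - y)"] le by linarith
  qed (use 1(1) 2(1) in auto)
qed

lemma has_strict_derivative_compose:
  assumes f: "has_strict_derivative f f' a" and g: "has_strict_derivative g g' (f a)"
  shows "has_strict_derivative (\<lambda>x. g (f x)) (\<lambda>h. g' (f' h)) a"
proof (rule has_strict_derivativeI)
  have bf: "bounded_linear f'" and bg: "bounded_linear g'" using f g by (auto simp: has_strict_derivative_def)
  show "bounded_linear (\<lambda>h. g' (f' h))" using bounded_linear_compose[OF bg bf] .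
  interpret g': bounded_linear g' by (rule bg)
  obtain K where K: "0 \<le> K" "\<And>h. norm (g' h) \<le> norm h * K" using g'.nonneg_bounded by blast
  obtain L \<rho>0 where L: "0 < \<rho>0" "0 \<le> L" "\<forall>x\<in>ball a \<rho>0. \<forall>y\<in>ball a \<rho>0. norm (f x - f y) \<le> L * norm (x - y)"
    by (rule has_strict_derivative_lipschitz[OF f])
  fix \<eta> :: real assume "0 < \<eta>"
  define \<eta>' where "\<eta>' = \<eta> / (L + K + 1)"
  have "0 < \<eta>'" using \<open>0 < \<eta>\<close> K L by (simp add: \<eta>'_def)
  have \<eta>': "\<eta>' * L + \<eta>' * K \<le> \<eta>"
  proof -
    have "\<eta>' * L + \<eta>' * K \<le> \<eta>' * (L + K + 1)" using \<open>0 < \<eta>'\<close> by (simp add: algebra_simps)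
    also have "\<dots> = \<eta>" using K L by (simp add: \<eta>'_def)
    finally show ?thesis .
  qed
  obtain \<rho>1 where 1: "0 < \<rho>1" "\<forall>x\<in>ball a \<rho>1. \<forall>y\<in>ball a \<rho>1. norm (f x - f y - f' (x - y)) \<le> \<eta>' * norm (x - y)"
    by (rule has_strict_derivativeE[OF f \<open>0 < \<eta>'\<close>])
  obtain \<rho>2 where 2: "0 < \<rho>2" "\<forall>x\<in>ball (f a) \<rho>2. \<forall>y\<in>ball (f a) \<rho>2. norm (g x - g y - g' (x - y)) \<le> \<eta>' * norm (x - y)"
    by (rule has_strict_derivativeE[OF g \<open>0 < \<eta>'\<close>])
  have "continuous (at a) f" by (rule has_strict_derivative_continuous[OF f])
  then obtain \<rho>3 where 3: "0 < \<rho>3" "\<forall>x. dist x a < \<rho>3 \<longrightarrow> dist (f x) (f a) < \<rho>2"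
    using \<open>0 < \<rho>2\<close> unfolding continuous_at_eps_delta by blast
  then have 3: "0 < \<rho>3" "\<And>x. x \<in> ball a \<rho>3 \<Longrightarrow> f x \<in> ball (f a) \<rho>2"
    by (auto simp: dist_commute)
  show "\<exists>\<rho>>0. \<forall>x\<in>ball a \<rho>. \<forall>y\<in>ball a \<rho>. norm (g (f x) - g (f y) - g' (f' (x - y))) \<le> \<eta> * norm (x - y)"
  proof (intro exI[of _ "min (min \<rho>0 \<rho>1) \<rho>3"] conjI ballI)
    fix x y assume "x \<in> ball a (min (min \<rho>0 \<rho>1) \<rho>3)" "y \<in> ball a (min (min \<rho>0 \<rho>1) \<rho>3)"
    then have xy: "x \<in> ball a \<rho>0" "y \<in> ball a \<rho>0" "x \<in> ball a \<rho>1" "y \<in> ball a \<rho>1" "f x \<in> ball (f a) \<rho>2" "f y \<in> ball (f a) \<rho>2"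
      using 3(2) by auto
    have "norm (g (f x) - g (f y) - g' (f x - f y)) \<le> \<eta>' * norm (f x - f y)" using 2(2) xy(5,6) by blast
    also have "\<dots> \<le> \<eta>' * (L * norm (x - y))" using L(3) xy \<open>0 < \<eta>'\<close> by (intro mult_left_mono) auto
    finally have A: "norm (g (f x) - g (f y) - g' (f x - f y)) \<le> \<eta>' * L * norm (x - y)" by simp
    have "norm (f x - f y - f' (x - y)) * K \<le> (\<eta>' * norm (x - y)) * K"
      using 1(2) xy K(1) by (intro mult_right_mono) auto
    then have B: "norm (g' (f x - f y - f' (x - y))) \<le> \<eta>' * K * norm (x - y)"
      using K(2)[of "f x - f y - f' (x - y)"] by (simp add: mult_ac)
    have "g (f x) - g (f y) - g' (f' (x - y)) = (g (f x) - g (f y) - g' (f x - f y)) + g' (f x - f y - f' (x - y))"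
      by (simp add: g'.diff)
    then have "norm (g (f x) - g (f y) - g' (f' (x - y))) \<le> (\<eta>' * L + \<eta>' * K) * norm (x - y)"
      using norm_triangle_ineq[of "g (f x) - g (f y) - g' (f x - f y)" "g' (f x - f y - f' (x - y))"] A B
      by (simp add: algebra_simps)
    also have "\<dots> \<le> \<eta> * norm (x - y)" using \<eta>' by (intro mult_right_mono) auto
    finally show "norm (g (f x) - g (f y) - g' (f' (x - y))) \<le> \<eta> * norm (x - y)" .
  qed (use 1(1) L(1) 3(1) in auto)
qed

lemma has_strict_derivative_transform:
  assumes f: "has_strict_derivative f f' a" and "open S" "a \<in> S" and eq: "\<And>x. x \<in> S \<Longrightarrow> g x = f x"
  shows "has_strict_derivative g f' a"
proof (rule has_strict_derivativeI)
  show "bounded_linear f'" using f by (simp add: has_strict_derivative_def)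
  fix \<eta> :: real assume "0 < \<eta>"
  obtain \<rho>1 where 1: "0 < \<rho>1" "\<forall>x\<in>ball a \<rho>1. \<forall>y\<in>ball a \<rho>1. norm (f x - f y - f' (x - y)) \<le> \<eta> * norm (x - y)"
    by (rule has_strict_derivativeE[OF f \<open>0 < \<eta>\<close>])
  obtain \<rho>2 where 2: "0 < \<rho>2" "ball a \<rho>2 \<subseteq> S" using \<open>open S\<close> \<open>a \<in> S\<close> by (meson openE)
  show "\<exists>\<rho>>0. \<forall>x\<in>ball a \<rho>. \<forall>y\<in>ball a \<rho>. norm (g x - g y - f' (x - y)) \<le> \<eta> * norm (x - y)"
  proof (intro exI[of _ "min \<rho>1 \<rho>2"] conjI ballI)
    fix x y assume "x \<in> ball a (min \<rho>1 \<rho>2)" "y \<in> ball a (min \<rho>1 \<rho>2)"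
    then have "x \<in> ball a \<rho>1" "y \<in> ball a \<rho>1" "x \<in> S" "y \<in> S" using 2 by auto
    then show "norm (g x - g y - f' (x - y)) \<le> \<eta> * norm (x - y)" using 1 by (simp add: eq)
  qed (use 1 2 in auto)
qed

lemma has_strict_derivative_square:
  fixes a :: "'a::real_normed_field"
  shows "has_strict_derivative (\<lambda>x. x * x) (\<lambda>h. 2 * a * h) a"
proof (rule has_strict_derivativeI)
  show "bounded_linear (\<lambda>h. 2 * a * h)" by (rule bounded_linear_mult_right)
  fix \<eta> :: real assume "0 < \<eta>"
  show "\<exists>\<rho>>0. \<forall>x\<in>ball a \<rho>. \<forall>y\<in>ball a \<rho>. norm (x * x - y * y - 2 * a * (x - y)) \<le> \<eta> * norm (x - y)"
  proof (intro exI[of _ "\<eta> / 2"] conjI ballI)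
    fix x y assume "x \<in> ball a (\<eta> / 2)" "y \<in> ball a (\<eta> / 2)"
    then have "norm ((x - a) + (y - a)) \<le> \<eta>"
      by (intro norm_triangle_le) (auto simp: dist_norm norm_minus_commute)
    moreover have "x * x - y * y - 2 * a * (x - y) = ((x - a) + (y - a)) * (x - y)"
      by (simp add: algebra_simps)
    ultimately show "norm (x * x - y * y - 2 * a * (x - y)) \<le> \<eta> * norm (x - y)"
      by (simp add: norm_mult mult_right_mono)
  qed (use \<open>0 < \<eta>\<close> in auto)
qed

text \<open>The derivative of a holomorphic function is continuous, and on a small disc the mean value inequality
  applies to \<open>f\<close> minus its linear part.\<close>
lemma holomorphic_strictly_differentiable:
  assumes hol: "f holomorphic_on S" and "open S" "a \<in> S"
  shows "strictly_differentiable_at f a"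
  unfolding strictly_differentiable_at_def
proof (rule exI, rule has_strict_derivativeI)
  show "bounded_linear (\<lambda>h. deriv f a * h)" by (rule bounded_linear_mult_right)
  fix \<eta> :: real assume "0 < \<eta>"
  have "deriv f holomorphic_on S" by (rule holomorphic_deriv[OF hol \<open>open S\<close>])
  then have "continuous (at a) (deriv f)"
    using \<open>open S\<close> \<open>a \<in> S\<close> continuous_on_eq_continuous_at holomorphic_on_imp_continuous_on by blast
  then obtain d where d: "0 < d" "\<And>x. dist x a < d \<Longrightarrow> dist (deriv f x) (deriv f a) < \<eta>"
    using \<open>0 < \<eta>\<close> unfolding continuous_at_eps_delta by blast
  obtain e where e: "0 < e" "ball a e \<subseteq> S" using \<open>open S\<close> \<open>a \<in> S\<close> by (meson openE)
  define \<rho> where "\<rho> = min d e"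
  show "\<exists>\<rho>>0. \<forall>x\<in>ball a \<rho>. \<forall>y\<in>ball a \<rho>. norm (f x - f y - deriv f a * (x - y)) \<le> \<eta> * norm (x - y)"
  proof (intro exI[of _ \<rho>] conjI ballI)
    fix x y assume xy: "x \<in> ball a \<rho>" "y \<in> ball a \<rho>"
    have "norm ((f x - deriv f a * x) - (f y - deriv f a * y)) \<le> \<eta> * norm (x - y)"
    proof (rule field_differentiable_bound[where S = "ball a \<rho>" and f' = "\<lambda>z. deriv f z - deriv f a"])
      fix z assume z: "z \<in> ball a \<rho>"
      then have "z \<in> S" using e by (auto simp: \<rho>_def)
      then have "(f has_field_derivative deriv f z) (at z within ball a \<rho>)"
        using hol \<open>open S\<close> by (meson DERIV_subset UNIV_I holomorphic_derivI subsetI)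
      then show "((\<lambda>z. f z - deriv f a * z) has_field_derivative deriv f z - deriv f a) (at z within ball a \<rho>)"
        by (auto intro!: derivative_eq_intros)
      show "norm (deriv f z - deriv f a) \<le> \<eta>"
        using d(2)[of z] z by (auto simp: \<rho>_def dist_norm norm_minus_commute)
    qed (use xy in auto)
    then show "norm (f x - f y - deriv f a * (x - y)) \<le> \<eta> * norm (x - y)" by (simp add: algebra_simps)
  qed (use d e in \<open>auto simp: \<rho>_def\<close>)
qed

lemma strictly_differentiable_add:
  "strictly_differentiable_at f a \<Longrightarrow> strictly_differentiable_at g a \<Longrightarrow> strictly_differentiable_at (\<lambda>x. f x + g x) a"
  unfolding strictly_differentiable_at_def using has_strict_derivative_add by blast

lemma strictly_differentiable_compose:
  "strictly_differentiable_at f a \<Longrightarrow> strictly_differentiable_at g (f a) \<Longrightarrow> strictly_differentiable_at (\<lambda>x. g (f x)) a"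
  unfolding strictly_differentiable_at_def using has_strict_derivative_compose by blast

lemma strictly_differentiable_linear:
  "bounded_linear f \<Longrightarrow> strictly_differentiable_at f a"
  unfolding strictly_differentiable_at_def using has_strict_derivative_linear by blast

lemma strictly_differentiable_const: "strictly_differentiable_at (\<lambda>x. c) a"
  unfolding strictly_differentiable_at_def using has_strict_derivative_const by blast

lemma strictly_differentiable_linear_compose:
  "bounded_linear g \<Longrightarrow> strictly_differentiable_at f a \<Longrightarrow> strictly_differentiable_at (\<lambda>x. g (f x)) a"
  by (rule strictly_differentiable_compose[OF _ strictly_differentiable_linear])

lemma strictly_differentiable_diff:
  assumes "strictly_differentiable_at f a" "strictly_differentiable_at g a"
  shows "strictly_differentiable_at (\<lambda>x. f x - g x) a"
  using strictly_differentiable_add[OF assms(1)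
      strictly_differentiable_linear_compose[OF bounded_linear_minus[OF bounded_linear_ident] assms(2)]]
  by simp

lemma strictly_differentiable_sum:
  "(\<And>i. i \<in> I \<Longrightarrow> strictly_differentiable_at (f i) a) \<Longrightarrow> strictly_differentiable_at (\<lambda>x. \<Sum>i\<in>I. f i x) a"
  by (induction I rule: infinite_finite_induct)
    (auto intro: strictly_differentiable_const strictly_differentiable_add)

text \<open>Polarization reduces products to squares, whose strict derivative is explicit.\<close>
lemma strictly_differentiable_mult:
  fixes f g :: "'a::real_normed_vector \<Rightarrow> complex"
  assumes f: "strictly_differentiable_at f a" and g: "strictly_differentiable_at g a"
  shows "strictly_differentiable_at (\<lambda>x. f x * g x) a"
proof -
  have sq: "strictly_differentiable_at (\<lambda>x. u x * u x) a" if "strictly_differentiable_at u a" for u :: "'a \<Rightarrow> complex"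
  proof (rule strictly_differentiable_compose[OF that])
    show "strictly_differentiable_at (\<lambda>x. x * x) (u a)"
      using has_strict_derivative_square unfolding strictly_differentiable_at_def by blast
  qed
  have "strictly_differentiable_at (\<lambda>x. (1 / 4) * ((f x + g x) * (f x + g x) - (f x - g x) * (f x - g x))) a"
    by (intro strictly_differentiable_linear_compose[OF bounded_linear_mult_right] strictly_differentiable_diff
        sq strictly_differentiable_add f g)
  moreover have "(1 / 4) * ((f x + g x) * (f x + g x) - (f x - g x) * (f x - g x)) = f x * g x" for x
    by (simp add: algebra_simps)
  ultimately show ?thesis by simp
qed

lemma strictly_differentiable_divide:
  fixes f g :: "'a::real_normed_vector \<Rightarrow> complex"
  assumes f: "strictly_differentiable_at f a" and g: "strictly_differentiable_at g a" and "g a \<noteq> 0"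
  shows "strictly_differentiable_at (\<lambda>x. f x / g x) a"
proof -
  have "(\<lambda>z. inverse z) holomorphic_on - {0 :: complex}" by (intro holomorphic_intros) auto
  then have "strictly_differentiable_at inverse (g a)"
    using \<open>g a \<noteq> 0\<close> by (intro holomorphic_strictly_differentiable[where S = "- {0}"]) auto
  then have "strictly_differentiable_at (\<lambda>x. f x * inverse (g x)) a"
    by (intro strictly_differentiable_mult f strictly_differentiable_compose[OF g])
  then show ?thesis by (simp add: divide_inverse)
qed

lemma strictly_differentiable_transform:
  "strictly_differentiable_at f a \<Longrightarrow> open S \<Longrightarrow> a \<in> S \<Longrightarrow> (\<And>x. x \<in> S \<Longrightarrow> g x = f x) \<Longrightarrow>
    strictly_differentiable_at g a"
  unfolding strictly_differentiable_at_def using has_strict_derivative_transform by blast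

lemma strict_gradientE:
  fixes \<phi> :: "'a::real_inner \<Rightarrow> real"
  assumes "has_strict_derivative \<phi> ((\<bullet>) \<nu>) p" "0 < \<eta>"
  obtains \<rho> where "0 < \<rho>" "\<forall>x\<in>ball p \<rho>. \<forall>y\<in>ball p \<rho>. \<bar>\<phi> x - \<phi> y - \<nu> \<bullet> (x - y)\<bar> \<le> \<eta> * norm (x - y)"
  using assms by (rule has_strict_derivativeE) (rule that, simp_all)

text \<open>A bounded linear functional on a Euclidean space is an inner product with a fixed vector.\<close>
lemma strictly_differentiable_imp_gradient:
  fixes \<phi> :: "'a::euclidean_space \<Rightarrow> real"
  assumes "strictly_differentiable_at \<phi> p"
  shows "\<exists>\<nu>. has_strict_derivative \<phi> ((\<bullet>) \<nu>) p"
proof -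
  obtain \<phi>' where \<phi>': "has_strict_derivative \<phi> \<phi>' p"
    using assms unfolding strictly_differentiable_at_def by blast
  then have "linear \<phi>'" by (simp add: has_strict_derivative_def bounded_linear.linear)
  then have "\<phi>' = (\<bullet>) (adjoint \<phi>' 1)"
    using adjoint_works[of \<phi>' _ 1] by (simp add: fun_eq_iff inner_commute)
  then show ?thesis using \<phi>' by metis
qed

lemma has_strict_derivative_imp_GDERIV:
  assumes grad: "has_strict_derivative \<phi> ((\<bullet>) \<nu>) p"
  shows "GDERIV \<phi> p :> \<nu>"
  unfolding gderiv_def has_derivative_at_alt
proof (intro conjI allI impI)
  show "bounded_linear (\<lambda>h. h \<bullet> \<nu>)" by (rule bounded_linear_inner_left)
  fix e :: real assume "0 < e"
  obtain \<rho> where \<rho>: "0 < \<rho>" "\<forall>x\<in>ball p \<rho>. \<forall>y\<in>ball p \<rho>. \<bar>\<phi> x - \<phi> y - \<nu> \<bullet> (x - y)\<bar> \<le> e * norm (x - y)"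
    by (rule strict_gradientE[OF grad \<open>0 < e\<close>])
  show "\<exists>d>0. \<forall>y. norm (y - p) < d \<longrightarrow> norm (\<phi> y - \<phi> p - (y - p) \<bullet> \<nu>) \<le> e * norm (y - p)"
    using \<rho> by (intro exI[of _ \<rho>]) (auto simp: dist_norm norm_minus_commute inner_commute)
qed

lemma strictly_differentiable_vec:
  fixes F :: "'a::real_normed_vector \<Rightarrow> ('b::real_normed_vector)^'n::finite"
  assumes "\<And>k. strictly_differentiable_at (\<lambda>x. F x $ k) a"
  shows "strictly_differentiable_at F a"
proof -
  have "strictly_differentiable_at (\<lambda>x. \<Sum>k\<in>UNIV. axis k (F x $ k)) a"
  proof (rule strictly_differentiable_sum, rule strictly_differentiable_linear_compose[OF _ assms])
    fix k :: 'n
    show "bounded_linear (\<lambda>v::'b. axis k v :: 'b^'n)"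
    proof (rule bounded_linear_intro[where K = 1])
      show "axis k (x + y) = (axis k x + axis k y :: 'b^'n)" for x y by (simp add: vec_eq_iff axis_def)
      show "axis k (r *\<^sub>R x) = (r *\<^sub>R axis k x :: 'b^'n)" for r x by (simp add: vec_eq_iff axis_def)
      show "norm (axis k x :: 'b^'n) \<le> norm x * 1" for x
        by (simp add: norm_vec_def L2_set_def axis_def if_distrib[of norm] if_distrib[of "\<lambda>x. x\<^sup>2"] sum.delta cong: if_cong)
    qed
  qed
  moreover have "(\<Sum>k\<in>UNIV. axis k (F x $ k)) = F x" for x
    by (simp add: vec_eq_iff axis_def sum.delta' if_distrib cong: if_cong)
  ultimately show ?thesis by simp
qed

lemma strictly_differentiable_lipschitz:
  assumes "strictly_differentiable_at f a"
  shows "\<exists>\<rho>>0. \<exists>L\<ge>0. \<forall>x\<in>ball a \<rho>. \<forall>y\<in>ball a \<rho>. norm (f x - f y) \<le> L * norm (x - y)"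
proof -
  obtain f' where "has_strict_derivative f f' a" using assms unfolding strictly_differentiable_at_def by blast
  then obtain L \<rho> where "0 < \<rho>" "0 \<le> L" "\<forall>x\<in>ball a \<rho>. \<forall>y\<in>ball a \<rho>. norm (f x - f y) \<le> L * norm (x - y)"
    by (rule has_strict_derivative_lipschitz)
  then show ?thesis by blast
qed

section \<open>Absolutely continuous functions\<close>

text \<open>The quotients are taken over intervals that contain \<open>t\<close>, so the bound concerns both sides of \<open>t\<close> at
  once. In this form it also makes sense for the maximum of two differentiable functions at a
  point where their graphs cross.\<close>
definition upper_slope_le :: "real set \<Rightarrow> (real \<Rightarrow> real) \<Rightarrow> real \<Rightarrow> real \<Rightarrow> bool" where
  "upper_slope_le S f t B \<longleftrightarrow>
     (\<forall>\<epsilon>>0. \<exists>d>0. \<forall>y\<in>S. \<forall>z\<in>S. y \<le> t \<and> t \<le> z \<and> z - y < d \<longrightarrow> f z - f y \<le> (B + \<epsilon>) * (z - y))"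

lemma absolutely_continuousE:
  assumes "absolutely_continuous_on_interval I X" "\<epsilon> > 0"
  obtains \<delta> where "\<delta> > 0"
    and "\<And>P. finite P \<Longrightarrow> \<forall>(a, c)\<in>P. a \<le> c \<and> {a..c} \<subseteq> I \<Longrightarrow>
        pairwise (\<lambda>(a, c) (a', c'). {a<..<c} \<inter> {a'<..<c'} = {}) P \<Longrightarrow>
        (\<Sum>(a, c)\<in>P. c - a) < \<delta> \<Longrightarrow> (\<Sum>(a, c)\<in>P. norm (X c - X a)) < \<epsilon>"
proof -
  from assms(1)[unfolded absolutely_continuous_on_interval_def, THEN spec, THEN mp, OF assms(2)]
  show ?thesis by (elim exE conjE) (rule that, assumption, simp)
qed

text \<open>A gauge makes the intervals of a tagged division short wherever the slope bound holds at the tag, and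
  puts the remaining intervals into an open set of small measure around the exceptional null set. The
  former contribute at most \<open>B + \<epsilon>\<close> times their length, the latter little by absolute continuity.\<close>
lemma growth_le_of_upper_slope:
  fixes f :: "real \<Rightarrow> real"
  assumes ac: "absolutely_continuous_on_interval {a..b} f" and "a \<le> b"
    and slope: "AE t in lebesgue. t \<in> {a..b} \<longrightarrow> upper_slope_le {a..b} f t B"
  shows "f b - f a \<le> B * (b - a)"
proof -
  obtain N where N: "N \<in> null_sets lebesgue"
    and good: "\<And>t. t \<notin> N \<Longrightarrow> t \<in> {a..b} \<Longrightarrow> upper_slope_le {a..b} f t B"
    using slope by (auto elim!: AE_E3)
  have approx: "f b - f a \<le> (B + \<epsilon>) * (b - a) + \<epsilon> + \<bar>B + \<epsilon>\<bar> * \<epsilon>" if "\<epsilon> > 0" for \<epsilon>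
  proof -
    obtain \<delta>0 where "\<delta>0 > 0" and \<delta>0: "\<And>P. finite P \<Longrightarrow> \<forall>(a', c)\<in>P. a' \<le> c \<and> {a'..c} \<subseteq> {a..b} \<Longrightarrow>
        pairwise (\<lambda>(a, c) (a', c'). {a<..<c} \<inter> {a'<..<c'} = {}) P \<Longrightarrow>
        (\<Sum>(a, c)\<in>P. c - a) < \<delta>0 \<Longrightarrow> (\<Sum>(a, c)\<in>P. norm (f c - f a)) < \<epsilon>"
      by (rule absolutely_continuousE[OF ac \<open>\<epsilon> > 0\<close>]) (rule that, assumption, simp)
    \<comment> \<open>Also at most \<open>\<epsilon>\<close>, which bounds the length of the exceptional intervals.\<close>
    define \<delta> where "\<delta> = min \<delta>0 \<epsilon>"
    have "\<delta> > 0" "\<delta> \<le> \<delta>0" "\<delta> \<le> \<epsilon>" using \<open>\<delta>0 > 0\<close> \<open>\<epsilon> > 0\<close> by (auto simp: \<delta>_def)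
    obtain U where "open U" "N \<subseteq> U" and U: "U - N \<in> lmeasurable" "emeasure lebesgue (U - N) < ennreal \<delta>"
      using sets_lebesgue_outer_open[of N \<delta>] N \<open>\<delta> > 0\<close> by blast
    have eU: "emeasure lebesgue U < ennreal \<delta>"
    proof -
      have "U = (U - N) \<union> N" using \<open>N \<subseteq> U\<close> by auto
      then have "emeasure lebesgue U = emeasure lebesgue (U - N)"
        using emeasure_Un_null_set[OF _ N, of "U - N"] U(1) by (metis fmeasurableD)
      then show ?thesis using U(2) by simp
    qed
    have Um: "U \<in> lmeasurable"
      using \<open>open U\<close> eU by (auto simp: fmeasurable_def less_top[symmetric])
    have mU: "measure lebesgue U < \<delta>"
      using eU \<open>\<delta> > 0\<close> Um by (simp add: emeasure_eq_measure2 ennreal_less_iff)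
    have "\<forall>t. \<exists>d>0. t \<notin> N \<and> t \<in> {a..b} \<longrightarrow> (\<forall>y\<in>{a..b}. \<forall>z\<in>{a..b}. y \<le> t \<and> t \<le> z \<and> z - y < d \<longrightarrow> f z - f y \<le> (B + \<epsilon>) * (z - y))"
    proof
      fix t
      show "\<exists>d>0. t \<notin> N \<and> t \<in> {a..b} \<longrightarrow> (\<forall>y\<in>{a..b}. \<forall>z\<in>{a..b}. y \<le> t \<and> t \<le> z \<and> z - y < d \<longrightarrow> f z - f y \<le> (B + \<epsilon>) * (z - y))"
      proof (cases "t \<notin> N \<and> t \<in> {a..b}")
        case True
        then show ?thesis using good[of t] \<open>\<epsilon> > 0\<close> unfolding upper_slope_le_def by blast
      next
        case False
        then show ?thesis using zero_less_one by blast
      qed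
    qed
    then obtain d where d: "\<And>t. d t > 0"
      and dgood: "\<And>t y z. t \<notin> N \<Longrightarrow> t \<in> {a..b} \<Longrightarrow> y \<in> {a..b} \<Longrightarrow> z \<in> {a..b} \<Longrightarrow> y \<le> t \<Longrightarrow> t \<le> z \<Longrightarrow> z - y < d t
           \<Longrightarrow> f z - f y \<le> (B + \<epsilon>) * (z - y)"
      by metis
    define g where "g t = (if t \<in> N then U else ball t (d t / 2))" for t
    have "gauge g"
      using \<open>open U\<close> \<open>N \<subseteq> U\<close> d by (auto simp: gauge_def g_def)
    then obtain p where p: "p tagged_division_of {a..b}" and fine: "g fine p"
      using fine_division_exists_real by blast
    have kint: "\<exists>u v. k = {u..v} \<and> u \<le> x \<and> x \<le> v \<and> a \<le> u \<and> v \<le> b \<and> Inf k = u \<and> Sup k = v" if "(x, k) \<in> p" for x k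
    proof -
      obtain u v where uv: "k = cbox u v" using tagged_division_ofD(4)[OF p \<open>(x, k) \<in> p\<close>] by blast
      have "x \<in> k" "k \<subseteq> {a..b}" using tagged_division_ofD(2,3)[OF p \<open>(x, k) \<in> p\<close>] by auto
      then have "k = {u..v} \<and> u \<le> x \<and> x \<le> v \<and> a \<le> u \<and> v \<le> b \<and> Inf k = u \<and> Sup k = v"
        using uv by auto
      then show ?thesis by blast
    qed
    have finp: "finite p" using p by (rule tagged_division_of_finite)
    have tot: "(\<Sum>(x,k)\<in>p. F (Sup k) - F (Inf k)) = F b - F a" for F :: "real \<Rightarrow> real"
      using additive_tagged_division_1[OF \<open>a \<le> b\<close> p] .
    define bad where "bad = {(x,k) \<in> p. x \<in> N \<and> Inf k < Sup k}"
    define P where "P = (\<lambda>(x,k). (Inf k, Sup k)) ` bad"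
    have badp: "bad \<subseteq> p" and finbad: "finite bad"
      using finp by (auto simp: bad_def intro: finite_subset[OF _ finp])
    have disj: "{Inf k<..<Sup k} \<inter> {Inf k'<..<Sup k'} = {}" if "(x,k) \<in> p" "(x',k') \<in> p" "(x,k) \<noteq> (x',k')" for x k x' k'
    proof -
      have "interior k \<inter> interior k' = {}" using tagged_division_ofD(5)[OF p that] .
      moreover have "interior k = {Inf k<..<Sup k}" "interior k' = {Inf k'<..<Sup k'}"
        using kint[OF that(1)] kint[OF that(2)] by (metis interior_atLeastAtMost_real)+
      ultimately show ?thesis by simp
    qed
    have inj: "inj_on (\<lambda>(x,k). (Inf k, Sup k)) bad"
    proof (rule inj_onI, clarify)
      fix x k x' k' assume *: "(x,k) \<in> bad" "(x',k') \<in> bad" "Inf k = Inf k'" "Sup k = Sup k'"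
      then have "(x,k) \<in> p" "(x',k') \<in> p" "Inf k < Sup k" by (auto simp: bad_def)
      then have "{Inf k<..<Sup k} \<inter> {Inf k'<..<Sup k'} \<noteq> {}" using * by auto
      then show "x = x' \<and> k = k'" using disj[of x k x' k'] \<open>(x,k) \<in> p\<close> \<open>(x',k') \<in> p\<close> by auto
    qed
    have finP: "finite P" using finbad by (simp add: P_def)
    have Psub: "\<forall>(a', c)\<in>P. a' \<le> c \<and> {a'..c} \<subseteq> {a..b}"
    proof (clarify)
      fix a' c assume "(a', c) \<in> P"
      then obtain x k where "(x,k) \<in> bad" "a' = Inf k" "c = Sup k" by (auto simp: P_def)
      then show "a' \<le> c \<and> {a'..c} \<subseteq> {a..b}" using kint[of x k] badp by auto
    qed
    have Pdisj: "pairwise (\<lambda>(a, c) (a', c'). {a<..<c} \<inter> {a'<..<c'} = {}) P"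
      unfolding pairwise_def
    proof (intro ballI impI)
      fix q q' assume "q \<in> P" "q' \<in> P" "q \<noteq> q'"
      then obtain x k x' k' where k: "(x,k) \<in> bad" "q = (Inf k, Sup k)" and k': "(x',k') \<in> bad" "q' = (Inf k', Sup k')"
        by (auto simp: P_def)
      with \<open>q \<noteq> q'\<close> have "(x,k) \<noteq> (x',k')" by auto
      show "(case q of (a, c) \<Rightarrow> \<lambda>(a', c'). {a<..<c} \<inter> {a'<..<c'} = {}) q'"
        using disj[of x k x' k'] k k' badp \<open>(x,k) \<noteq> (x',k')\<close> by auto
    qed
    have Plen: "(\<Sum>(a, c)\<in>P. c - a) < \<delta>"
    proof -
      let ?I = "\<lambda>q::real\<times>real. {fst q<..<snd q}"
      have "(\<Sum>(a, c)\<in>P. c - a) = (\<Sum>q\<in>P. measure lebesgue (?I q))"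
        using Psub by (intro sum.cong) auto
      also have "\<dots> = measure lebesgue (\<Union>q\<in>P. ?I q)"
      proof (rule measure_finite_Union[symmetric])
        show "disjoint_family_on ?I P"
          using Pdisj unfolding disjoint_family_on_def pairwise_def by (auto simp: case_prod_beta)
        show "emeasure lebesgue (?I q) \<noteq> \<infinity>" if "q \<in> P" for q
          using emeasure_lborel_box_finite[of "fst q" "snd q"] by simp
      qed (use finP in auto)
      also have "\<dots> \<le> measure lebesgue U"
      proof (rule measure_mono_fmeasurable)
        show "(\<Union>q\<in>P. ?I q) \<subseteq> U"
        proof clarify
          fix y u v assume "(u,v) \<in> P" "y \<in> {fst (u,v)<..<snd (u,v)}"
          then obtain x k where xk: "(x,k) \<in> bad" "u = Inf k" "v = Sup k" by (auto simp: P_def)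
          then have "k \<subseteq> U" using fine badp by (force simp: fine_def g_def bad_def)
          have "(x,k) \<in> p" using xk badp by blast
          then have "k = {u..v}" using kint[of x k] xk(2,3) by metis
          then show "y \<in> U" using \<open>k \<subseteq> U\<close> \<open>y \<in> _\<close> by auto
        qed
      qed (use Um finP in auto)
      finally show ?thesis using mU by simp
    qed
    have badsum: "(\<Sum>(x,k)\<in>bad. \<bar>f (Sup k) - f (Inf k)\<bar>) < \<epsilon>"
    proof -
      have "(\<Sum>(a, c)\<in>P. norm (f c - f a)) < \<epsilon>"
        using \<delta>0[OF finP Psub Pdisj] Plen \<open>\<delta> \<le> \<delta>0\<close> by auto
      moreover have "(\<Sum>(a, c)\<in>P. norm (f c - f a)) = (\<Sum>(x,k)\<in>bad. \<bar>f (Sup k) - f (Inf k)\<bar>)"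
        unfolding P_def by (subst sum.reindex[OF inj]) (auto intro!: sum.cong)
      ultimately show ?thesis by simp
    qed
    have badlen: "(\<Sum>(x,k)\<in>bad. Sup k - Inf k) < \<epsilon>"
    proof -
      have "(\<Sum>(a, c)\<in>P. c - a) = (\<Sum>(x,k)\<in>bad. Sup k - Inf k)"
        unfolding P_def by (subst sum.reindex[OF inj]) (auto intro!: sum.cong)
      then show ?thesis using Plen \<open>\<delta> \<le> \<epsilon>\<close> by simp
    qed
    have badlen0: "0 \<le> (\<Sum>(x,k)\<in>bad. Sup k - Inf k)"
      by (rule sum_nonneg) (auto simp: bad_def)
    have "f b - f a - (B + \<epsilon>) * (b - a) = (\<Sum>(x,k)\<in>p. (f (Sup k) - (B + \<epsilon>) * Sup k) - (f (Inf k) - (B + \<epsilon>) * Inf k))"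
      unfolding tot[of "\<lambda>t. f t - (B + \<epsilon>) * t"] by (simp add: algebra_simps)
    also have "\<dots> \<le> (\<Sum>(x,k)\<in>bad. (f (Sup k) - (B + \<epsilon>) * Sup k) - (f (Inf k) - (B + \<epsilon>) * Inf k))"
    proof -
      have "(\<Sum>(x,k)\<in>p - bad. (f (Sup k) - (B + \<epsilon>) * Sup k) - (f (Inf k) - (B + \<epsilon>) * Inf k)) \<le> 0"
      proof (rule sum_nonpos, clarify)
        fix x k assume xk: "(x,k) \<in> p" "(x,k) \<notin> bad"
        obtain u v where uv: "k = {u..v}" "u \<le> x" "x \<le> v" "a \<le> u" "v \<le> b" "Inf k = u" "Sup k = v"
          using kint[OF xk(1)] by blast
        show "f (Sup k) - (B + \<epsilon>) * Sup k - (f (Inf k) - (B + \<epsilon>) * Inf k) \<le> 0"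
        proof (cases "x \<in> N")
          case True
          then have "u = v" using xk uv by (auto simp: bad_def)
          then show ?thesis using uv by simp
        next
          case False
          then have "k \<subseteq> ball x (d x / 2)" using fine xk(1) by (force simp: fine_def g_def)
          moreover have "u \<in> k" "v \<in> k" using uv by auto
          ultimately have "dist x u < d x / 2" "dist x v < d x / 2" by auto
          then have "v - u < d x" unfolding dist_real_def by linarith
          then have "f v - f u \<le> (B + \<epsilon>) * (v - u)"
            using dgood[of x u v] False uv by auto
          then show ?thesis using uv by (simp add: algebra_simps)
        qed
      qed
      then show ?thesis unfolding sum.subset_diff[OF badp finp] by linarith
    qed
    also have "\<dots> = (\<Sum>(x,k)\<in>bad. f (Sup k) - f (Inf k)) - (B + \<epsilon>) * (\<Sum>(x,k)\<in>bad. Sup k - Inf k)"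
      unfolding sum_distrib_left sum_subtractf[symmetric] by (rule sum.cong) (auto simp: algebra_simps)
    also have "\<dots> \<le> \<epsilon> + \<bar>B + \<epsilon>\<bar> * \<epsilon>"
    proof -
      have "(\<Sum>(x,k)\<in>bad. f (Sup k) - f (Inf k)) \<le> (\<Sum>(x,k)\<in>bad. \<bar>f (Sup k) - f (Inf k)\<bar>)"
        by (rule sum_mono) auto
      moreover have "- ((B + \<epsilon>) * (\<Sum>(x,k)\<in>bad. Sup k - Inf k)) \<le> \<bar>B + \<epsilon>\<bar> * (\<Sum>(x,k)\<in>bad. Sup k - Inf k)"
        by (rule order_trans[OF abs_ge_minus_self]) (simp add: abs_mult abs_of_nonneg[OF badlen0])
      moreover have "\<bar>B + \<epsilon>\<bar> * (\<Sum>(x,k)\<in>bad. Sup k - Inf k) \<le> \<bar>B + \<epsilon>\<bar> * \<epsilon>"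
        using badlen by (intro mult_left_mono) auto
      ultimately show ?thesis using badsum by linarith
    qed
    finally show ?thesis by simp
  qed
  have "((\<lambda>\<epsilon>. (B + \<epsilon>) * (b - a) + \<epsilon> + \<bar>B + \<epsilon>\<bar> * \<epsilon>) \<longlongrightarrow> (B + 0) * (b - a) + 0 + \<bar>B + 0\<bar> * 0) (at_right 0)"
    by (intro tendsto_intros)
  moreover have "\<forall>\<^sub>F \<epsilon> in at_right 0. f b - f a \<le> (B + \<epsilon>) * (b - a) + \<epsilon> + \<bar>B + \<epsilon>\<bar> * \<epsilon>"
    using approx by (intro eventually_at_rightI[of 0 1]) auto
  ultimately have "f b - f a \<le> (B + 0) * (b - a) + 0 + \<bar>B + 0\<bar> * 0"
    by (rule tendsto_lowerbound) simp
  then show ?thesis by simp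
qed
lemma upper_slope_le_mono:
  assumes "upper_slope_le S f t B" "B \<le> B'" "S' \<subseteq> S"
  shows "upper_slope_le S' f t B'"
  unfolding upper_slope_le_def
proof (intro allI impI)
  fix \<epsilon> :: real assume "\<epsilon> > 0"
  then obtain d where "d > 0" and d: "\<And>y z. y \<in> S \<Longrightarrow> z \<in> S \<Longrightarrow> y \<le> t \<Longrightarrow> t \<le> z \<Longrightarrow> z - y < d
      \<Longrightarrow> f z - f y \<le> (B + \<epsilon>) * (z - y)"
    using assms(1) unfolding upper_slope_le_def by meson
  show "\<exists>d>0. \<forall>y\<in>S'. \<forall>z\<in>S'. y \<le> t \<and> t \<le> z \<and> z - y < d \<longrightarrow> f z - f y \<le> (B' + \<epsilon>) * (z - y)"
  proof (intro exI[of _ d] conjI ballI impI)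
    fix y z assume "y \<in> S'" "z \<in> S'" and yz: "y \<le> t \<and> t \<le> z \<and> z - y < d"
    then have "f z - f y \<le> (B + \<epsilon>) * (z - y)" using d assms(3) by blast
    also have "\<dots> \<le> (B' + \<epsilon>) * (z - y)" using assms(2) yz by (intro mult_right_mono) auto
    finally show "f z - f y \<le> (B' + \<epsilon>) * (z - y)" .
  qed (fact \<open>d > 0\<close>)
qed

lemma upper_slope_leI:
  assumes "t \<in> S"
    and "\<And>\<epsilon>. \<epsilon> > 0 \<Longrightarrow> \<forall>\<^sub>F y in at t within S.
           (t < y \<longrightarrow> f y - f t \<le> (B + \<epsilon>) * (y - t)) \<and> (y < t \<longrightarrow> f t - f y \<le> (B + \<epsilon>) * (t - y))"
  shows "upper_slope_le S f t B"
  unfolding upper_slope_le_def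
proof (intro allI impI)
  fix \<epsilon> :: real assume "\<epsilon> > 0"
  from assms(2)[OF this] obtain d where "d > 0" and d: "\<And>y. y \<in> S \<Longrightarrow> y \<noteq> t \<Longrightarrow> dist y t < d \<Longrightarrow>
        (t < y \<longrightarrow> f y - f t \<le> (B + \<epsilon>) * (y - t)) \<and> (y < t \<longrightarrow> f t - f y \<le> (B + \<epsilon>) * (t - y))"
    unfolding eventually_at by blast
  show "\<exists>d>0. \<forall>y\<in>S. \<forall>z\<in>S. y \<le> t \<and> t \<le> z \<and> z - y < d \<longrightarrow> f z - f y \<le> (B + \<epsilon>) * (z - y)"
  proof (intro exI[of _ d] conjI ballI impI)
    fix y z assume yz: "y \<in> S" "z \<in> S" "y \<le> t \<and> t \<le> z \<and> z - y < d"
    have "f z - f t \<le> (B + \<epsilon>) * (z - t)"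
      using d[of z] yz by (cases "z = t") (auto simp: dist_real_def)
    moreover have "f t - f y \<le> (B + \<epsilon>) * (t - y)"
      using d[of y] yz by (cases "y = t") (auto simp: dist_real_def)
    ultimately show "f z - f y \<le> (B + \<epsilon>) * (z - y)" by (simp add: algebra_simps)
  qed (fact \<open>d > 0\<close>)
qed

lemma eventually_slope_of_derivative:
  fixes f :: "real \<Rightarrow> real"
  assumes "(f has_real_derivative f') (at t within S)" "f' \<le> B" "\<epsilon> > 0"
  shows "\<forall>\<^sub>F y in at t within S.
           (t < y \<longrightarrow> f y - f t \<le> (B + \<epsilon>) * (y - t)) \<and> (y < t \<longrightarrow> f t - f y \<le> (B + \<epsilon>) * (t - y))"
proof -
  have "((\<lambda>y. (f y - f t) / (y - t)) \<longlongrightarrow> f') (at t within S)"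
    using assms(1) by (simp add: has_field_derivative_iff)
  then have "\<forall>\<^sub>F y in at t within S. (f y - f t) / (y - t) < B + \<epsilon>"
    using assms(2,3) by (intro order_tendstoD) auto
  then show ?thesis
  proof eventually_elim
    case (elim y)
    have "f y - f t \<le> (B + \<epsilon>) * (y - t)" if "t < y"
      using elim that by (simp add: divide_less_eq)
    moreover have "f t - f y \<le> (B + \<epsilon>) * (t - y)" if "y < t"
      using elim that by (simp add: divide_less_eq algebra_simps)
    ultimately show ?case by blast
  qed
qed

lemma upper_slope_of_derivative:
  fixes f :: "real \<Rightarrow> real"
  assumes "(f has_real_derivative f') (at t within S)" "f' \<le> B" "t \<in> S"
  shows "upper_slope_le S f t B"
  using eventually_slope_of_derivative[OF assms(1,2)] assms(3) by (intro upper_slope_leI) auto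

text \<open>Where the functions differ, the larger one is the maximum nearby; where they agree, the slopes of
  both are bounded.\<close>
lemma upper_slope_max:
  fixes p q :: "real \<Rightarrow> real"
  assumes t: "t \<in> S"
    and p: "(p has_real_derivative p') (at t within S)" "q t \<le> p t \<Longrightarrow> p' \<le> B"
    and q: "(q has_real_derivative q') (at t within S)" "p t \<le> q t \<Longrightarrow> q' \<le> B"
  shows "upper_slope_le S (\<lambda>s. max (p s) (q s)) t B"
proof (rule upper_slope_leI[OF t])
  fix \<epsilon> :: real assume \<epsilon>: "\<epsilon> > 0"
  have cp: "(p \<longlongrightarrow> p t) (at t within S)" and cq: "(q \<longlongrightarrow> q t) (at t within S)"
    using p(1) q(1) DERIV_continuous continuous_within by blast+
  have ep: "\<forall>\<^sub>F y in at t within S. q t \<le> p t \<longrightarrow>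
      (t < y \<longrightarrow> p y - p t \<le> (B + \<epsilon>) * (y - t)) \<and> (y < t \<longrightarrow> p t - p y \<le> (B + \<epsilon>) * (t - y))"
    using eventually_slope_of_derivative[OF p(1) _ \<epsilon>, of B] p(2) by (cases "q t \<le> p t") auto
  have eq: "\<forall>\<^sub>F y in at t within S. p t \<le> q t \<longrightarrow>
      (t < y \<longrightarrow> q y - q t \<le> (B + \<epsilon>) * (y - t)) \<and> (y < t \<longrightarrow> q t - q y \<le> (B + \<epsilon>) * (t - y))"
    using eventually_slope_of_derivative[OF q(1) _ \<epsilon>, of B] q(2) by (cases "p t \<le> q t") auto
  have e1: "\<forall>\<^sub>F y in at t within S. p t < q t \<longrightarrow> p y < q y"
    using order_tendstoD(2)[OF tendsto_diff[OF cp cq], of 0] by (cases "p t < q t") (auto elim: eventually_mono)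
  have e2: "\<forall>\<^sub>F y in at t within S. q t < p t \<longrightarrow> q y < p y"
    using order_tendstoD(2)[OF tendsto_diff[OF cq cp], of 0] by (cases "q t < p t") (auto elim: eventually_mono)
  from ep eq e1 e2 show "\<forall>\<^sub>F y in at t within S.
      (t < y \<longrightarrow> max (p y) (q y) - max (p t) (q t) \<le> (B + \<epsilon>) * (y - t)) \<and>
      (y < t \<longrightarrow> max (p t) (q t) - max (p y) (q y) \<le> (B + \<epsilon>) * (t - y))"
  proof eventually_elim
    case (elim y)
    show ?case
    proof (cases "p t < q t \<or> q t < p t")
      case True then show ?thesis using elim by (auto simp: max_def)
    next
      case False then have "p t = q t" by simp
      then show ?thesis using elim by (auto simp: max_def)
    qed
  qed
qed

lemma absolutely_continuous_dominated:
  fixes X :: "real \<Rightarrow> 'a::real_normed_vector" and f :: "real \<Rightarrow> 'b::real_normed_vector"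
  assumes ac: "absolutely_continuous_on_interval I X" and "J \<subseteq> I"
    and dom: "\<And>s t. s \<in> J \<Longrightarrow> t \<in> J \<Longrightarrow> norm (f t - f s) \<le> K * norm (X t - X s)"
  shows "absolutely_continuous_on_interval J f"
  unfolding absolutely_continuous_on_interval_def
proof (intro allI impI)
  fix \<epsilon> :: real assume "\<epsilon> > 0"
  define K' where "K' = max K 1"
  have "K' > 0" by (simp add: K'_def)
  then have "\<epsilon> / K' > 0" using \<open>\<epsilon> > 0\<close> by simp
  obtain \<delta> where "\<delta> > 0" and \<delta>: "\<And>P. finite P \<Longrightarrow> \<forall>(a, c)\<in>P. a \<le> c \<and> {a..c} \<subseteq> I \<Longrightarrow>
        pairwise (\<lambda>(a, c) (a', c'). {a<..<c} \<inter> {a'<..<c'} = {}) P \<Longrightarrow>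
        (\<Sum>(a, c)\<in>P. c - a) < \<delta> \<Longrightarrow> (\<Sum>(a, c)\<in>P. norm (X c - X a)) < \<epsilon> / K'"
    by (rule absolutely_continuousE[OF ac \<open>\<epsilon> / K' > 0\<close>]) (rule that, assumption, simp)
  show "\<exists>\<delta>>0. \<forall>P :: (real \<times> real) set.
        finite P \<and> (\<forall>(a, c)\<in>P. a \<le> c \<and> {a..c} \<subseteq> J) \<and>
        pairwise (\<lambda>(a, c) (a', c'). {a<..<c} \<inter> {a'<..<c'} = {}) P \<and>
        (\<Sum>(a, c)\<in>P. c - a) < \<delta> \<longrightarrow> (\<Sum>(a, c)\<in>P. norm (f c - f a)) < \<epsilon>"
  proof (intro exI[of _ \<delta>] conjI allI impI)
    fix P :: "(real \<times> real) set"
    assume P: "finite P \<and> (\<forall>(a, c)\<in>P. a \<le> c \<and> {a..c} \<subseteq> J) \<and>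
        pairwise (\<lambda>(a, c) (a', c'). {a<..<c} \<inter> {a'<..<c'} = {}) P \<and> (\<Sum>(a, c)\<in>P. c - a) < \<delta>"
    then have "\<forall>(a, c)\<in>P. a \<le> c \<and> {a..c} \<subseteq> I" using \<open>J \<subseteq> I\<close> by blast
    then have X: "(\<Sum>(a, c)\<in>P. norm (X c - X a)) < \<epsilon> / K'" using \<delta>[of P] P by blast
    have "(\<Sum>(a, c)\<in>P. norm (f c - f a)) \<le> (\<Sum>(a, c)\<in>P. K' * norm (X c - X a))"
    proof (intro sum_mono, clarify)
      fix a c assume "(a, c) \<in> P"
      moreover have "\<forall>(a, c)\<in>P. a \<le> c \<and> {a..c} \<subseteq> J" using P by blast
      ultimately have "a \<le> c" "{a..c} \<subseteq> J" by blast+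
      then have "a \<in> J" "c \<in> J" by auto
      then have "norm (f c - f a) \<le> K * norm (X c - X a)" by (rule dom)
      also have "\<dots> \<le> K' * norm (X c - X a)" by (intro mult_right_mono) (auto simp: K'_def)
      finally show "norm (f c - f a) \<le> K' * norm (X c - X a)" .
    qed
    also have "\<dots> = K' * (\<Sum>(a, c)\<in>P. norm (X c - X a))" by (simp add: sum_distrib_left case_prod_beta)
    also have "\<dots> < \<epsilon>" using X \<open>K' > 0\<close> by (simp add: pos_less_divide_eq mult.commute)
    finally show "(\<Sum>(a, c)\<in>P. norm (f c - f a)) < \<epsilon>" .
  qed (fact \<open>\<delta> > 0\<close>)
qed

lemma absolutely_continuous_lipschitz:
  fixes f :: "real \<Rightarrow> 'b::real_normed_vector"
  assumes "\<And>s t. s \<in> J \<Longrightarrow> t \<in> J \<Longrightarrow> norm (f t - f s) \<le> K * \<bar>t - s\<bar>"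
  shows "absolutely_continuous_on_interval J f"
proof (rule absolutely_continuous_dominated)
  show "absolutely_continuous_on_interval UNIV (\<lambda>t::real. t)"
    unfolding absolutely_continuous_on_interval_def
  proof (intro allI impI exI conjI)
    fix \<epsilon> :: real and P :: "(real \<times> real) set"
    assume P: "finite P \<and> (\<forall>(a, c)\<in>P. a \<le> c \<and> {a..c} \<subseteq> UNIV) \<and>
        pairwise (\<lambda>(a, c) (a', c'). {a<..<c} \<inter> {a'<..<c'} = {}) P \<and> (\<Sum>(a, c)\<in>P. c - a) < \<epsilon>"
    then have "(\<Sum>(a, c)\<in>P. norm (c - a)) = (\<Sum>(a, c)\<in>P. c - a)" by (intro sum.cong) auto
    then show "(\<Sum>(a, c)\<in>P. norm (c - a)) < \<epsilon>" using P by simp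
  qed
qed (use assms in auto)

lemma is_interval_segment_subset:
  fixes I :: "real set"
  assumes "is_interval I" "u \<in> I" "v \<in> I"
  shows "{u..v} \<subseteq> I"
proof
  fix x assume "x \<in> {u..v}"
  then show "x \<in> I" using mem_is_interval_1_I[OF assms] by simp
qed

lemma absolutely_continuous_imp_continuous_on:
  fixes X :: "real \<Rightarrow> 'a::real_normed_vector"
  assumes ac: "absolutely_continuous_on_interval I X" and "is_interval I"
  shows "continuous_on I X"
  unfolding continuous_on_iff
proof (intro ballI allI impI)
  fix t e :: real assume "t \<in> I" "e > 0"
  obtain \<delta> where "\<delta> > 0" and \<delta>: "\<And>P. finite P \<Longrightarrow> \<forall>(a, c)\<in>P. a \<le> c \<and> {a..c} \<subseteq> I \<Longrightarrow>
        pairwise (\<lambda>(a, c) (a', c'). {a<..<c} \<inter> {a'<..<c'} = {}) P \<Longrightarrow>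
        (\<Sum>(a, c)\<in>P. c - a) < \<delta> \<Longrightarrow> (\<Sum>(a, c)\<in>P. norm (X c - X a)) < e"
    by (rule absolutely_continuousE[OF ac \<open>e > 0\<close>]) (rule that, assumption, simp)
  have sub: "{u..v} \<subseteq> I" if "u \<in> I" "v \<in> I" for u v
    by (rule is_interval_segment_subset[OF \<open>is_interval I\<close> that])
  have *: "norm (X v - X u) < e" if "u \<in> I" "v \<in> I" "u \<le> v" "v - u < \<delta>" for u v
    using \<delta>[of "{(u, v)}"] that sub[OF that(1,2)] by (auto simp: pairwise_def)
  show "\<exists>d>0. \<forall>x'\<in>I. dist x' t < d \<longrightarrow> dist (X x') (X t) < e"
  proof (intro exI[of _ \<delta>] conjI ballI impI)
    fix s assume "s \<in> I" "dist s t < \<delta>"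
    then show "dist (X s) (X t) < e"
      using *[of s t] *[of t s] \<open>t \<in> I\<close> by (cases "s \<le> t") (auto simp: dist_norm norm_minus_commute)
  qed (fact \<open>\<delta> > 0\<close>)
qed

lemma displacement_le_speed:
  fixes X :: "real \<Rightarrow> 'a::real_inner"
  assumes ac: "absolutely_continuous_on_interval I X" and "{a..b} \<subseteq> I" "a \<le> b"
    and speed: "AE t in lebesgue. t \<in> {a..b} \<longrightarrow> (\<exists>v. (X has_vector_derivative v) (at t within I) \<and> u \<bullet> v \<le> M)"
  shows "u \<bullet> (X b - X a) \<le> M * (b - a)"
proof -
  have "(\<lambda>t. u \<bullet> X t) b - (\<lambda>t. u \<bullet> X t) a \<le> M * (b - a)"
  proof (rule growth_le_of_upper_slope[OF _ \<open>a \<le> b\<close>])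
    show "absolutely_continuous_on_interval {a..b} (\<lambda>t. u \<bullet> X t)"
      using Cauchy_Schwarz_ineq2[of u]
      by (intro absolutely_continuous_dominated[OF ac assms(2), where K = "norm u"])
        (auto simp: inner_diff_right[symmetric])
    show "AE t in lebesgue. t \<in> {a..b} \<longrightarrow> upper_slope_le {a..b} (\<lambda>t. u \<bullet> X t) t M"
      using speed
    proof eventually_elim
      case (elim t)
      show ?case
      proof
        assume t: "t \<in> {a..b}"
        then obtain v where v: "(X has_vector_derivative v) (at t within I)" "u \<bullet> v \<le> M" using elim by blast
        have "((\<lambda>t. u \<bullet> X t) has_real_derivative u \<bullet> v) (at t within {a..b})"
          using has_vector_derivative_within_subset[OF v(1) assms(2)]
          unfolding has_vector_derivative_def has_field_derivative_def
          by (auto intro!: derivative_eq_intros simp: mult.commute)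
        then show "upper_slope_le {a..b} (\<lambda>t. u \<bullet> X t) t M"
          using v(2) t by (rule upper_slope_of_derivative)
      qed
    qed
  qed
  then show ?thesis by (simp add: inner_diff_right)
qed

lemma distance_le_speed:
  fixes X :: "real \<Rightarrow> 'a::real_inner"
  assumes ac: "absolutely_continuous_on_interval I X" and "{a..b} \<subseteq> I" "a \<le> b" "0 \<le> M"
    and speed: "AE t in lebesgue. t \<in> {a..b} \<longrightarrow> (\<exists>v. (X has_vector_derivative v) (at t within I) \<and> norm v \<le> M)"
  shows "norm (X b - X a) \<le> M * (b - a)"
proof (cases "X b = X a")
  case True
  then show ?thesis using \<open>0 \<le> M\<close> \<open>a \<le> b\<close> by simp
next
  case False
  define u where "u = X b - X a"
  have "u \<bullet> (X b - X a) \<le> (norm u * M) * (b - a)"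
  proof (rule displacement_le_speed[OF assms(1-3)])
    show "AE t in lebesgue. t \<in> {a..b} \<longrightarrow> (\<exists>v. (X has_vector_derivative v) (at t within I) \<and> u \<bullet> v \<le> norm u * M)"
      using speed
    proof eventually_elim
      case (elim t)
      have "u \<bullet> v \<le> norm u * M" if "norm v \<le> M" for v
        using norm_cauchy_schwarz[of u v] mult_left_mono[OF that norm_ge_zero[of u]] by linarith
      then show ?case using elim by blast
    qed
  qed
  then have "norm u * norm u \<le> norm u * (M * (b - a))"
    by (simp add: u_def power2_norm_eq_inner[symmetric] power2_eq_square mult.assoc)
  then show ?thesis using False by (simp add: u_def)
qed

text \<open>The maximum of \<open>V\<close> is at most \<open>C * (b - a)\<close> times itself.\<close>
lemma vanishes_by_short_gronwall:
  fixes V :: "real \<Rightarrow> real"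
  assumes ac: "absolutely_continuous_on_interval {a..b} V" and "a \<le> b"
    and nonneg: "\<And>t. t \<in> {a..b} \<Longrightarrow> 0 \<le> V t" and "V a = 0"
    and "0 \<le> C" "C * (b - a) < 1"
    and slope: "AE t in lebesgue. t \<in> {a..b} \<longrightarrow> upper_slope_le {a..b} V t (C * V t)"
    and t: "t \<in> {a..b}"
  shows "V t = 0"
proof -
  have "continuous_on {a..b} V"
    by (rule absolutely_continuous_imp_continuous_on[OF ac]) (simp add: is_interval_cc)
  then obtain m where m: "m \<in> {a..b}" "\<And>s. s \<in> {a..b} \<Longrightarrow> V s \<le> V m"
    using continuous_attains_sup[of "{a..b}" V] \<open>a \<le> b\<close> by auto
  have sub: "{a..m} \<subseteq> {a..b}" using m by auto
  have "V m - V a \<le> (C * V m) * (m - a)"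
  proof (rule growth_le_of_upper_slope)
    show "absolutely_continuous_on_interval {a..m} V"
      using sub by (rule absolutely_continuous_dominated[OF ac, where K = 1]) auto
    show "AE t in lebesgue. t \<in> {a..m} \<longrightarrow> upper_slope_le {a..m} V t (C * V m)"
      using slope
    proof eventually_elim
      case (elim s)
      show ?case
      proof
        assume s: "s \<in> {a..m}"
        then have "C * V s \<le> C * V m" using m sub \<open>0 \<le> C\<close> by (intro mult_left_mono) auto
        then show "upper_slope_le {a..m} V s (C * V m)"
          using upper_slope_le_mono[OF _ _ sub] elim s sub by blast
      qed
    qed
  qed (use m in auto)
  also have "\<dots> = V m * (C * (m - a))" by simp
  also have "\<dots> \<le> V m * (C * (b - a))"
    using m nonneg[OF m(1)] \<open>0 \<le> C\<close> by (intro mult_left_mono) auto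
  finally have "V m * (1 - C * (b - a)) \<le> 0" using \<open>V a = 0\<close> by (simp add: algebra_simps)
  then have "V m \<le> 0" using \<open>C * (b - a) < 1\<close> by (simp add: mult_le_0_iff)
  then show ?thesis using m(2)[OF t] nonneg[OF t] by linarith
qed

text \<open>Up to the first exit time the speed is at most \<open>M\<close>, which puts that time at \<open>t1 + \<delta> / M\<close> or later.\<close>
lemma stays_in_ball:
  fixes X :: "real \<Rightarrow> 'a::real_inner"
  assumes int: "is_interval I" and ac: "absolutely_continuous_on_interval I X" and "t1 \<in> I" "0 \<le> M"
    and speed: "AE t in lebesgue. t \<in> I \<and> X t \<in> ball (X t1) \<delta> \<longrightarrow>
                  (\<exists>v. (X has_vector_derivative v) (at t within I) \<and> norm v \<le> M)"
    and t: "t \<in> I" "t1 \<le> t" "M * (t - t1) < \<delta>"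
  shows "X t \<in> ball (X t1) \<delta>"
proof (rule ccontr)
  assume out: "X t \<notin> ball (X t1) \<delta>"
  have sub: "{t1..t} \<subseteq> I" by (rule is_interval_segment_subset[OF int \<open>t1 \<in> I\<close> t(1)])
  have cont: "continuous_on {t1..t} X"
    using absolutely_continuous_imp_continuous_on[OF ac int] sub continuous_on_subset by blast
  define S where "S = {s \<in> {t1..t}. \<delta> \<le> dist (X t1) (X s)}"
  have "closed S" unfolding S_def
    by (intro continuous_on_closed_Collect_le continuous_intros cont closed_atLeastAtMost)
  moreover have "t \<in> S" using out t by (auto simp: S_def)
  moreover have "bdd_below S" by (auto simp: S_def bdd_below_def)
  ultimately have m: "Inf S \<in> S" using closed_contains_Inf by blast
  define m where "m = Inf S"
  have mS: "t1 \<le> m" "m \<le> t" "\<delta> \<le> dist (X t1) (X m)" using m by (auto simp: S_def m_def)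
  have before: "X s \<in> ball (X t1) \<delta>" if "s \<in> {t1..m}" "s \<noteq> m" for s
  proof (rule ccontr)
    assume "X s \<notin> ball (X t1) \<delta>"
    then have "s \<in> S" using that mS by (auto simp: S_def)
    then have "m \<le> s" unfolding m_def using \<open>bdd_below S\<close> by (rule cInf_lower)
    then show False using that by auto
  qed
  have "AE s in lebesgue. s \<noteq> m"
    using AE_not_in[of "{m}" lebesgue] by simp
  with speed have "AE s in lebesgue. s \<in> {t1..m} \<longrightarrow> (\<exists>v. (X has_vector_derivative v) (at s within I) \<and> norm v \<le> M)"
  proof eventually_elim
    case (elim s)
    then show ?case using before[of s] sub mS by auto
  qed
  then have "norm (X m - X t1) \<le> M * (m - t1)"
    using sub mS \<open>0 \<le> M\<close> by (intro distance_le_speed[OF ac]) auto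
  also have "\<dots> \<le> M * (t - t1)" using mS \<open>0 \<le> M\<close> by (intro mult_left_mono) auto
  finally show False using mS t by (simp add: dist_norm norm_minus_commute)
qed

section \<open>Uniqueness for a field that jumps across a surface\<close>

text \<open>The velocity relation \<open>vel\<close> constrains a solution only while it is in \<open>U\<close>, since all the
  estimates are local.\<close>
definition solution_from ::
  "('a::real_normed_vector \<Rightarrow> 'a \<Rightarrow> bool) \<Rightarrow> 'a set \<Rightarrow> real \<Rightarrow> 'a \<Rightarrow> real set \<Rightarrow> (real \<Rightarrow> 'a) \<Rightarrow> bool" where
  "solution_from vel U t1 Z1 I X \<longleftrightarrow>
     is_interval I \<and> absolutely_continuous_on_interval I X \<and> t1 \<in> I \<and> X t1 = Z1 \<and>
     (AE t in lebesgue. t \<in> I \<and> X t \<in> U \<longrightarrow>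
        (\<exists>v. vel (X t) v \<and> (X has_vector_derivative v) (at t within I)))"

text \<open>The length \<open>t2 - t1\<close> is common to all pairs of solutions.\<close>
definition unique_from :: "('a::real_normed_vector \<Rightarrow> 'a \<Rightarrow> bool) \<Rightarrow> 'a set \<Rightarrow> real \<Rightarrow> 'a \<Rightarrow> bool" where
  "unique_from vel U t1 Z1 \<longleftrightarrow>
     (\<exists>t2>t1. \<forall>I I' X Y. solution_from vel U t1 Z1 I X \<and> solution_from vel U t1 Z1 I' Y \<longrightarrow>
        (\<forall>t\<in>{t1..t2} \<inter> I \<inter> I'. X t = Y t))"

text \<open>A speed bound keeps a solution in the ball for a time that depends only on \<open>M\<close> and \<open>\<delta>\<close>, and
  makes it Lipschitz in time.\<close>
lemma solution_from_local:
  fixes Z1 :: "'a::real_inner"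
  assumes sol: "solution_from vel (ball Z1 \<delta>) t1 Z1 I X" and "0 \<le> M"
    and speed: "\<forall>x\<in>ball Z1 \<delta>. \<forall>v. vel x v \<longrightarrow> norm v \<le> M"
    and t: "t \<in> I" "M * (t - t1) < \<delta>"
  shows "\<And>s. s \<in> {t1..t} \<Longrightarrow> X s \<in> ball Z1 \<delta>"
    and "AE s in lebesgue. s \<in> {t1..t} \<longrightarrow> (\<exists>v. vel (X s) v \<and> (X has_vector_derivative v) (at s within I))"
    and "{t1..t} \<subseteq> I"
    and "\<And>a b. a \<in> {t1..t} \<Longrightarrow> b \<in> {t1..t} \<Longrightarrow> norm (X b - X a) \<le> M * \<bar>b - a\<bar>"
proof -
  have int: "is_interval I" and ac: "absolutely_continuous_on_interval I X" and "t1 \<in> I" and X1: "X t1 = Z1"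
    and ae: "AE t in lebesgue. t \<in> I \<and> X t \<in> ball Z1 \<delta> \<longrightarrow>
        (\<exists>v. vel (X t) v \<and> (X has_vector_derivative v) (at t within I))"
    using sol by (auto simp: solution_from_def)
  show sub: "{t1..t} \<subseteq> I" by (rule is_interval_segment_subset[OF int \<open>t1 \<in> I\<close> t(1)])
  have sp: "AE t in lebesgue. t \<in> I \<and> X t \<in> ball (X t1) \<delta> \<longrightarrow>
      (\<exists>v. (X has_vector_derivative v) (at t within I) \<and> norm v \<le> M)"
    using ae
  proof eventually_elim
    case (elim s)
    then show ?case using speed X1 by blast
  qed
  show inb: "X s \<in> ball Z1 \<delta>" if "s \<in> {t1..t}" for s
  proof -
    have "M * (s - t1) \<le> M * (t - t1)" using that \<open>0 \<le> M\<close> by (intro mult_left_mono) auto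
    then show ?thesis
      using stays_in_ball[OF int ac \<open>t1 \<in> I\<close> \<open>0 \<le> M\<close> sp, of s] that sub t X1 by auto
  qed
  show ae': "AE s in lebesgue. s \<in> {t1..t} \<longrightarrow> (\<exists>v. vel (X s) v \<and> (X has_vector_derivative v) (at s within I))"
    using ae
  proof eventually_elim
    case (elim s)
    then show ?case using inb[of s] sub by blast
  qed
  have lip: "norm (X b - X a) \<le> M * (b - a)" if ab: "a \<in> {t1..t}" "b \<in> {t1..t}" "a \<le> b" for a b
  proof (rule distance_le_speed[OF ac])
    show "AE s in lebesgue. s \<in> {a..b} \<longrightarrow> (\<exists>v. (X has_vector_derivative v) (at s within I) \<and> norm v \<le> M)"
      using ae'
    proof eventually_elim
      case (elim s)
      then show ?case using inb[of s] speed ab by fastforce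
    qed
  qed (use sub ab \<open>0 \<le> M\<close> in auto)
  show "norm (X b - X a) \<le> M * \<bar>b - a\<bar>" if "a \<in> {t1..t}" "b \<in> {t1..t}" for a b
    using lip[of a b] lip[of b a] that by (cases "a \<le> b") (auto simp: norm_minus_commute)
qed

text \<open>The velocities of two solutions differ by a multiple \<open>\<kappa> *\<^sub>R E\<close> of a fixed vector, up to a
  term that is Lipschitz in the difference \<open>w\<close> of the solutions, and \<open>\<kappa>\<close> has the sign of the
  difference of the values of \<open>\<phi>\<close>. The projection \<open>P\<close> along \<open>E\<close> does not see that multiple. In the
  direction \<open>\<nu>\<close> it acts as a restoring force, because \<open>\<nu> \<bullet> E < 0\<close>, as long as the difference
  of the values of \<open>\<phi>\<close> has the sign of \<open>\<nu> \<bullet> w\<close>. The approximation of \<open>\<phi>\<close> by its linear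
  part guarantees the latter whenever \<open>\<bar>\<nu> \<bullet> w\<bar>\<close> is at least \<open>norm (P w)\<close>. Hence the larger of the
  two squares grows at most linearly in itself.\<close>
lemma sliding_uniqueness:
  fixes Z1 \<nu> E :: "'a::real_inner" and \<phi> :: "'a \<Rightarrow> real"
  assumes "0 < \<delta>" "0 \<le> M" "0 \<le> C"
    and speed: "\<And>x v. x \<in> ball Z1 \<delta> \<Longrightarrow> vel x v \<Longrightarrow> norm v \<le> M"
    and split: "\<And>x y v w. x \<in> ball Z1 \<delta> \<Longrightarrow> y \<in> ball Z1 \<delta> \<Longrightarrow> vel x v \<Longrightarrow> vel y w \<Longrightarrow>
          \<exists>\<kappa>. norm (v - w - \<kappa> *\<^sub>R E) \<le> C * norm (x - y) \<and> 0 \<le> \<kappa> * (\<phi> x - \<phi> y)"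
    and trans: "\<nu> \<bullet> E < 0"
    and approx: "\<And>x y. x \<in> ball Z1 \<delta> \<Longrightarrow> y \<in> ball Z1 \<delta> \<Longrightarrow> \<bar>\<phi> x - \<phi> y - \<nu> \<bullet> (x - y)\<bar> \<le> \<eta> * norm (x - y)"
    and "0 \<le> \<eta>" and small: "\<eta> * (1 + norm E / \<bar>\<nu> \<bullet> E\<bar>) < 1"
  shows "unique_from vel (ball Z1 \<delta>) t1 Z1"
proof -
  define K where "K = norm E / \<bar>\<nu> \<bullet> E\<bar>"
  have "K \<ge> 0" by (simp add: K_def)
  define P where "P w = w - ((\<nu> \<bullet> w) / (\<nu> \<bullet> E)) *\<^sub>R E" for w
  define q where "q w = max \<bar>\<nu> \<bullet> w\<bar> (norm (P w))" for w
  have PE: "P (w + \<kappa> *\<^sub>R E) = P w" for w \<kappa>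
    using trans by (simp add: P_def inner_add_right add_divide_distrib scaleR_add_left)
  have Pdiff: "P (x - y) = P x - P y" for x y
    by (simp add: P_def inner_diff_right diff_divide_distrib scaleR_diff_left)
  have nPE: "norm (((\<nu> \<bullet> w) / (\<nu> \<bullet> E)) *\<^sub>R E) = K * \<bar>\<nu> \<bullet> w\<bar>" for w
    by (simp add: K_def)
  have w_le: "norm w \<le> norm (P w) + K * \<bar>\<nu> \<bullet> w\<bar>" for w
    using norm_triangle_ineq[of "P w" "((\<nu> \<bullet> w) / (\<nu> \<bullet> E)) *\<^sub>R E"] nPE[of w] by (simp add: P_def)
  have P_le: "norm (P w) \<le> (1 + K * norm \<nu>) * norm w" for w
  proof -
    have "norm (P w) \<le> norm w + K * \<bar>\<nu> \<bullet> w\<bar>"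
      using norm_triangle_ineq4[of w "((\<nu> \<bullet> w) / (\<nu> \<bullet> E)) *\<^sub>R E"] nPE[of w] by (simp add: P_def)
    also have "\<dots> \<le> norm w + K * (norm \<nu> * norm w)"
      using \<open>K \<ge> 0\<close> Cauchy_Schwarz_ineq2 by (intro add_left_mono mult_left_mono) auto
    finally show ?thesis by (simp add: algebra_simps)
  qed
  define L where "L = 1 + norm \<nu> + K * norm \<nu>"
  have "L \<ge> 0" using \<open>K \<ge> 0\<close> by (simp add: L_def)
  have nu_le: "\<bar>\<nu> \<bullet> w\<bar> \<le> L * norm w" for w
  proof -
    have "\<bar>\<nu> \<bullet> w\<bar> \<le> norm \<nu> * norm w" by (rule Cauchy_Schwarz_ineq2)
    also have "\<dots> \<le> L * norm w" using \<open>K \<ge> 0\<close> by (intro mult_right_mono) (auto simp: L_def)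
    finally show ?thesis .
  qed
  have PL_le: "norm (P w) \<le> L * norm w" for w
    using P_le[of w] mult_right_mono[of "1 + K * norm \<nu>" L "norm w"] by (simp add: L_def)
  have q_lip: "\<bar>q x - q y\<bar> \<le> L * norm (x - y)" for x y
  proof -
    have "\<bar>\<bar>\<nu> \<bullet> x\<bar> - \<bar>\<nu> \<bullet> y\<bar>\<bar> \<le> L * norm (x - y)"
      using nu_le[of "x - y"] by (simp add: inner_diff_right)
    moreover have "\<bar>norm (P x) - norm (P y)\<bar> \<le> L * norm (x - y)"
      using PL_le[of "x - y"] norm_triangle_ineq3[of "P x" "P y"] by (simp add: Pdiff)
    ultimately show ?thesis unfolding q_def by linarith
  qed
  have q_le: "q w \<le> L * norm w" "0 \<le> q w" for w
    using nu_le[of w] PL_le[of w] by (auto simp: q_def)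
  have q_sq: "(q w)\<^sup>2 = max ((\<nu> \<bullet> w)\<^sup>2) (P w \<bullet> P w)" for w
  proof -
    have "P w \<bullet> P w = (norm (P w))\<^sup>2" "(\<nu> \<bullet> w)\<^sup>2 = \<bar>\<nu> \<bullet> w\<bar>\<^sup>2" by (simp_all add: power2_norm_eq_inner)
    moreover have "(max a b)\<^sup>2 = max (a\<^sup>2) (b\<^sup>2)" if "0 \<le> a" "0 \<le> b" for a b :: real
      using that power_mono[of a b 2] power_mono[of b a 2] by (auto simp: max_def)
    ultimately show ?thesis by (simp add: q_def)
  qed
  \<comment> \<open>Growth rate of the larger square; the factor \<open>1 + K\<close> bounds \<open>norm w\<close> by the larger component.\<close>
  define C2 where "C2 = 2 * (L * C * (1 + K))"
  have "C2 \<ge> 0" using \<open>L \<ge> 0\<close> \<open>K \<ge> 0\<close> \<open>0 \<le> C\<close> by (simp add: C2_def)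
  have slope_s: "2 * (\<nu> \<bullet> (x - y)) * (\<nu> \<bullet> (v - w)) \<le> C2 * (q (x - y))\<^sup>2"
    if x: "x \<in> ball Z1 \<delta>" "y \<in> ball Z1 \<delta>" "vel x v" "vel y w"
      and dom: "P (x - y) \<bullet> P (x - y) \<le> (\<nu> \<bullet> (x - y))\<^sup>2" for x y v w
  proof -
    define s where "s = \<nu> \<bullet> (x - y)"
    obtain \<kappa> where \<kappa>: "norm (v - w - \<kappa> *\<^sub>R E) \<le> C * norm (x - y)" "0 \<le> \<kappa> * (\<phi> x - \<phi> y)"
      using split[OF x] by blast
    define R where "R = v - w - \<kappa> *\<^sub>R E"
    have vw: "v - w = R + \<kappa> *\<^sub>R E" by (simp add: R_def)
    have "norm (P (x - y)) \<le> \<bar>s\<bar>"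
      using dom by (simp add: s_def power2_norm_eq_inner[symmetric] abs_le_square_iff[symmetric])
    then have w1: "norm (x - y) \<le> (1 + K) * \<bar>s\<bar>" using w_le[of "x - y"] by (simp add: s_def algebra_simps)
    have \<kappa>s: "0 \<le> \<kappa> * s"
    proof (cases "s = 0")
      case False
      have "\<bar>\<phi> x - \<phi> y - s\<bar> \<le> \<eta> * ((1 + K) * \<bar>s\<bar>)"
        using approx[OF x(1,2)] mult_left_mono[OF w1 \<open>0 \<le> \<eta>\<close>] by (simp add: s_def)
      also have "\<dots> = (\<eta> * (1 + K)) * \<bar>s\<bar>" by simp
      also have "\<dots> < 1 * \<bar>s\<bar>" using small False by (intro mult_strict_right_mono) (auto simp: K_def)
      finally have "\<bar>\<phi> x - \<phi> y - s\<bar> < \<bar>s\<bar>" by simp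
      then have "(s > 0 \<and> \<phi> x - \<phi> y > 0) \<or> (s < 0 \<and> \<phi> x - \<phi> y < 0)" by linarith
      then show ?thesis using \<kappa>(2) by (auto simp: zero_le_mult_iff)
    qed simp
    have "s * (\<nu> \<bullet> (v - w)) = s * (\<nu> \<bullet> R) + (\<kappa> * s) * (\<nu> \<bullet> E)"
      by (simp add: vw inner_add_right algebra_simps)
    also have "\<dots> \<le> s * (\<nu> \<bullet> R)"
      using \<kappa>s trans by (simp add: mult_nonneg_nonpos)
    also have "\<dots> \<le> \<bar>s\<bar> * \<bar>\<nu> \<bullet> R\<bar>" by (metis abs_ge_self abs_mult)
    also have "\<dots> \<le> \<bar>s\<bar> * (L * (C * ((1 + K) * \<bar>s\<bar>)))"
    proof (intro mult_left_mono)
      have "norm R \<le> C * ((1 + K) * \<bar>s\<bar>)"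
        using \<kappa>(1) mult_left_mono[OF w1 \<open>0 \<le> C\<close>] by (simp add: R_def)
      then show "\<bar>\<nu> \<bullet> R\<bar> \<le> L * (C * ((1 + K) * \<bar>s\<bar>))"
        using nu_le[of R] mult_left_mono[of "norm R" _ L] \<open>L \<ge> 0\<close> by fastforce
    qed simp
    finally have "2 * (s * (\<nu> \<bullet> (v - w))) \<le> C2 * \<bar>s\<bar>\<^sup>2"
      by (simp add: C2_def power2_eq_square algebra_simps)
    moreover have "C2 * \<bar>s\<bar>\<^sup>2 \<le> C2 * (q (x - y))\<^sup>2"
      unfolding q_sq s_def using \<open>C2 \<ge> 0\<close> by (intro mult_left_mono) auto
    ultimately show ?thesis unfolding s_def by linarith
  qed
  have slope_P: "2 * (P (x - y) \<bullet> P (v - w)) \<le> C2 * (q (x - y))\<^sup>2"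
    if x: "x \<in> ball Z1 \<delta>" "y \<in> ball Z1 \<delta>" "vel x v" "vel y w"
      and dom: "(\<nu> \<bullet> (x - y))\<^sup>2 \<le> P (x - y) \<bullet> P (x - y)" for x y v w
  proof -
    define p where "p = norm (P (x - y))"
    obtain \<kappa> where \<kappa>: "norm (v - w - \<kappa> *\<^sub>R E) \<le> C * norm (x - y)"
      using split[OF x] by blast
    define R where "R = v - w - \<kappa> *\<^sub>R E"
    have vw: "v - w = R + \<kappa> *\<^sub>R E" by (simp add: R_def)
    have "\<bar>\<nu> \<bullet> (x - y)\<bar> \<le> p"
      using dom unfolding p_def by (simp add: power2_norm_eq_inner[symmetric] power2_le_iff_abs_le)
    then have "norm (x - y) \<le> p + K * p"
      using w_le[of "x - y"] mult_left_mono[of "\<bar>\<nu> \<bullet> (x - y)\<bar>" p K] \<open>K \<ge> 0\<close> by (simp add: p_def)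
    then have w1: "norm (x - y) \<le> (1 + K) * p" by (simp add: algebra_simps)
    have "P (x - y) \<bullet> P (v - w) = P (x - y) \<bullet> P R" unfolding vw PE ..
    also have "\<dots> \<le> p * norm (P R)" unfolding p_def by (rule norm_cauchy_schwarz)
    also have "\<dots> \<le> p * (L * (C * ((1 + K) * p)))"
    proof (intro mult_left_mono)
      have "norm R \<le> C * ((1 + K) * p)"
        using \<kappa>(1) mult_left_mono[OF w1 \<open>0 \<le> C\<close>] by (simp add: R_def)
      then show "norm (P R) \<le> L * (C * ((1 + K) * p))"
        using PL_le[of R] mult_left_mono[of "norm R" _ L] \<open>L \<ge> 0\<close> by fastforce
    qed (simp add: p_def)
    finally have "2 * (P (x - y) \<bullet> P (v - w)) \<le> C2 * p\<^sup>2"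
      by (simp add: C2_def power2_eq_square algebra_simps)
    moreover have "C2 * p\<^sup>2 \<le> C2 * (q (x - y))\<^sup>2"
      unfolding q_sq p_def power2_norm_eq_inner using \<open>C2 \<ge> 0\<close> by (intro mult_left_mono) auto
    ultimately show ?thesis by linarith
  qed
  \<comment> \<open>Short enough to stay in the ball and for \<open>vanishes_by_short_gronwall\<close>.\<close>
  define h where "h = min (\<delta> / (2 * (M + 1))) (1 / (2 * (C2 + 1)))"
  have "h > 0" using \<open>0 < \<delta>\<close> \<open>0 \<le> M\<close> \<open>C2 \<ge> 0\<close> by (simp add: h_def)
  have "M * h \<le> (M + 1) * (\<delta> / (2 * (M + 1)))"
    using \<open>0 \<le> M\<close> \<open>h > 0\<close> by (intro mult_mono) (auto simp: h_def)
  also have "\<dots> = \<delta> / 2" using \<open>0 \<le> M\<close> by (simp add: field_simps)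
  finally have Mh: "M * h < \<delta>" using \<open>0 < \<delta>\<close> by simp
  have "C2 * h \<le> (C2 + 1) * (1 / (2 * (C2 + 1)))"
    using \<open>0 \<le> C2\<close> \<open>h > 0\<close> by (intro mult_mono) (auto simp: h_def)
  also have "\<dots> = 1 / 2" using \<open>0 \<le> C2\<close> by (simp add: field_simps)
  finally have Ch: "C2 * h < 1" by simp
  have "X t = Y t"
    if X: "solution_from vel (ball Z1 \<delta>) t1 Z1 I X" and Y: "solution_from vel (ball Z1 \<delta>) t1 Z1 I' Y"
      and t: "t \<in> {t1..t1 + h} \<inter> I \<inter> I'" for I I' X Y t
  proof -
    have "M * (t - t1) \<le> M * h" "C2 * (t - t1) \<le> C2 * h"
      using t \<open>0 \<le> M\<close> \<open>0 \<le> C2\<close> by (auto intro!: mult_left_mono)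
    then have Mt: "M * (t - t1) < \<delta>" and Ct: "C2 * (t - t1) < 1" using Mh Ch by auto
    have speed': "\<forall>x\<in>ball Z1 \<delta>. \<forall>v. vel x v \<longrightarrow> norm v \<le> M" using speed by blast
    have tI: "t \<in> I" "t \<in> I'" using t by auto
    note lX = solution_from_local[OF X \<open>0 \<le> M\<close> speed' tI(1) Mt]
    note lY = solution_from_local[OF Y \<open>0 \<le> M\<close> speed' tI(2) Mt]
    define V where "V s = (q (X s - Y s))\<^sup>2" for s
    have Vt: "V t = 0"
    proof (rule vanishes_by_short_gronwall[where C = C2 and V = V and a = t1 and b = t])
      have V_lip: "norm (V b - V a) \<le> (L * (2 * M) * (L * (2 * \<delta>) + L * (2 * \<delta>))) * \<bar>b - a\<bar>"
        if ab: "a \<in> {t1..t}" "b \<in> {t1..t}" for a b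
      proof -
        define x y where "x = X b - Y b" and "y = X a - Y a"
        have "norm (x - y) \<le> norm (X b - X a) + norm (Y b - Y a)"
          using norm_triangle_ineq4[of "X b - X a" "Y b - Y a"] by (simp add: x_def y_def algebra_simps)
        then have xy: "norm (x - y) \<le> 2 * M * \<bar>b - a\<bar>"
          using lX(4)[OF ab] lY(4)[OF ab] by simp
        have bd: "norm (X c - Y c) \<le> 2 * \<delta>" if "c \<in> {t1..t}" for c
        proof -
          have "dist (X c) (Y c) \<le> dist Z1 (X c) + dist Z1 (Y c)" by (rule dist_triangle3)
          then show ?thesis using lX(1)[OF that] lY(1)[OF that] by (auto simp: dist_norm)
        qed
        have "\<bar>q x + q y\<bar> \<le> L * (2 * \<delta>) + L * (2 * \<delta>)"
          using q_le[of x] q_le[of y] mult_left_mono[OF bd[OF ab(1)] \<open>L \<ge> 0\<close>]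
            mult_left_mono[OF bd[OF ab(2)] \<open>L \<ge> 0\<close>] by (simp add: x_def y_def)
        moreover have "\<bar>q x - q y\<bar> \<le> L * (2 * M * \<bar>b - a\<bar>)"
          using q_lip[of x y] mult_left_mono[OF xy \<open>L \<ge> 0\<close>] by linarith
        ultimately have "\<bar>q x - q y\<bar> * \<bar>q x + q y\<bar> \<le> (L * (2 * M * \<bar>b - a\<bar>)) * (L * (2 * \<delta>) + L * (2 * \<delta>))"
          by (intro mult_mono) auto
        moreover have "V b - V a = (q x - q y) * (q x + q y)"
          by (simp add: V_def x_def y_def power2_eq_square algebra_simps)
        ultimately show ?thesis by (simp add: abs_mult mult_ac)
      qed
      show "absolutely_continuous_on_interval {t1..t} V"
        by (rule absolutely_continuous_lipschitz) (rule V_lip)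
      have "X t1 = Z1" "Y t1 = Z1" using X Y by (auto simp: solution_from_def)
      then show "V t1 = 0" using trans by (simp add: V_def q_def P_def)
      have aX: "AE s in lebesgue. s \<in> {t1..t} \<longrightarrow> (\<exists>v. vel (X s) v \<and> (X has_vector_derivative v) (at s within I))"
        by (rule lX(2))
      have aY: "AE s in lebesgue. s \<in> {t1..t} \<longrightarrow> (\<exists>v. vel (Y s) v \<and> (Y has_vector_derivative v) (at s within I'))"
        by (rule lY(2))
      from aX aY show "AE s in lebesgue. s \<in> {t1..t} \<longrightarrow> upper_slope_le {t1..t} V s (C2 * V s)"
      proof eventually_elim
        case (elim s)
        show ?case
        proof
          assume s: "s \<in> {t1..t}"
          obtain v w where v: "vel (X s) v" "(X has_vector_derivative v) (at s within I)"
            and w: "vel (Y s) w" "(Y has_vector_derivative w) (at s within I')"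
            using elim s by blast
          have sub: "{t1..t} \<subseteq> I" "{t1..t} \<subseteq> I'" by (rule lX(3), rule lY(3))
          have inb: "X s \<in> ball Z1 \<delta>" "Y s \<in> ball Z1 \<delta>" by (rule lX(1)[OF s], rule lY(1)[OF s])
          have dW: "((\<lambda>s. X s - Y s) has_derivative (\<lambda>h. h *\<^sub>R (v - w))) (at s within {t1..t})"
            using has_vector_derivative_diff[OF has_vector_derivative_within_subset[OF v(2) sub(1)]
                has_vector_derivative_within_subset[OF w(2) sub(2)]]
            by (simp add: has_vector_derivative_def)
          have Plin: "bounded_linear P"
            unfolding P_def by (intro bounded_linear_sub bounded_linear_ident bounded_linear_scaleR_const
                bounded_linear_compose[OF bounded_linear_divide] bounded_linear_inner_right)
          have d1: "((\<lambda>s. (\<nu> \<bullet> (X s - Y s))\<^sup>2) has_real_derivative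
              2 * (\<nu> \<bullet> (X s - Y s)) * (\<nu> \<bullet> (v - w))) (at s within {t1..t})"
            unfolding has_field_derivative_def power2_eq_square
            by (rule has_derivative_eq_rhs, (rule dW derivative_intros)+) (auto simp: algebra_simps)
          have dP: "((\<lambda>s. P (X s - Y s)) has_derivative (\<lambda>h. P (h *\<^sub>R (v - w)))) (at s within {t1..t})"
            by (rule bounded_linear.has_derivative[OF Plin dW])
          have Psc: "P (h *\<^sub>R z) = h *\<^sub>R P z" for h z
            using Plin by (simp add: linear_simps)
          have d2: "((\<lambda>s. P (X s - Y s) \<bullet> P (X s - Y s)) has_real_derivative
              2 * (P (X s - Y s) \<bullet> P (v - w))) (at s within {t1..t})"
            unfolding has_field_derivative_def
            by (rule has_derivative_eq_rhs, rule has_derivative_inner[OF dP dP])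
              (simp add: fun_eq_iff Psc inner_commute[of "P (v - w)"])
          show "upper_slope_le {t1..t} V s (C2 * V s)"
            unfolding V_def using upper_slope_max[OF s d1 _ d2, of "C2 * (q (X s - Y s))\<^sup>2"]
              slope_s[OF inb v(1) w(1)] slope_P[OF inb v(1) w(1)]
            by (simp add: q_sq[symmetric])
        qed
      qed
    qed (use t Ct \<open>0 \<le> C2\<close> in \<open>auto simp: V_def\<close>)
    then have "q (X t - Y t) = 0" by (simp add: V_def)
    moreover have "norm (P (X t - Y t)) \<le> q (X t - Y t)" "\<bar>\<nu> \<bullet> (X t - Y t)\<bar> \<le> q (X t - Y t)"
      by (auto simp: q_def)
    ultimately show ?thesis using w_le[of "X t - Y t"] by simp
  qed
  then show ?thesis
    unfolding unique_from_def using \<open>h > 0\<close> by (intro exI[of _ "t1 + h"]) (auto; blast)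
qed

text \<open>A solution gains at least \<open>c\<close> per unit of time in the direction \<open>\<nu>\<close>, so it is in the region
  \<open>\<phi> > 0\<close> immediately after \<open>t1\<close>, where velocities are Lipschitz. Restricted to times after
  \<open>t1\<close> the solutions satisfy the hypotheses of \<open>sliding_uniqueness\<close> with \<open>\<kappa> = 0\<close> and
  \<open>E = - \<nu>\<close>.\<close>
lemma crossing_uniqueness:
  fixes Z1 \<nu> :: "'a::real_inner" and \<phi> :: "'a \<Rightarrow> real"
  assumes "0 < \<delta>" "0 \<le> M" "0 \<le> C" "0 < c" "\<nu> \<noteq> 0"
    and speed: "\<And>x v. x \<in> ball Z1 \<delta> \<Longrightarrow> vel x v \<Longrightarrow> norm v \<le> M"
    and advance: "\<And>x v. x \<in> ball Z1 \<delta> \<Longrightarrow> vel x v \<Longrightarrow> c \<le> \<nu> \<bullet> v"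
    and smooth: "\<And>x y v w. x \<in> ball Z1 \<delta> \<Longrightarrow> y \<in> ball Z1 \<delta> \<Longrightarrow> vel x v \<Longrightarrow> vel y w \<Longrightarrow>
          0 < \<phi> x \<Longrightarrow> 0 < \<phi> y \<Longrightarrow> norm (v - w) \<le> C * norm (x - y)"
    and "\<phi> Z1 = 0"
    and approx: "\<And>x y. x \<in> ball Z1 \<delta> \<Longrightarrow> y \<in> ball Z1 \<delta> \<Longrightarrow> \<bar>\<phi> x - \<phi> y - \<nu> \<bullet> (x - y)\<bar> \<le> \<eta> * norm (x - y)"
    and "0 \<le> \<eta>" and small: "\<eta> * (1 + 1 / norm \<nu>) < 1" "\<eta> * M < c"
  shows "unique_from vel (ball Z1 \<delta>) t1 Z1"
proof -
  define vel' where "vel' x v \<longleftrightarrow> vel x v \<and> 0 < \<phi> x" for x v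
  have "unique_from vel' (ball Z1 \<delta>) t1 Z1"
  proof (rule sliding_uniqueness[where E = "- \<nu>" and \<nu> = \<nu> and \<phi> = \<phi> and \<eta> = \<eta> and M = M and C = C])
    fix x y v w assume "x \<in> ball Z1 \<delta>" "y \<in> ball Z1 \<delta>" "vel' x v" "vel' y w"
    then have "norm (v - w) \<le> C * norm (x - y)" using smooth by (auto simp: vel'_def)
    then show "\<exists>\<kappa>. norm (v - w - \<kappa> *\<^sub>R - \<nu>) \<le> C * norm (x - y) \<and> 0 \<le> \<kappa> * (\<phi> x - \<phi> y)"
      by (intro exI[of _ 0]) auto
  next
    have "norm (- \<nu>) / \<bar>\<nu> \<bullet> - \<nu>\<bar> = 1 / norm \<nu>"
      using \<open>\<nu> \<noteq> 0\<close> by (simp add: power2_norm_eq_inner[symmetric] power2_eq_square)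
    then show "\<eta> * (1 + norm (- \<nu>) / \<bar>\<nu> \<bullet> - \<nu>\<bar>) < 1" using small(1) by simp
  qed (use assms in \<open>auto simp: vel'_def\<close>)
  then obtain t2 where "t2 > t1" and uniq: "\<And>I I' X Y t. solution_from vel' (ball Z1 \<delta>) t1 Z1 I X \<Longrightarrow>
        solution_from vel' (ball Z1 \<delta>) t1 Z1 I' Y \<Longrightarrow> t \<in> {t1..t2} \<inter> I \<inter> I' \<Longrightarrow> X t = Y t"
    unfolding unique_from_def by blast
  define h where "h = \<delta> / (2 * (M + 1))"
  have "h > 0" using \<open>0 < \<delta>\<close> \<open>0 \<le> M\<close> by (simp add: h_def)
  have "M * h \<le> (M + 1) * h" using \<open>h > 0\<close> by simp
  also have "\<dots> = \<delta> / 2" using \<open>0 \<le> M\<close> by (simp add: h_def field_simps)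
  finally have Mh: "M * h < \<delta>" using \<open>0 < \<delta>\<close> by simp
  have restrict: "solution_from vel' (ball Z1 \<delta>) t1 Z1 (I \<inter> {t1..t1 + h}) X"
    if sol: "solution_from vel (ball Z1 \<delta>) t1 Z1 I X" for I X
  proof -
    have int: "is_interval I" and ac: "absolutely_continuous_on_interval I X" and "t1 \<in> I" and X1: "X t1 = Z1"
      and ae: "AE t in lebesgue. t \<in> I \<and> X t \<in> ball Z1 \<delta> \<longrightarrow>
          (\<exists>v. vel (X t) v \<and> (X has_vector_derivative v) (at t within I))"
      using sol by (auto simp: solution_from_def)
    have pos: "0 < \<phi> (X s)" and inb: "X s \<in> ball Z1 \<delta>" if s: "s \<in> I" "t1 < s" "s \<le> t1 + h" for s
    proof -
      have "M * (s - t1) \<le> M * h" using s \<open>0 \<le> M\<close> by (intro mult_left_mono) auto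
      then have Ms: "M * (s - t1) < \<delta>" using Mh by simp
      have speed': "\<forall>x\<in>ball Z1 \<delta>. \<forall>v. vel x v \<longrightarrow> norm v \<le> M" using speed by blast
      note loc = solution_from_local[OF sol \<open>0 \<le> M\<close> speed' s(1) Ms]
      show "X s \<in> ball Z1 \<delta>" using loc(1)[of s] s by auto
      have "- \<nu> \<bullet> (X s - X t1) \<le> - c * (s - t1)"
      proof (rule displacement_le_speed[OF ac])
        show "{t1..s} \<subseteq> I" by (rule loc(3))
        show "AE r in lebesgue. r \<in> {t1..s} \<longrightarrow> (\<exists>v. (X has_vector_derivative v) (at r within I) \<and> - \<nu> \<bullet> v \<le> - c)"
          using loc(2)
        proof eventually_elim
          case (elim r)
          then show ?case using loc(1)[of r] advance[of "X r"] by fastforce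
        qed
      qed (use s in auto)
      then have "c * (s - t1) \<le> \<nu> \<bullet> (X s - Z1)" by (simp add: X1)
      moreover have "norm (X s - Z1) \<le> M * (s - t1)"
        using loc(4)[of t1 s] s X1 by auto
      then have "\<eta> * norm (X s - Z1) \<le> \<eta> * (M * (s - t1))" using \<open>0 \<le> \<eta>\<close> by (rule mult_left_mono)
      moreover have "\<eta> * (M * (s - t1)) < c * (s - t1)"
        using mult_strict_right_mono[OF small(2), of "s - t1"] s by (simp add: mult.assoc)
      moreover have "\<bar>\<phi> (X s) - \<phi> Z1 - \<nu> \<bullet> (X s - Z1)\<bar> \<le> \<eta> * norm (X s - Z1)"
        using approx[of "X s" Z1] \<open>X s \<in> ball Z1 \<delta>\<close> \<open>0 < \<delta>\<close> by simp
      ultimately show "0 < \<phi> (X s)" using \<open>\<phi> Z1 = 0\<close> by linarith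
    qed
    have "AE s in lebesgue. s \<noteq> t1" using AE_not_in[of "{t1}" lebesgue] by simp
    with ae have ae': "AE t in lebesgue. t \<in> I \<inter> {t1..t1 + h} \<and> X t \<in> ball Z1 \<delta> \<longrightarrow>
          (\<exists>v. vel' (X t) v \<and> (X has_vector_derivative v) (at t within I \<inter> {t1..t1 + h}))"
    proof eventually_elim
      case (elim t)
      show ?case
      proof
        assume t: "t \<in> I \<inter> {t1..t1 + h} \<and> X t \<in> ball Z1 \<delta>"
        then obtain v where v: "vel (X t) v" "(X has_vector_derivative v) (at t within I)" using elim by blast
        have "0 < \<phi> (X t)" using pos[of t] t elim by auto
        then show "\<exists>v. vel' (X t) v \<and> (X has_vector_derivative v) (at t within I \<inter> {t1..t1 + h})"
          using v has_vector_derivative_within_subset[OF v(2), of "I \<inter> {t1..t1 + h}"] by (auto simp: vel'_def)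
      qed
    qed
    have "absolutely_continuous_on_interval (I \<inter> {t1..t1 + h}) X"
      by (rule absolutely_continuous_dominated[OF ac, where K = 1]) auto
    then show ?thesis
      using ae' int \<open>t1 \<in> I\<close> X1 \<open>h > 0\<close>
      unfolding solution_from_def by (auto intro: is_interval_Int is_interval_cc)
  qed
  have "X t = Y t" if "solution_from vel (ball Z1 \<delta>) t1 Z1 I X" "solution_from vel (ball Z1 \<delta>) t1 Z1 I' Y"
     "t \<in> {t1..min t2 (t1 + h)} \<inter> I \<inter> I'" for I I' X Y t
    using uniq[OF restrict[OF that(1)] restrict[OF that(2)], of t] that(3) by auto
  then show ?thesis unfolding unique_from_def
    using \<open>h > 0\<close> \<open>t2 > t1\<close> by (intro exI[of _ "min t2 (t1 + h)"]) (auto; blast)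
qed

text \<open>The convex combinations of a field \<open>f\<close> and the field \<open>f + m E + \<phi> e\<close>, of which the first prevails where
  \<open>\<phi> < 0\<close> and the second where \<open>\<phi> > 0\<close>. On the surface \<open>\<phi> = 0\<close> the jump is a multiple of the constant
  vector \<open>E\<close>.\<close>
definition side_mixture ::
  "('a::real_vector \<Rightarrow> 'a) \<Rightarrow> ('a \<Rightarrow> real) \<Rightarrow> ('a \<Rightarrow> real) \<Rightarrow> 'a \<Rightarrow> 'a \<Rightarrow> 'a \<Rightarrow> 'a \<Rightarrow> bool" where
  "side_mixture f m \<phi> E e x v \<longleftrightarrow>
     (\<exists>\<alpha>\<in>{0..1}. v = f x + \<alpha> *\<^sub>R (m x *\<^sub>R E + \<phi> x *\<^sub>R e) \<and> (\<phi> x < 0 \<longrightarrow> \<alpha> = 0) \<and> (0 < \<phi> x \<longrightarrow> \<alpha> = 1))"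

text \<open>The description of the mixture with the two sides exchanged.\<close>
lemma side_mixture_flip:
  assumes "side_mixture f m \<phi> E e x v"
  shows "side_mixture (\<lambda>x. f x + m x *\<^sub>R E + \<phi> x *\<^sub>R e) m (\<lambda>x. - \<phi> x) (- E) e x v"
proof -
  obtain \<alpha> where \<alpha>: "\<alpha> \<in> {0..1}" "v = f x + \<alpha> *\<^sub>R (m x *\<^sub>R E + \<phi> x *\<^sub>R e)" "\<phi> x < 0 \<longrightarrow> \<alpha> = 0" "0 < \<phi> x \<longrightarrow> \<alpha> = 1"
    using assms unfolding side_mixture_def by blast
  show ?thesis unfolding side_mixture_def
    using \<alpha> by (intro bexI[of _ "1 - \<alpha>"]) (auto simp: algebra_simps)
qed

text \<open>In a mixture the weight times \<open>\<phi>\<close> is \<open>max \<phi> 0\<close>, so the velocity is a Lipschitz function plus a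
  multiple of \<open>E\<close> whose coefficient increases with \<open>\<phi>\<close>, up to a Lipschitz error. If \<open>E\<close> points to the
  negative side, this is the situation of \<open>sliding_uniqueness\<close>. Otherwise the second field
  points to the positive side at least as much as the first, and all solutions cross.\<close>
lemma one_sided_uniqueness_up:
  fixes Z1 \<nu> E e :: "'a::real_inner"
  assumes "0 < \<delta>0" "0 \<le> K"
    and f_lip: "\<And>x y. x \<in> ball Z1 \<delta>0 \<Longrightarrow> y \<in> ball Z1 \<delta>0 \<Longrightarrow> norm (f x - f y) \<le> K * norm (x - y)"
    and m_lip: "\<And>x y. x \<in> ball Z1 \<delta>0 \<Longrightarrow> y \<in> ball Z1 \<delta>0 \<Longrightarrow> \<bar>m x - m y\<bar> \<le> K * norm (x - y)"
    and grad: "has_strict_derivative \<phi> ((\<bullet>) \<nu>) Z1"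
    and "\<phi> Z1 = 0" "0 < m Z1" "\<nu> \<noteq> 0"
    and vel: "\<And>x v. x \<in> ball Z1 \<delta>0 \<Longrightarrow> vel x v \<Longrightarrow> side_mixture f m \<phi> E e x v"
    and up: "0 < \<nu> \<bullet> f Z1"
  shows "\<exists>\<delta>>0. \<delta> \<le> \<delta>0 \<and> unique_from vel (ball Z1 \<delta>) t1 Z1"
proof -
  define a where "a = min (\<nu> \<bullet> f Z1) (\<nu> \<bullet> (f Z1 + m Z1 *\<^sub>R E)) / 2"
  define B where "B = norm (f Z1) + m Z1 * norm E"
  define K' where "K' = K + (1 + norm \<nu>) * norm e + K * norm E"
  have "0 \<le> K'" using \<open>0 \<le> K\<close> by (simp add: K'_def)
  have "0 \<le> B" using \<open>0 < m Z1\<close> by (simp add: B_def)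
  define \<eta>1 where "\<eta>1 = min (1 / (2 * (1 + norm E / \<bar>\<nu> \<bullet> E\<bar>))) (1 / (2 * (1 + 1 / norm \<nu>)))"
  \<comment> \<open>If \<open>a > 0\<close> both fields point upwards, and \<open>a\<close> is a lower bound for the speed of the crossing.\<close>
  define \<eta> where "\<eta> = min 1 (if 0 < a then min \<eta>1 (a / (2 * (B + 2))) else \<eta>1)"
  have nn: "0 < 1 + norm E / \<bar>\<nu> \<bullet> E\<bar>" "0 < 1 + 1 / norm \<nu>"
    by (simp_all add: add_pos_nonneg)
  have "0 < \<eta>1" using nn by (simp add: \<eta>1_def)
  then have "0 < \<eta>" using \<open>0 \<le> B\<close> by (auto simp: \<eta>_def)
  have "\<eta> \<le> \<eta>1" "\<eta> \<le> 1" by (auto simp: \<eta>_def)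
  have "\<eta> * (1 + norm E / \<bar>\<nu> \<bullet> E\<bar>) \<le> 1 / (2 * (1 + norm E / \<bar>\<nu> \<bullet> E\<bar>)) * (1 + norm E / \<bar>\<nu> \<bullet> E\<bar>)"
    using nn \<open>\<eta> \<le> \<eta>1\<close> by (intro mult_right_mono) (auto simp: \<eta>1_def)
  also have "\<dots> = 1 / 2" using nn(1) by simp
  finally have small1: "\<eta> * (1 + norm E / \<bar>\<nu> \<bullet> E\<bar>) < 1" by linarith
  have "\<eta> * (1 + 1 / norm \<nu>) \<le> 1 / (2 * (1 + 1 / norm \<nu>)) * (1 + 1 / norm \<nu>)"
    using nn \<open>\<eta> \<le> \<eta>1\<close> by (intro mult_right_mono) (auto simp: \<eta>1_def)
  also have "\<dots> = 1 / 2" using nn(2) by simp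
  finally have small2: "\<eta> * (1 + 1 / norm \<nu>) < 1" by linarith
  obtain \<rho> where "\<rho> > 0" and \<rho>: "\<forall>x\<in>ball Z1 \<rho>. \<forall>y\<in>ball Z1 \<rho>. \<bar>\<phi> x - \<phi> y - \<nu> \<bullet> (x - y)\<bar> \<le> \<eta> * norm (x - y)"
    by (rule strict_gradientE[OF grad \<open>0 < \<eta>\<close>])
  \<comment> \<open>On this ball the speed is at most \<open>B + 1\<close> and \<open>m\<close> is positive.\<close>
  define \<delta>1 where "\<delta>1 = min (min \<delta>0 \<rho>) (min (1 / (K' + 1)) (m Z1 / (K + 1)))"
  define \<delta> where "\<delta> = (if 0 < a then min \<delta>1 (a / (norm \<nu> * K' + 1)) else \<delta>1)"
  have "0 < \<delta>1" using \<open>0 < \<delta>0\<close> \<open>0 < \<rho>\<close> \<open>0 \<le> K\<close> \<open>0 \<le> K'\<close> \<open>0 < m Z1\<close> by (simp add: \<delta>1_def)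
  have "0 \<le> norm \<nu> * K'" using \<open>0 \<le> K'\<close> by simp
  then have "0 < \<delta>" using \<open>0 < \<delta>1\<close> by (auto simp: \<delta>_def)
  have "\<delta> \<le> \<delta>1" by (auto simp: \<delta>_def)
  then have "\<delta> \<le> \<delta>0" "\<delta> \<le> \<rho>" "\<delta> \<le> 1 / (K' + 1)" "\<delta> \<le> m Z1 / (K + 1)" by (auto simp: \<delta>1_def)
  have in0: "x \<in> ball Z1 \<delta>0" and in\<rho>: "x \<in> ball Z1 \<rho>" if "x \<in> ball Z1 \<delta>" for x
    using that \<open>\<delta> \<le> \<delta>0\<close> \<open>\<delta> \<le> \<rho>\<close> by auto
  have Zin: "Z1 \<in> ball Z1 \<delta>" using \<open>0 < \<delta>\<close> by simp
  have ap: "\<bar>\<phi> x - \<phi> y - \<nu> \<bullet> (x - y)\<bar> \<le> \<eta> * norm (x - y)" if "x \<in> ball Z1 \<delta>" "y \<in> ball Z1 \<delta>" for x y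
    using \<rho> in\<rho> that by blast
  have \<phi>_lip: "\<bar>\<phi> x - \<phi> y\<bar> \<le> (1 + norm \<nu>) * norm (x - y)" if "x \<in> ball Z1 \<delta>" "y \<in> ball Z1 \<delta>" for x y
  proof -
    have "\<eta> * norm (x - y) \<le> 1 * norm (x - y)" using \<open>\<eta> \<le> 1\<close> by (intro mult_right_mono) auto
    then show ?thesis
      using ap[OF that] Cauchy_Schwarz_ineq2[of \<nu> "x - y"] by (simp add: algebra_simps)
  qed
  have m_pos: "0 < m x" if "x \<in> ball Z1 \<delta>" for x
  proof -
    have "norm (x - Z1) < m Z1 / (K + 1)" using that \<open>\<delta> \<le> m Z1 / (K + 1)\<close> by (auto simp: dist_norm norm_minus_commute)
    then have "norm (x - Z1) * (K + 1) < m Z1" using \<open>0 \<le> K\<close> by (simp add: pos_less_divide_eq)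
    then have "K * norm (x - Z1) < m Z1" by (simp add: algebra_simps add_strict_increasing) (smt (verit) norm_ge_zero)
    then show ?thesis using m_lip[OF in0[OF that] in0[OF Zin]] by linarith
  qed
  have near: "norm (v - (f Z1 + \<alpha> *\<^sub>R (m Z1 *\<^sub>R E))) \<le> K' * norm (x - Z1)"
    if x: "x \<in> ball Z1 \<delta>" and v: "v = f x + \<alpha> *\<^sub>R (m x *\<^sub>R E + \<phi> x *\<^sub>R e)" "\<alpha> \<in> {0..1}" for x v \<alpha>
  proof -
    let ?d = "norm (x - Z1)"
    have eq: "v - (f Z1 + \<alpha> *\<^sub>R (m Z1 *\<^sub>R E)) = (f x - f Z1) + (\<alpha> * \<phi> x) *\<^sub>R e + (\<alpha> * (m x - m Z1)) *\<^sub>R E"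
      unfolding v(1) by (simp add: algebra_simps)
    have A: "\<bar>\<alpha>\<bar> \<le> 1" using v(2) by auto
    have "\<bar>\<alpha> * \<phi> x\<bar> \<le> 1 * ((1 + norm \<nu>) * ?d)"
      unfolding abs_mult using A \<phi>_lip[OF x Zin] \<open>\<phi> Z1 = 0\<close> by (intro mult_mono) auto
    moreover have "\<bar>\<alpha> * (m x - m Z1)\<bar> \<le> 1 * (K * ?d)"
      unfolding abs_mult using A m_lip[OF in0[OF x] in0[OF Zin]] by (intro mult_mono) auto
    ultimately have "\<bar>\<alpha> * \<phi> x\<bar> * norm e \<le> (1 + norm \<nu>) * ?d * norm e" "\<bar>\<alpha> * (m x - m Z1)\<bar> * norm E \<le> K * ?d * norm E"
      by (auto intro!: mult_right_mono)
    moreover have "norm (f x - f Z1) \<le> K * ?d" by (rule f_lip[OF in0[OF x] in0[OF Zin]])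
    moreover have "norm (v - (f Z1 + \<alpha> *\<^sub>R (m Z1 *\<^sub>R E))) \<le> norm (f x - f Z1) + \<bar>\<alpha> * \<phi> x\<bar> * norm e + \<bar>\<alpha> * (m x - m Z1)\<bar> * norm E"
      unfolding eq by (rule norm_triangle_le, rule add_mono, rule norm_triangle_le) auto
    ultimately show ?thesis by (simp add: K'_def algebra_simps)
  qed
  have speed: "norm v \<le> B + 1" if x: "x \<in> ball Z1 \<delta>" "vel x v" for x v
  proof -
    obtain \<alpha> where \<alpha>: "\<alpha> \<in> {0..1}" "v = f x + \<alpha> *\<^sub>R (m x *\<^sub>R E + \<phi> x *\<^sub>R e)"
      using vel[OF in0[OF x(1)] x(2)] unfolding side_mixture_def by blast
    have "norm (x - Z1) \<le> 1 / (K' + 1)" using x \<open>\<delta> \<le> 1 / (K' + 1)\<close> by (auto simp: dist_norm norm_minus_commute)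
    then have "(K' + 1) * norm (x - Z1) \<le> 1" using \<open>0 \<le> K'\<close> by (simp add: pos_le_divide_eq mult.commute)
    then have "K' * norm (x - Z1) \<le> 1" by (simp add: algebra_simps) (smt (verit) norm_ge_zero)
    then have 1: "norm (v - (f Z1 + \<alpha> *\<^sub>R (m Z1 *\<^sub>R E))) \<le> 1" using near[OF x(1) \<alpha>(2,1)] by linarith
    have "norm (\<alpha> *\<^sub>R (m Z1 *\<^sub>R E)) \<le> 1 * (m Z1 * norm E)"
      unfolding norm_scaleR using \<alpha>(1) \<open>0 < m Z1\<close> by (intro mult_mono) auto
    then have 2: "norm (f Z1 + \<alpha> *\<^sub>R (m Z1 *\<^sub>R E)) \<le> B"
      unfolding B_def by (intro norm_triangle_le) auto
    show ?thesis
      using norm_triangle_ineq[of "v - (f Z1 + \<alpha> *\<^sub>R (m Z1 *\<^sub>R E))" "f Z1 + \<alpha> *\<^sub>R (m Z1 *\<^sub>R E)"] 1 2 by simp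
  qed
  have split: "\<exists>\<kappa>. norm (v - w - \<kappa> *\<^sub>R E) \<le> K' * norm (x - y) \<and> 0 \<le> \<kappa> * (\<phi> x - \<phi> y) \<and> (0 < \<phi> x \<and> 0 < \<phi> y \<longrightarrow> \<kappa> = 0)"
    if x: "x \<in> ball Z1 \<delta>" and y: "y \<in> ball Z1 \<delta>" and "vel x v" "vel y w" for x y v w
  proof -
    let ?d = "norm (x - y)"
    obtain \<alpha> where \<alpha>: "\<alpha> \<in> {0..1}" "v = f x + \<alpha> *\<^sub>R (m x *\<^sub>R E + \<phi> x *\<^sub>R e)" "\<phi> x < 0 \<longrightarrow> \<alpha> = 0" "0 < \<phi> x \<longrightarrow> \<alpha> = 1"
      using vel[OF in0[OF x]] \<open>vel x v\<close> unfolding side_mixture_def by blast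
    obtain \<beta> where \<beta>: "\<beta> \<in> {0..1}" "w = f y + \<beta> *\<^sub>R (m y *\<^sub>R E + \<phi> y *\<^sub>R e)" "\<phi> y < 0 \<longrightarrow> \<beta> = 0" "0 < \<phi> y \<longrightarrow> \<beta> = 1"
      using vel[OF in0[OF y]] \<open>vel y w\<close> unfolding side_mixture_def by blast
    define \<kappa> where "\<kappa> = (\<alpha> - \<beta>) * m y"
    have eq: "v - w - \<kappa> *\<^sub>R E = (f x - f y) + (\<alpha> * \<phi> x - \<beta> * \<phi> y) *\<^sub>R e + (\<alpha> * (m x - m y)) *\<^sub>R E"
      unfolding \<alpha>(2) \<beta>(2) \<kappa>_def by (simp add: algebra_simps)
    \<comment> \<open>The weight is arbitrary only where \<open>\<phi>\<close> vanishes.\<close>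
    have px: "\<alpha> * \<phi> x = max (\<phi> x) 0" using \<alpha>(3,4) by (cases "\<phi> x" "0::real" rule: linorder_cases) auto
    have py: "\<beta> * \<phi> y = max (\<phi> y) 0" using \<beta>(3,4) by (cases "\<phi> y" "0::real" rule: linorder_cases) auto
    have "\<bar>\<alpha> * \<phi> x - \<beta> * \<phi> y\<bar> \<le> \<bar>\<phi> x - \<phi> y\<bar>" unfolding px py by linarith
    then have "\<bar>\<alpha> * \<phi> x - \<beta> * \<phi> y\<bar> \<le> (1 + norm \<nu>) * ?d" using \<phi>_lip[OF x y] by linarith
    moreover have "\<bar>\<alpha> * (m x - m y)\<bar> \<le> 1 * (K * ?d)"
      unfolding abs_mult using \<alpha>(1) m_lip[OF in0[OF x] in0[OF y]] by (intro mult_mono) auto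
    ultimately have "\<bar>\<alpha> * \<phi> x - \<beta> * \<phi> y\<bar> * norm e \<le> (1 + norm \<nu>) * ?d * norm e" "\<bar>\<alpha> * (m x - m y)\<bar> * norm E \<le> K * ?d * norm E"
      by (auto intro!: mult_right_mono)
    moreover have "norm (f x - f y) \<le> K * ?d" by (rule f_lip[OF in0[OF x] in0[OF y]])
    moreover have "norm (v - w - \<kappa> *\<^sub>R E) \<le> norm (f x - f y) + \<bar>\<alpha> * \<phi> x - \<beta> * \<phi> y\<bar> * norm e + \<bar>\<alpha> * (m x - m y)\<bar> * norm E"
      unfolding eq by (rule norm_triangle_le, rule add_mono, rule norm_triangle_le) auto
    ultimately have 1: "norm (v - w - \<kappa> *\<^sub>R E) \<le> K' * ?d" by (simp add: K'_def algebra_simps)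
    have "0 \<le> (\<alpha> - \<beta>) * (\<phi> x - \<phi> y)"
    proof (cases "\<phi> x" "\<phi> y" rule: linorder_cases)
      case less
      then have "\<alpha> \<le> \<beta>" using \<alpha>(1,3,4) \<beta>(1,3,4) by (cases "\<phi> x < 0") auto
      then show ?thesis using less by (intro mult_nonpos_nonpos) auto
    next
      case greater
      then have "\<beta> \<le> \<alpha>" using \<alpha>(1,3,4) \<beta>(1,3,4) by (cases "\<phi> y < 0") auto
      then show ?thesis using greater by (intro mult_nonneg_nonneg) auto
    qed simp
    then have 2: "0 \<le> \<kappa> * (\<phi> x - \<phi> y)"
      using m_pos[OF y] unfolding \<kappa>_def by (metis less_imp_le mult.assoc mult.commute mult_nonneg_nonneg)
    have 3: "0 < \<phi> x \<and> 0 < \<phi> y \<longrightarrow> \<kappa> = 0" using \<alpha>(4) \<beta>(4) by (simp add: \<kappa>_def)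
    show ?thesis using 1 2 3 by blast
  qed
  have "unique_from vel (ball Z1 \<delta>) t1 Z1"
  proof (cases "\<nu> \<bullet> E < 0")
    case True
    show ?thesis
    proof (rule sliding_uniqueness[where \<nu> = \<nu> and E = E and \<phi> = \<phi> and \<eta> = \<eta> and M = "B + 1" and C = K'])
      fix x y v w assume "x \<in> ball Z1 \<delta>" "y \<in> ball Z1 \<delta>" "vel x v" "vel y w"
      then show "\<exists>\<kappa>. norm (v - w - \<kappa> *\<^sub>R E) \<le> K' * norm (x - y) \<and> 0 \<le> \<kappa> * (\<phi> x - \<phi> y)"
        using split by blast
    qed (use True \<open>0 < \<delta>\<close> \<open>0 \<le> B\<close> \<open>0 \<le> K'\<close> speed ap \<open>0 < \<eta>\<close> small1 in auto)
  next
    case False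
    then have "\<nu> \<bullet> f Z1 \<le> \<nu> \<bullet> (f Z1 + m Z1 *\<^sub>R E)"
      using \<open>0 < m Z1\<close> by (simp add: inner_add_right)
    then have a2: "a = (\<nu> \<bullet> f Z1) / 2" "0 < a" using up by (auto simp: a_def)
    show ?thesis
    proof (rule crossing_uniqueness[where \<nu> = \<nu> and \<phi> = \<phi> and \<eta> = \<eta> and M = "B + 1" and C = K' and c = a])
      fix x v assume x: "x \<in> ball Z1 \<delta>" "vel x v"
      obtain \<alpha> where \<alpha>: "\<alpha> \<in> {0..1}" "v = f x + \<alpha> *\<^sub>R (m x *\<^sub>R E + \<phi> x *\<^sub>R e)"
        using vel[OF in0[OF x(1)] x(2)] unfolding side_mixture_def by blast
      have "\<delta> \<le> a / (norm \<nu> * K' + 1)" using a2(2) unfolding \<delta>_def by simp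
      then have "norm (x - Z1) \<le> a / (norm \<nu> * K' + 1)"
        using x(1) unfolding mem_ball dist_norm norm_minus_commute[of Z1] by linarith
      then have "(norm \<nu> * K' + 1) * norm (x - Z1) \<le> a"
        using \<open>0 \<le> norm \<nu> * K'\<close> by (simp add: pos_le_divide_eq mult.commute)
      then have "norm \<nu> * K' * norm (x - Z1) \<le> a" by (simp add: algebra_simps) (smt (verit) norm_ge_zero)
      moreover have "\<bar>\<nu> \<bullet> (v - (f Z1 + \<alpha> *\<^sub>R (m Z1 *\<^sub>R E)))\<bar> \<le> norm \<nu> * (K' * norm (x - Z1))"
        using order_trans[OF Cauchy_Schwarz_ineq2 mult_left_mono[OF near[OF x(1) \<alpha>(2,1)]]] by simp
      moreover have "0 \<le> \<nu> \<bullet> (\<alpha> *\<^sub>R (m Z1 *\<^sub>R E))" using False \<alpha>(1) \<open>0 < m Z1\<close> by simp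
      ultimately show "a \<le> \<nu> \<bullet> v" using a2(1) by (simp add: inner_diff_right inner_add_right)
    next
      fix x y v w assume *: "x \<in> ball Z1 \<delta>" "y \<in> ball Z1 \<delta>" "vel x v" "vel y w" "0 < \<phi> x" "0 < \<phi> y"
      show "norm (v - w) \<le> K' * norm (x - y)" using split[OF *(1-4)] *(5,6) by auto
    next
      have "\<eta> * (B + 1) \<le> a / (2 * (B + 2)) * (B + 2)"
        using a2 \<open>0 \<le> B\<close> \<open>0 < \<eta>\<close> by (intro mult_mono) (auto simp: \<eta>_def)
      also have "\<dots> = a / 2" using \<open>0 \<le> B\<close> by (simp add: field_simps)
      finally show "\<eta> * (B + 1) < a" using a2 by simp
    qed (use False \<open>0 < \<delta>\<close> \<open>0 \<le> B\<close> \<open>0 \<le> K'\<close> speed ap \<open>0 < \<eta>\<close> small2 \<open>\<nu> \<noteq> 0\<close> \<open>\<phi> Z1 = 0\<close> a2 in auto)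
  qed
  then show ?thesis using \<open>0 < \<delta>\<close> \<open>\<delta> \<le> \<delta>0\<close> by blast
qed

text \<open>If the second field points to the negative side, exchange the two sides.\<close>
lemma one_sided_uniqueness:
  fixes Z1 \<nu> E e :: "'a::real_inner"
  assumes "0 < \<delta>0" "0 \<le> K"
    and f_lip: "\<And>x y. x \<in> ball Z1 \<delta>0 \<Longrightarrow> y \<in> ball Z1 \<delta>0 \<Longrightarrow> norm (f x - f y) \<le> K * norm (x - y)"
    and m_lip: "\<And>x y. x \<in> ball Z1 \<delta>0 \<Longrightarrow> y \<in> ball Z1 \<delta>0 \<Longrightarrow> \<bar>m x - m y\<bar> \<le> K * norm (x - y)"
    and grad: "has_strict_derivative \<phi> ((\<bullet>) \<nu>) Z1"
    and "\<phi> Z1 = 0" "0 < m Z1" "\<nu> \<noteq> 0"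
    and vel: "\<And>x v. x \<in> ball Z1 \<delta>0 \<Longrightarrow> vel x v \<Longrightarrow> side_mixture f m \<phi> E e x v"
    and up_or_down: "0 < \<nu> \<bullet> f Z1 \<or> \<nu> \<bullet> (f Z1 + m Z1 *\<^sub>R E) < 0"
  shows "\<exists>\<delta>>0. \<delta> \<le> \<delta>0 \<and> unique_from vel (ball Z1 \<delta>) t1 Z1"
  using up_or_down
proof
  assume up: "0 < \<nu> \<bullet> f Z1"
  show ?thesis
    by (rule one_sided_uniqueness_up[where f = f and m = m and \<phi> = \<phi> and E = E and e = e and \<nu> = \<nu> and K = K])
      (fact assms up)+
next
  assume down: "\<nu> \<bullet> (f Z1 + m Z1 *\<^sub>R E) < 0"
  obtain \<rho> where "\<rho> > 0" and \<rho>: "\<forall>x\<in>ball Z1 \<rho>. \<forall>y\<in>ball Z1 \<rho>. \<bar>\<phi> x - \<phi> y - \<nu> \<bullet> (x - y)\<bar> \<le> 1 * norm (x - y)"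
    by (rule strict_gradientE[OF grad zero_less_one])
  define \<delta>1 where "\<delta>1 = min \<delta>0 \<rho>"
  define K' where "K' = K + K * norm E + (1 + norm \<nu>) * norm e"
  have "\<exists>\<delta>>0. \<delta> \<le> \<delta>1 \<and> unique_from vel (ball Z1 \<delta>) t1 Z1"
  proof (rule one_sided_uniqueness_up[where f = "\<lambda>x. f x + m x *\<^sub>R E + \<phi> x *\<^sub>R e" and m = m
        and \<phi> = "\<lambda>x. - \<phi> x" and E = "- E" and e = e and \<nu> = "- \<nu>" and K = K'])
    show "0 < \<delta>1" using \<open>0 < \<delta>0\<close> \<open>0 < \<rho>\<close> by (simp add: \<delta>1_def)
    show "0 \<le> K'" using \<open>0 \<le> K\<close> by (simp add: K'_def)
    fix x y assume "x \<in> ball Z1 \<delta>1" "y \<in> ball Z1 \<delta>1"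
    then have x: "x \<in> ball Z1 \<delta>0" "y \<in> ball Z1 \<delta>0" and x\<rho>: "x \<in> ball Z1 \<rho>" "y \<in> ball Z1 \<rho>" by (auto simp: \<delta>1_def)
    have "K \<le> K'" using \<open>0 \<le> K\<close> by (simp add: K'_def)
    then show "\<bar>m x - m y\<bar> \<le> K' * norm (x - y)"
      using m_lip[OF x] mult_right_mono[of K K' "norm (x - y)"] by simp
    have eq: "f x + m x *\<^sub>R E + \<phi> x *\<^sub>R e - (f y + m y *\<^sub>R E + \<phi> y *\<^sub>R e) =
        (f x - f y) + (m x - m y) *\<^sub>R E + (\<phi> x - \<phi> y) *\<^sub>R e" by (simp add: algebra_simps)
    have "\<bar>\<phi> x - \<phi> y\<bar> \<le> (1 + norm \<nu>) * norm (x - y)"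
      using bspec[OF bspec[OF \<rho> x\<rho>(1)] x\<rho>(2)] Cauchy_Schwarz_ineq2[of \<nu> "x - y"] by (simp add: algebra_simps)
    then have "\<bar>\<phi> x - \<phi> y\<bar> * norm e \<le> (1 + norm \<nu>) * norm (x - y) * norm e"
      "\<bar>m x - m y\<bar> * norm E \<le> K * norm (x - y) * norm E"
      using m_lip[OF x] by (auto intro!: mult_right_mono)
    moreover have "norm (f x + m x *\<^sub>R E + \<phi> x *\<^sub>R e - (f y + m y *\<^sub>R E + \<phi> y *\<^sub>R e)) \<le>
        norm (f x - f y) + \<bar>m x - m y\<bar> * norm E + \<bar>\<phi> x - \<phi> y\<bar> * norm e"
      unfolding eq by (rule norm_triangle_le, rule add_mono, rule norm_triangle_le) auto
    ultimately show "norm (f x + m x *\<^sub>R E + \<phi> x *\<^sub>R e - (f y + m y *\<^sub>R E + \<phi> y *\<^sub>R e)) \<le> K' * norm (x - y)"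
      using f_lip[OF x] by (simp add: K'_def algebra_simps)
  next
    have "has_strict_derivative (\<lambda>x. - \<phi> x) (\<lambda>h. - (\<nu> \<bullet> h)) Z1"
      by (rule has_strict_derivative_compose[OF grad has_strict_derivative_linear[OF bounded_linear_minus[OF bounded_linear_ident]]])
    moreover have "(\<lambda>h. - (\<nu> \<bullet> h)) = (\<bullet>) (- \<nu>)" by (simp add: fun_eq_iff)
    ultimately show "has_strict_derivative (\<lambda>x. - \<phi> x) ((\<bullet>) (- \<nu>)) Z1" by simp
  next
    fix x v assume "x \<in> ball Z1 \<delta>1" "vel x v"
    then show "side_mixture (\<lambda>x. f x + m x *\<^sub>R E + \<phi> x *\<^sub>R e) m (\<lambda>x. - \<phi> x) (- E) e x v"
      by (intro side_mixture_flip vel) (auto simp: \<delta>1_def)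
  qed (use \<open>\<phi> Z1 = 0\<close> \<open>0 < m Z1\<close> \<open>\<nu> \<noteq> 0\<close> down in auto)
  then show ?thesis by (auto simp: \<delta>1_def)
qed

section \<open>Glide directions and tangents to level sets\<close>

text \<open>The component of such a vector along the rotated \<open>v\<close> is known up to sign, and together with the
  component along \<open>v\<close> it determines the vector.\<close>
lemma card_unit_vectors_same_inner_le_2:
  fixes v :: "real^2"
  assumes "v \<noteq> 0" and S: "S \<subseteq> {g. norm g = 1 \<and> v \<bullet> g = c}"
  shows "card S \<le> 2"
proof -
  define w where "w g = v $ 1 * g $ 2 - v $ 2 * g $ 1" for g :: "real^2"
  have v2: "v \<bullet> v = (v $ 1)\<^sup>2 + (v $ 2)\<^sup>2" by (simp add: inner_vec_def sum_2 power2_eq_square)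
  have lagrange: "(v \<bullet> d)\<^sup>2 + (w d)\<^sup>2 = (v \<bullet> v) * (d \<bullet> d)" for d
    unfolding w_def by (simp add: inner_vec_def sum_2 power2_eq_square algebra_simps)
  have "inj_on w S"
  proof (rule inj_onI)
    fix g h assume "g \<in> S" "h \<in> S" "w g = w h"
    then have "v \<bullet> (g - h) = 0" "w (g - h) = 0"
      using S by (auto simp: inner_diff_right w_def algebra_simps)
    then have "(v \<bullet> v) * ((g - h) \<bullet> (g - h)) = 0" using lagrange[of "g - h"] by simp
    then show "g = h" using \<open>v \<noteq> 0\<close> by simp
  qed
  then have "card S = card (w ` S)" by (simp add: card_image)
  also have "\<dots> \<le> card {sqrt (v \<bullet> v - c\<^sup>2), - sqrt (v \<bullet> v - c\<^sup>2)}"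
  proof (rule card_mono)
    show "w ` S \<subseteq> {sqrt (v \<bullet> v - c\<^sup>2), - sqrt (v \<bullet> v - c\<^sup>2)}"
    proof
      fix y assume "y \<in> w ` S"
      then obtain g where g: "g \<in> S" "y = w g" by blast
      then have "norm g = 1" "v \<bullet> g = c" using S by auto
      then have "y\<^sup>2 = v \<bullet> v - c\<^sup>2" using lagrange[of g] g by (simp add: power2_norm_eq_inner[symmetric])
      then have "sqrt (v \<bullet> v - c\<^sup>2) = \<bar>y\<bar>" by (metis real_sqrt_abs)
      then show "y \<in> {sqrt (v \<bullet> v - c\<^sup>2), - sqrt (v \<bullet> v - c\<^sup>2)}" by auto
    qed
  qed simp
  also have "\<dots> \<le> 2" by (simp add: card_insert_if)
  finally show ?thesis .
qed

lemma max_dirs_iff: "g \<in> max_dirs \<G> j k Z \<longleftrightarrow> g \<in> \<G> \<and> (\<forall>h\<in>\<G>. j k Z \<bullet> h \<le> j k Z \<bullet> g)"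
  by (auto simp: max_dirs_def is_arg_max_def not_less)

lemma max_dirs_nonempty:
  assumes "glide_directions \<G>"
  shows "max_dirs \<G> j k Z \<noteq> {}"
proof -
  have "finite \<G>" "\<G> \<noteq> {}"
    using assms by (auto simp: glide_directions_def)
  then have "Max ((\<lambda>g. j k Z \<bullet> g) ` \<G>) \<in> (\<lambda>g. j k Z \<bullet> g) ` \<G>" by (intro Max_in) auto
  then obtain g where g: "g \<in> \<G>" "Max ((\<lambda>g. j k Z \<bullet> g) ` \<G>) = j k Z \<bullet> g" by blast
  have "j k Z \<bullet> h \<le> j k Z \<bullet> g" if "h \<in> \<G>" for h
    unfolding g(2)[symmetric] using \<open>finite \<G>\<close> that by (intro Max_ge) auto
  with g(1) have "g \<in> max_dirs \<G> j k Z" by (simp add: max_dirs_iff)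
  then show ?thesis by blast
qed

text \<open>Glide directions span the plane, so one of them is not orthogonal to the force, and they come in
  opposite pairs.\<close>
lemma max_dirs_inner_pos:
  assumes G: "glide_directions \<G>" and "j k Z \<noteq> 0" and g: "g \<in> max_dirs \<G> j k Z"
  shows "0 < j k Z \<bullet> g"
proof (rule ccontr)
  assume "\<not> 0 < j k Z \<bullet> g"
  then have le: "j k Z \<bullet> h \<le> 0" if "h \<in> \<G>" for h using g that by (auto simp: max_dirs_iff)
  have "orthogonal (j k Z) h" if "h \<in> \<G>" for h
    using le[OF that] le[of "- h"] that G by (auto simp: orthogonal_def glide_directions_def)
  then have "orthogonal (j k Z) (j k Z)"
    using orthogonal_to_span[of "j k Z" \<G> "j k Z"] G by (auto simp: glide_directions_def)
  then show False using \<open>j k Z \<noteq> 0\<close> by (simp add: orthogonal_self)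
qed

lemma card_max_dirs_le_2:
  assumes G: "glide_directions \<G>" and "j k Z \<noteq> 0"
  shows "card (max_dirs \<G> j k Z) \<le> 2"
proof -
  obtain g where g: "g \<in> max_dirs \<G> j k Z" using max_dirs_nonempty[OF G] by blast
  show ?thesis
  proof (rule card_unit_vectors_same_inner_le_2[OF \<open>j k Z \<noteq> 0\<close>, where c = "j k Z \<bullet> g"])
    show "max_dirs \<G> j k Z \<subseteq> {h. norm h = 1 \<and> j k Z \<bullet> h = j k Z \<bullet> g}"
      using g G by (auto simp: max_dirs_iff glide_directions_def intro!: antisym)
  qed
qed

text \<open>The finitely many strict inequalities that exclude a direction at \<open>Z1\<close> persist nearby.\<close>
lemma max_dirs_upper_semicontinuous:
  assumes G: "glide_directions \<G>" and cont: "continuous (at Z1) (j k)"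
  shows "\<exists>\<rho>>0. \<forall>Z\<in>ball Z1 \<rho>. max_dirs \<G> j k Z \<subseteq> max_dirs \<G> j k Z1"
proof -
  obtain g where g: "g \<in> max_dirs \<G> j k Z1" using max_dirs_nonempty[OF G] by blast
  have "finite \<G>" using G by (simp add: glide_directions_def)
  have "\<forall>\<^sub>F Z in nhds Z1. \<forall>h\<in>\<G> - max_dirs \<G> j k Z1. j k Z \<bullet> h < j k Z \<bullet> g"
  proof (rule eventually_ball_finite, use \<open>finite \<G>\<close> in blast, rule ballI)
    fix h assume h: "h \<in> \<G> - max_dirs \<G> j k Z1"
    then have "j k Z1 \<bullet> h < j k Z1 \<bullet> g" using g by (auto simp: max_dirs_iff not_le intro: less_le_trans)
    moreover have "((\<lambda>Z. j k Z \<bullet> g - j k Z \<bullet> h) \<longlongrightarrow> j k Z1 \<bullet> g - j k Z1 \<bullet> h) (nhds Z1)"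
      using cont by (intro tendsto_intros) (simp_all add: continuous_at tendsto_at_iff_tendsto_nhds)
    ultimately have "\<forall>\<^sub>F Z in nhds Z1. 0 < j k Z \<bullet> g - j k Z \<bullet> h" by (intro order_tendstoD) auto
    then show "\<forall>\<^sub>F Z in nhds Z1. j k Z \<bullet> h < j k Z \<bullet> g" by eventually_elim simp
  qed
  then obtain \<rho> where \<rho>: "0 < \<rho>" "\<And>Z. dist Z Z1 < \<rho> \<Longrightarrow> \<forall>h\<in>\<G> - max_dirs \<G> j k Z1. j k Z \<bullet> h < j k Z \<bullet> g"
    unfolding eventually_nhds_metric by blast
  show ?thesis
  proof (intro exI[of _ \<rho>] conjI ballI subsetI)
    fix Z h assume "Z \<in> ball Z1 \<rho>" "h \<in> max_dirs \<G> j k Z"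
    then show "h \<in> max_dirs \<G> j k Z1"
      using \<rho>(2)[of Z] g by (auto simp: max_dirs_iff dist_commute not_le[symmetric])
  qed (fact \<rho>(1))
qed

text \<open>The admissible weights form an interval, and the mixture is its affine image.\<close>
lemma convex_side_mixture: "convex {v. side_mixture f m \<phi> E e x v}"
proof -
  define A :: "real set" where "A = {\<alpha>\<in>{0..1}. (\<phi> x < 0 \<longrightarrow> \<alpha> = 0) \<and> (0 < \<phi> x \<longrightarrow> \<alpha> = 1)}"
  have "A = (if \<phi> x < 0 then {0} else if 0 < \<phi> x then {1} else {0..1})"
    by (auto simp: A_def)
  then have "convex A" by auto
  moreover have "{v. side_mixture f m \<phi> E e x v} = (\<lambda>\<alpha>. f x + \<alpha> *\<^sub>R (m x *\<^sub>R E + \<phi> x *\<^sub>R e)) ` A"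
    unfolding side_mixture_def A_def by blast
  then have "{v. side_mixture f m \<phi> E e x v} =
      (\<lambda>v. f x + v) ` ((\<lambda>\<alpha>. \<alpha> *\<^sub>R (m x *\<^sub>R E + \<phi> x *\<^sub>R e)) ` A)"
    by (simp add: image_image)
  moreover have "linear (\<lambda>\<alpha>::real. \<alpha> *\<^sub>R (m x *\<^sub>R E + \<phi> x *\<^sub>R e))"
    by (rule linearI) (simp_all add: scaleR_add_left)
  ultimately show ?thesis
    by (simp add: convex_linear_image convex_translation)
qed

text \<open>Only the \<open>l\<close>-th component can take two values, and their difference is
  \<open>(j l Z \<bullet> gm) *\<^sub>R (gp - gm) + (j l Z \<bullet> (gp - gm)) *\<^sub>R gp\<close>.\<close>
lemma glide_velocity_side_mixture:
  fixes j :: "'n::finite force"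
  assumes l: "max_dirs \<G> j l Z \<subseteq> {gp, gm}"
    and k: "\<And>k. k \<noteq> l \<Longrightarrow> max_dirs \<G> j k Z \<subseteq> {the_elem (max_dirs \<G> j k Z1)}"
    and gs: "gp \<in> \<G>" "gm \<in> \<G>"
    and v: "v \<in> convex hull (glide_velocities \<G> j Z)"
  shows "side_mixture (local_field \<G> j l Z1 gm) (\<lambda>Z. j l Z \<bullet> gm) (\<lambda>Z. j l Z \<bullet> (gp - gm))
           (axis l (gp - gm)) (axis l gp) Z v"
proof -
  have "glide_velocities \<G> j Z \<subseteq> {v. side_mixture (local_field \<G> j l Z1 gm) (\<lambda>Z. j l Z \<bullet> gm) (\<lambda>Z. j l Z \<bullet> (gp - gm))
           (axis l (gp - gm)) (axis l gp) Z v}"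
  proof
    fix V assume V: "V \<in> glide_velocities \<G> j Z"
    then obtain g where g: "g \<in> max_dirs \<G> j l Z" "V $ l = (j l Z \<bullet> g) *\<^sub>R g"
      by (auto simp: glide_velocities_def)
    have other: "V $ k = local_field \<G> j l Z1 gm Z $ k" if "k \<noteq> l" for k
    proof -
      obtain h where "h \<in> max_dirs \<G> j k Z" "V $ k = (j k Z \<bullet> h) *\<^sub>R h"
        using V unfolding glide_velocities_def by blast
      then show ?thesis using k[OF that] that by (auto simp: local_field_def Let_def)
    qed
    from g l consider "g = gp" | "g = gm" by blast
    then show "V \<in> {v. side_mixture (local_field \<G> j l Z1 gm) (\<lambda>Z. j l Z \<bullet> gm) (\<lambda>Z. j l Z \<bullet> (gp - gm))
           (axis l (gp - gm)) (axis l gp) Z v}"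
    proof cases
      case 1
      have eq: "V = local_field \<G> j l Z1 gm Z + 1 *\<^sub>R ((j l Z \<bullet> gm) *\<^sub>R axis l (gp - gm) + (j l Z \<bullet> (gp - gm)) *\<^sub>R axis l gp)"
      proof (rule vec_eq_iff[THEN iffD2], rule allI)
        fix k
        show "V $ k = (local_field \<G> j l Z1 gm Z + 1 *\<^sub>R ((j l Z \<bullet> gm) *\<^sub>R axis l (gp - gm) + (j l Z \<bullet> (gp - gm)) *\<^sub>R axis l gp)) $ k"
          using g(2) 1 other[of k]
          by (cases "k = l") (simp_all add: axis_def local_field_def inner_diff_right algebra_simps)
      qed
      have "0 \<le> j l Z \<bullet> (gp - gm)"
        using g(1) gs 1 by (simp add: max_dirs_iff inner_diff_right)
      then show ?thesis using eq unfolding side_mixture_def by (intro CollectI bexI[of _ 1]) auto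
    next
      case 2
      have eq: "V = local_field \<G> j l Z1 gm Z"
      proof (rule vec_eq_iff[THEN iffD2], rule allI)
        fix k
        show "V $ k = local_field \<G> j l Z1 gm Z $ k"
          using g(2) 2 other[of k] by (cases "k = l") (simp_all add: local_field_def)
      qed
      have "j l Z \<bullet> (gp - gm) \<le> 0"
        using g(1) gs 2 by (simp add: max_dirs_iff inner_diff_right)
      then show ?thesis using eq unfolding side_mixture_def by (intro CollectI bexI[of _ 0]) auto
    qed
  qed
  then show ?thesis using hull_minimal[of "glide_velocities \<G> j Z" _ convex] convex_side_mixture v by blast
qed

text \<open>For small \<open>t\<close> the intermediate value theorem, applied in the direction \<open>\<nu>\<close>, provides a zero of \<open>\<phi>\<close> at
  distance \<open>O(t)\<close> from \<open>p + t *\<^sub>R v\<close>. As \<open>\<nu> \<bullet> v = 0\<close>, strict differentiability improves the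
  distance to \<open>o(t)\<close>, so these zeros form a curve with velocity \<open>v\<close>.\<close>
lemma tangent_vector_of_level_set:
  fixes \<phi> :: "'a::euclidean_space \<Rightarrow> real"
  assumes grad: "has_strict_derivative \<phi> ((\<bullet>) \<nu>) p"
    and "\<phi> p = 0" "\<nu> \<noteq> 0" and perp: "\<nu> \<bullet> v = 0"
    and "0 < \<delta>" and M: "\<And>x. x \<in> ball p \<delta> \<Longrightarrow> \<phi> x = 0 \<Longrightarrow> x \<in> M"
  shows "v \<in> tangent_vectors M p"
proof -
  define N where "N = \<nu> \<bullet> \<nu>"
  define Q where "Q = norm v + norm \<nu>"
  have "0 < N" "0 < Q" using \<open>\<nu> \<noteq> 0\<close> by (auto simp: N_def Q_def add_nonneg_pos)
  define pt where "pt t s = p + t *\<^sub>R v + s *\<^sub>R \<nu>" for t s :: real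
  have small: "norm (t *\<^sub>R v + s *\<^sub>R \<nu>) \<le> \<bar>t\<bar> * Q" if "\<bar>s\<bar> \<le> \<bar>t\<bar>" for s t
  proof -
    have "norm (t *\<^sub>R v + s *\<^sub>R \<nu>) \<le> \<bar>t\<bar> * norm v + \<bar>s\<bar> * norm \<nu>" by (intro norm_triangle_le) simp
    also have "\<dots> \<le> \<bar>t\<bar> * norm v + \<bar>t\<bar> * norm \<nu>" using that by (intro add_left_mono mult_right_mono) auto
    finally show ?thesis by (simp add: Q_def algebra_simps)
  qed
  have in_ball: "pt t s \<in> ball p \<rho>" if "\<bar>s\<bar> \<le> \<bar>t\<bar>" "\<bar>t\<bar> * Q < \<rho>" for s t \<rho>
  proof -
    have "dist p (pt t s) = norm (t *\<^sub>R v + s *\<^sub>R \<nu>)"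
      unfolding dist_commute[of p] by (simp add: pt_def dist_norm)
    then show ?thesis using small[OF that(1)] that(2) by simp
  qed
  have est: "\<bar>\<phi> (pt t s) - s * N\<bar> \<le> \<eta> * (\<bar>t\<bar> * Q)"
    if "\<forall>x\<in>ball p \<rho>. \<forall>y\<in>ball p \<rho>. \<bar>\<phi> x - \<phi> y - \<nu> \<bullet> (x - y)\<bar> \<le> \<eta> * norm (x - y)"
      "0 \<le> \<eta>" "\<bar>s\<bar> \<le> \<bar>t\<bar>" "\<bar>t\<bar> * Q < \<rho>" for \<eta> \<rho> s t
  proof -
    have "0 \<le> \<bar>t\<bar> * Q" using \<open>0 < Q\<close> by simp
    then have "p \<in> ball p \<rho>" using that(4) by simp
    then have "\<bar>\<phi> (pt t s) - \<phi> p - \<nu> \<bullet> (pt t s - p)\<bar> \<le> \<eta> * norm (pt t s - p)"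
      using that(1) in_ball[OF that(3,4)] by blast
    moreover have "\<eta> * norm (pt t s - p) \<le> \<eta> * (\<bar>t\<bar> * Q)"
      using small[OF that(3)] that(2) by (intro mult_left_mono) (auto simp: pt_def)
    ultimately show ?thesis
      using \<open>\<phi> p = 0\<close> perp by (simp add: pt_def N_def inner_add_right)
  qed
  \<comment> \<open>With this accuracy \<open>\<phi> (pt t s)\<close> has opposite signs at \<open>s = \<bar>t\<bar>\<close> and \<open>s = - \<bar>t\<bar>\<close>.\<close>
  define \<eta>0 where "\<eta>0 = N / (2 * Q)"
  have "0 < \<eta>0" using \<open>0 < N\<close> \<open>0 < Q\<close> by (simp add: \<eta>0_def)
  obtain \<rho>0 where \<rho>0: "0 < \<rho>0" "\<forall>x\<in>ball p \<rho>0. \<forall>y\<in>ball p \<rho>0. \<bar>\<phi> x - \<phi> y - \<nu> \<bullet> (x - y)\<bar> \<le> \<eta>0 * norm (x - y)"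
    by (rule strict_gradientE[OF grad \<open>0 < \<eta>0\<close>])
  have cont: "continuous_on (ball p \<rho>0) \<phi>"
  proof (rule lipschitz_on_continuous_on[of "\<eta>0 + norm \<nu>"], rule lipschitz_onI)
    fix x y assume "x \<in> ball p \<rho>0" "y \<in> ball p \<rho>0"
    then have "\<bar>\<phi> x - \<phi> y - \<nu> \<bullet> (x - y)\<bar> \<le> \<eta>0 * norm (x - y)" using \<rho>0(2) by blast
    then show "dist (\<phi> x) (\<phi> y) \<le> (\<eta>0 + norm \<nu>) * dist x y"
      using Cauchy_Schwarz_ineq2[of \<nu> "x - y"] by (simp add: dist_norm algebra_simps)
  qed (use \<open>0 < \<eta>0\<close> in simp)
  have zero: "\<exists>s. \<bar>s\<bar> \<le> \<bar>t\<bar> \<and> \<phi> (pt t s) = 0" if t: "\<bar>t\<bar> * Q < \<rho>0" for t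
  proof -
    have e: "\<eta>0 * (\<bar>t\<bar> * Q) = \<bar>t\<bar> * N / 2" using \<open>0 < Q\<close> by (simp add: \<eta>0_def)
    have "\<bar>\<phi> (pt t \<bar>t\<bar>) - \<bar>t\<bar> * N\<bar> \<le> \<bar>t\<bar> * N / 2" "\<bar>\<phi> (pt t (- \<bar>t\<bar>)) - (- \<bar>t\<bar>) * N\<bar> \<le> \<bar>t\<bar> * N / 2"
      using est[OF \<rho>0(2), of "\<bar>t\<bar>" t] est[OF \<rho>0(2), of "- \<bar>t\<bar>" t] t \<open>0 < \<eta>0\<close> e by auto
    moreover have "0 \<le> \<bar>t\<bar> * N" using \<open>0 < N\<close> by simp
    ultimately have signs: "\<phi> (pt t (- \<bar>t\<bar>)) \<le> 0 \<and> 0 \<le> \<phi> (pt t \<bar>t\<bar>)"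
      unfolding mult_minus_left by argo
    have "continuous_on {- \<bar>t\<bar>..\<bar>t\<bar>} (\<lambda>s. \<phi> (pt t s))"
    proof (rule continuous_on_compose2[OF cont])
      show "continuous_on {- \<bar>t\<bar>..\<bar>t\<bar>} (pt t)" unfolding pt_def by (intro continuous_intros)
      show "pt t ` {- \<bar>t\<bar>..\<bar>t\<bar>} \<subseteq> ball p \<rho>0" using in_ball t by (auto simp: abs_le_iff)
    qed
    then obtain s where "- \<bar>t\<bar> \<le> s" "s \<le> \<bar>t\<bar>" "\<phi> (pt t s) = 0"
      using IVT'[of "\<lambda>s. \<phi> (pt t s)" "- \<bar>t\<bar>" 0 "\<bar>t\<bar>"] signs by auto
    then show ?thesis by (intro exI[of _ s]) auto
  qed
  \<comment> \<open>Such a zero exists for small \<open>t\<close>, which determines the velocity of the curve at \<open>0\<close>.\<close>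
  define \<sigma> where "\<sigma> t = (SOME s. \<bar>s\<bar> \<le> \<bar>t\<bar> \<and> \<phi> (pt t s) = 0)" for t
  have \<sigma>: "\<bar>\<sigma> t\<bar> \<le> \<bar>t\<bar>" "\<phi> (pt t (\<sigma> t)) = 0" if "\<bar>t\<bar> * Q < \<rho>0" for t
    using someI_ex[OF zero[OF that]] by (auto simp: \<sigma>_def)
  define c where "c t = pt t (\<sigma> t)" for t
  have "\<sigma> 0 = 0" using \<sigma>(1)[of 0] \<rho>0(1) by simp
  then have c0: "c 0 = p" by (simp add: c_def pt_def)
  have near0: "\<forall>\<^sub>F t in nhds (0::real). \<bar>t\<bar> * Q < \<rho>" if "0 < \<rho>" for \<rho>
  proof -
    have "((\<lambda>t. \<bar>t\<bar> * Q) \<longlongrightarrow> \<bar>0\<bar> * Q) (nhds 0)" by (intro tendsto_intros filterlim_ident)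
    then show ?thesis using that by (intro order_tendstoD) auto
  qed
  have inM: "\<forall>\<^sub>F t in nhds 0. c t \<in> M"
    using near0[OF \<rho>0(1)] near0[OF \<open>0 < \<delta>\<close>]
  proof eventually_elim
    case (elim t)
    show ?case unfolding c_def using \<sigma>[OF elim(1)] in_ball[OF _ elim(2)] by (intro M) auto
  qed
  have "(c has_vector_derivative v) (at 0)"
    unfolding has_vector_derivative_def has_derivative_at_within
  proof (intro conjI)
    show "bounded_linear (\<lambda>x. x *\<^sub>R v)" by (rule bounded_linear_scaleR_left)
    show "((\<lambda>y. (c y - c 0 - (y - 0) *\<^sub>R v) /\<^sub>R norm (y - 0)) \<longlongrightarrow> 0) (at 0)"
    proof (rule tendstoI)
      fix \<epsilon> :: real assume "0 < \<epsilon>"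
      define \<eta> where "\<eta> = \<epsilon> * N / (2 * Q * norm \<nu>)"
      have "0 < \<eta>" using \<open>0 < \<epsilon>\<close> \<open>0 < N\<close> \<open>0 < Q\<close> \<open>\<nu> \<noteq> 0\<close> by (simp add: \<eta>_def)
      obtain \<rho> where \<rho>: "0 < \<rho>" "\<forall>x\<in>ball p \<rho>. \<forall>y\<in>ball p \<rho>. \<bar>\<phi> x - \<phi> y - \<nu> \<bullet> (x - y)\<bar> \<le> \<eta> * norm (x - y)"
        by (rule strict_gradientE[OF grad \<open>0 < \<eta>\<close>])
      have near_at: "\<forall>\<^sub>F t in at (0::real). \<bar>t\<bar> * Q < R" if "0 < R" for R
        using near0[OF that] by (auto simp: eventually_at_filter elim!: eventually_mono)
      note near_at[OF \<rho>0(1)] near_at[OF \<rho>(1)]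
      moreover have "\<forall>\<^sub>F t in at (0::real). t \<noteq> 0" by (simp add: eventually_at_filter)
      ultimately show "\<forall>\<^sub>F t in at 0. dist ((c t - c 0 - (t - 0) *\<^sub>R v) /\<^sub>R norm (t - 0)) 0 < \<epsilon>"
      proof eventually_elim
        case (elim t)
        have "\<bar>0 - \<sigma> t * N\<bar> \<le> \<eta> * (\<bar>t\<bar> * Q)"
          using est[OF \<rho>(2), of "\<sigma> t" t] \<sigma>[OF elim(1)] elim(2) \<open>0 < \<eta>\<close> by simp
        then have "\<bar>\<sigma> t\<bar> * N \<le> \<eta> * (\<bar>t\<bar> * Q)" using \<open>0 < N\<close> by (simp add: abs_mult)
        also have "\<dots> = (\<bar>t\<bar> * \<epsilon> / (2 * norm \<nu>)) * N" using \<open>0 < Q\<close> by (simp add: \<eta>_def)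
        finally have "\<bar>\<sigma> t\<bar> \<le> \<bar>t\<bar> * \<epsilon> / (2 * norm \<nu>)" by (rule mult_right_le_imp_le) (rule \<open>0 < N\<close>)
        then have "\<bar>\<sigma> t\<bar> * norm \<nu> \<le> \<bar>t\<bar> * \<epsilon> / (2 * norm \<nu>) * norm \<nu>" by (rule mult_right_mono) simp
        also have "\<dots> = \<bar>t\<bar> * (\<epsilon> / 2)" using \<open>\<nu> \<noteq> 0\<close> by simp
        finally have le: "\<bar>\<sigma> t\<bar> * norm \<nu> \<le> \<bar>t\<bar> * (\<epsilon> / 2)" .
        have "c t - c 0 - (t - 0) *\<^sub>R v = \<sigma> t *\<^sub>R \<nu>" unfolding c0 by (simp add: c_def pt_def)
        then have "dist ((c t - c 0 - (t - 0) *\<^sub>R v) /\<^sub>R norm (t - 0)) 0 = (\<bar>\<sigma> t\<bar> * norm \<nu>) / \<bar>t\<bar>"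
          by (simp add: divide_inverse abs_mult)
        also have "\<dots> \<le> \<epsilon> / 2"
          using le elim(3) by (simp add: divide_le_eq mult.commute)
        finally show ?case using \<open>0 < \<epsilon>\<close> by linarith
      qed
    qed
  qed
  then show ?thesis using c0 inM unfolding tangent_vectors_def by blast
qed

text \<open>All vectors orthogonal to the gradient are tangent to the zero set, which makes the normal a multiple
  of the gradient; the sign follows from the values of \<open>\<phi>\<close> on \<open>W\<close>.\<close>
lemma unit_normal_parallel_gradient:
  fixes \<phi> :: "'a::euclidean_space \<Rightarrow> real"
  assumes grad: "has_strict_derivative \<phi> ((\<bullet>) \<nu>) p"
    and "\<phi> p = 0" "\<nu> \<noteq> 0"
    and "0 < \<delta>" and M: "\<And>x. x \<in> ball p \<delta> \<Longrightarrow> \<phi> x = 0 \<Longrightarrow> x \<in> M"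
    and W: "\<And>x. x \<in> W \<Longrightarrow> 0 < \<phi> x"
    and normal: "unit_normal M V W p n"
  shows "\<exists>c>0. n = c *\<^sub>R \<nu>"
proof -
  define N where "N = \<nu> \<bullet> \<nu>"
  have "0 < N" using \<open>\<nu> \<noteq> 0\<close> by (simp add: N_def)
  define c where "c = (\<nu> \<bullet> n) / N"
  have "\<nu> \<bullet> (n - c *\<^sub>R \<nu>) = 0" using \<open>0 < N\<close> by (simp add: inner_diff_right c_def N_def)
  then have "n - c *\<^sub>R \<nu> \<in> tangent_vectors M p"
    by (intro tangent_vector_of_level_set[OF grad \<open>\<phi> p = 0\<close> \<open>\<nu> \<noteq> 0\<close> _ \<open>0 < \<delta>\<close> M])
  then have "(n - c *\<^sub>R \<nu>) \<bullet> n = 0" using normal by (simp add: unit_normal_def)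
  then have "(n - c *\<^sub>R \<nu>) \<bullet> (n - c *\<^sub>R \<nu>) = 0"
    using \<open>\<nu> \<bullet> (n - c *\<^sub>R \<nu>) = 0\<close> by (simp add: inner_diff_right inner_commute)
  then have n: "n = c *\<^sub>R \<nu>" by simp
  have "norm n = 1" using normal by (simp add: unit_normal_def)
  then have "c \<noteq> 0" using n by auto
  moreover have "\<not> c < 0"
  proof
    assume "c < 0"
    define \<eta> where "\<eta> = - c * N / 2"
    have "0 < \<eta>" using \<open>c < 0\<close> \<open>0 < N\<close> by (simp add: \<eta>_def mult_neg_pos)
    obtain \<rho> where \<rho>: "0 < \<rho>" "\<forall>x\<in>ball p \<rho>. \<forall>y\<in>ball p \<rho>. \<bar>\<phi> x - \<phi> y - \<nu> \<bullet> (x - y)\<bar> \<le> \<eta> * norm (x - y)"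
      by (rule strict_gradientE[OF grad \<open>0 < \<eta>\<close>])
    have "\<forall>\<^sub>F s in at_right 0. p - s *\<^sub>R n \<in> V \<and> p + s *\<^sub>R n \<in> W" using normal by (simp add: unit_normal_def)
    moreover have "\<forall>\<^sub>F s in at_right (0::real). 0 < s \<and> s < \<rho>"
      using \<rho>(1) by (auto simp: eventually_at_right_less intro: eventually_conj eventually_at_rightI[of 0 \<rho>])
    ultimately have "\<forall>\<^sub>F s in at_right (0::real). False"
    proof eventually_elim
      case (elim s)
      have "p + s *\<^sub>R n \<in> ball p \<rho>" "p \<in> ball p \<rho>" using elim \<rho>(1) \<open>norm n = 1\<close> by (auto simp: dist_norm)
      then have le: "\<bar>\<phi> (p + s *\<^sub>R n) - \<phi> p - \<nu> \<bullet> (p + s *\<^sub>R n - p)\<bar> \<le> \<eta> * norm (p + s *\<^sub>R n - p)" using \<rho>(2) by blast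
      have ns: "norm (p + s *\<^sub>R n - p) = s" using \<open>norm n = 1\<close> elim by simp
      have ins: "\<nu> \<bullet> (p + s *\<^sub>R n - p) = s * (c * N)" unfolding n by (simp add: N_def)
      have "\<bar>\<phi> (p + s *\<^sub>R n) - s * (c * N)\<bar> \<le> \<eta> * s"
        using le[unfolded ns ins \<open>\<phi> p = 0\<close>] by simp
      moreover have "0 < \<phi> (p + s *\<^sub>R n)" using W elim by blast
      moreover have "\<eta> * s + s * (c * N) < 0"
      proof -
        have "\<eta> * s + s * (c * N) = - (\<eta> * s)" by (simp add: \<eta>_def field_simps)
        moreover have "0 < \<eta> * s" using \<open>0 < \<eta>\<close> elim by simp
        ultimately show ?thesis by linarith
      qed
      ultimately show False by linarith
    qed
    then show False by simp
  qed
  ultimately show ?thesis using n by (intro exI[of _ c]) auto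
qed

section \<open>Right uniqueness for a strictly differentiable force\<close>

lemma unique_from_imp_right_uniqueness:
  assumes "unique_from (\<lambda>Z v. v \<in> convex hull (glide_velocities \<G> j Z)) U t1 Z1"
  shows "right_uniqueness D \<G> j t1 Z1"
proof -
  let ?vel = "\<lambda>Z v. v \<in> convex hull (glide_velocities \<G> j Z)"
  have sol: "solution_from ?vel U t1 Z1 I X" if "inclusion_solution D \<G> j I X" "t1 \<in> I" "X t1 = Z1" for I X
    using that unfolding inclusion_solution_def solution_from_def by (auto elim!: eventually_mono)
  obtain t2 where "t2 > t1" and t2: "\<And>I I' X Y. solution_from ?vel U t1 Z1 I X \<Longrightarrow> solution_from ?vel U t1 Z1 I' Y \<Longrightarrow>
        \<forall>t\<in>{t1..t2} \<inter> I \<inter> I'. X t = Y t"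
    using assms unfolding unique_from_def by blast
  show ?thesis
    unfolding right_uniqueness_def
  proof (intro exI[of _ t2] conjI allI impI)
    fix I I' X Y
    assume "inclusion_solution D \<G> j I X \<and> t1 \<in> I \<and> X t1 = Z1 \<and> inclusion_solution D \<G> j I' Y \<and> t1 \<in> I' \<and> Y t1 = Z1"
    then show "\<forall>t\<in>{t1..t2} \<inter> I \<inter> I'. X t = Y t" by (intro t2 sol) auto
  qed (fact \<open>t2 > t1\<close>)
qed

text \<open>A nonzero force has at most two maximizing directions, and two would put \<open>Z1\<close> into a second
  ambiguity set.\<close>
lemma max_dirs_other_singleton:
  assumes G: "glide_directions \<G>" and Z1: "Z1 \<in> regular_ambiguity_set D \<G> j l" and "k \<noteq> l"
  shows "max_dirs \<G> j k Z1 = {the_elem (max_dirs \<G> j k Z1)}"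
proof -
  have "Z1 \<in> ambiguity_set D \<G> j l" "Z1 \<notin> E_int D \<G> j" "Z1 \<notin> E_zero D j" "Z1 \<in> D"
    using Z1 by (auto simp: regular_ambiguity_set_def ambiguity_set_def)
  then have "j k Z1 \<noteq> 0" by (auto simp: E_zero_def)
  then have "card (max_dirs \<G> j k Z1) \<le> 2" by (rule card_max_dirs_le_2[OF G])
  moreover have "card (max_dirs \<G> j k Z1) \<noteq> 2"
    using \<open>Z1 \<in> ambiguity_set D \<G> j l\<close> \<open>Z1 \<notin> E_int D \<G> j\<close> \<open>Z1 \<in> D\<close> \<open>k \<noteq> l\<close>
    by (auto simp: E_int_def ambiguity_set_def)
  moreover have "finite (max_dirs \<G> j k Z1)"
    using G by (auto simp: glide_directions_def max_dirs_def is_arg_max_def)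
  then have "card (max_dirs \<G> j k Z1) \<noteq> 0" using max_dirs_nonempty[OF G] by auto
  ultimately have "card (max_dirs \<G> j k Z1) = 1" by linarith
  then obtain d where "max_dirs \<G> j k Z1 = {d}" by (auto simp: card_1_singleton_iff)
  then show ?thesis by simp
qed

text \<open>The data of \<open>one_sided_uniqueness\<close> are read off from the force: \<open>\<phi>\<close> is the difference of its components
  along the two maximizers, and regularity of \<open>Z1\<close> makes the gradient of \<open>\<phi>\<close> nonzero.\<close>
lemma right_uniqueness_of_strictly_differentiable_force:
  fixes j :: "'n::finite force"
  assumes G: "glide_directions \<G>" and "open D"
    and diff: "\<And>k. strictly_differentiable_at (j k) Z1"
    and Z1: "Z1 \<in> regular_ambiguity_set D \<G> j l"
    and labels: "max_dirs \<G> j l Z1 = {gp, gm}"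
    and "0 < r"
    and normal: "unit_normal (ambiguity_set D \<G> j l \<inter> ball Z1 r)
                   (side D \<G> j l Z1 r gm) (side D \<G> j l Z1 r gp) Z1 n"
    and toward: "local_field \<G> j l Z1 gm Z1 \<bullet> n > 0 \<or> local_field \<G> j l Z1 gp Z1 \<bullet> n < 0"
  shows "right_uniqueness D \<G> j t1 Z1"
proof -
  have Z1D: "Z1 \<in> D" and A: "card {gp, gm} = 2" and nsing: "Z1 \<notin> singular_set D \<G> j l" and nz: "j l Z1 \<noteq> 0"
    using Z1 labels by (auto simp: regular_ambiguity_set_def ambiguity_set_def E_zero_def)
  have ne: "gp \<noteq> gm" using A by auto
  have gs: "gp \<in> \<G>" "gm \<in> \<G>" "gp \<in> max_dirs \<G> j l Z1" "gm \<in> max_dirs \<G> j l Z1"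
    using labels max_dirs_iff[of _ \<G> j l Z1] by blast+
  define \<phi> where "\<phi> Z = j l Z \<bullet> (gp - gm)" for Z
  define m where "m Z = j l Z \<bullet> gm" for Z
  define fm where "fm = local_field \<G> j l Z1 gm"
  have \<phi>1: "\<phi> Z1 = 0"
    using gs max_dirs_iff[of _ \<G> j l Z1] unfolding \<phi>_def inner_diff_right by (simp add: order_antisym)
  have m1: "0 < m Z1" unfolding m_def by (rule max_dirs_inner_pos[OF G nz gs(4)])
  have "strictly_differentiable_at \<phi> Z1"
    unfolding \<phi>_def by (rule strictly_differentiable_linear_compose[OF bounded_linear_inner_left diff])
  from strictly_differentiable_imp_gradient[OF this]
  obtain \<nu> where grad: "has_strict_derivative \<phi> ((\<bullet>) \<nu>) Z1" by blast
  have "\<nu> \<noteq> 0"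
  proof
    assume "\<nu> = 0"
    then have "Z1 \<in> singular_set D \<G> j l"
      using has_strict_derivative_imp_GDERIV[OF grad] \<phi>1 labels Z1 unfolding singular_set_def \<phi>_def regular_ambiguity_set_def by blast
    then show False using nsing by simp
  qed
  have semi: "\<exists>\<rho>>0. \<forall>k. \<forall>Z\<in>ball Z1 \<rho>. max_dirs \<G> j k Z \<subseteq> max_dirs \<G> j k Z1"
  proof -
    have "\<forall>k. \<exists>\<rho>>0. \<forall>Z\<in>ball Z1 \<rho>. max_dirs \<G> j k Z \<subseteq> max_dirs \<G> j k Z1"
    proof
      fix k
      obtain f' where "has_strict_derivative (j k) f' Z1" using diff[of k] unfolding strictly_differentiable_at_def by blast
      then show "\<exists>\<rho>>0. \<forall>Z\<in>ball Z1 \<rho>. max_dirs \<G> j k Z \<subseteq> max_dirs \<G> j k Z1"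
        by (intro max_dirs_upper_semicontinuous[OF G] has_strict_derivative_continuous)
    qed
    then obtain \<rho> where \<rho>: "\<And>k. 0 < \<rho> k" "\<And>k Z. Z \<in> ball Z1 (\<rho> k) \<Longrightarrow> max_dirs \<G> j k Z \<subseteq> max_dirs \<G> j k Z1" by metis
    show ?thesis
    proof (intro exI[of _ "Min (range \<rho>)"] conjI allI ballI)
      show "0 < Min (range \<rho>)" using \<rho>(1) by (subst Min_gr_iff) auto
      fix k Z assume "Z \<in> ball Z1 (Min (range \<rho>))"
      moreover have "Min (range \<rho>) \<le> \<rho> k" by (rule Min_le) auto
      ultimately show "max_dirs \<G> j k Z \<subseteq> max_dirs \<G> j k Z1" by (intro \<rho>(2)) auto
    qed
  qed
  then obtain \<rho>s where \<rho>s: "0 < \<rho>s" "\<And>k Z. Z \<in> ball Z1 \<rho>s \<Longrightarrow> max_dirs \<G> j k Z \<subseteq> max_dirs \<G> j k Z1" by blast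
  obtain \<rho>D where \<rho>D: "0 < \<rho>D" "ball Z1 \<rho>D \<subseteq> D" using \<open>open D\<close> Z1D by (meson openE)
  define \<delta>n where "\<delta>n = min (min \<rho>s \<rho>D) r"
  have "\<exists>c>0. n = c *\<^sub>R \<nu>"
  proof (rule unit_normal_parallel_gradient[OF grad \<phi>1 \<open>\<nu> \<noteq> 0\<close> _ _ _ normal])
    show "0 < \<delta>n" using \<rho>s(1) \<rho>D(1) \<open>0 < r\<close> by (simp add: \<delta>n_def)
    fix Z
    show "Z \<in> ambiguity_set D \<G> j l \<inter> ball Z1 r" if Z: "Z \<in> ball Z1 \<delta>n" "\<phi> Z = 0"
    proof -
      have "Z \<in> ball Z1 \<rho>s" "Z \<in> D" "Z \<in> ball Z1 r" using Z(1) \<rho>D(2) by (auto simp: \<delta>n_def)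
      then have sub: "max_dirs \<G> j l Z \<subseteq> {gp, gm}" using \<rho>s(2) labels by blast
      have "j l Z \<bullet> gp = j l Z \<bullet> gm" using Z(2) by (simp add: \<phi>_def inner_diff_right)
      then have "gp \<in> max_dirs \<G> j l Z \<longleftrightarrow> gm \<in> max_dirs \<G> j l Z" using gs by (simp add: max_dirs_iff)
      then have "max_dirs \<G> j l Z = {gp, gm}" using sub max_dirs_nonempty[OF G, of j l Z] by blast
      then show ?thesis using \<open>Z \<in> D\<close> \<open>Z \<in> ball Z1 r\<close> A by (simp add: ambiguity_set_def)
    qed
    show "0 < \<phi> Z" if Z: "Z \<in> side D \<G> j l Z1 r gp"
    proof -
      have eq: "max_dirs \<G> j l Z = {gp}" using Z by (simp add: side_def)
      then have "gm \<notin> max_dirs \<G> j l Z" using ne by simp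
      then have "\<exists>h\<in>\<G>. j l Z \<bullet> gm < j l Z \<bullet> h" using gs by (auto simp: max_dirs_iff not_le)
      moreover have "\<forall>h\<in>\<G>. j l Z \<bullet> h \<le> j l Z \<bullet> gp" using eq max_dirs_iff[of gp \<G> j l Z] by simp
      ultimately show ?thesis by (auto simp: \<phi>_def inner_diff_right intro: less_le_trans)
    qed
  qed
  then obtain c where c: "0 < c" "n = c *\<^sub>R \<nu>" by blast
  have fp: "local_field \<G> j l Z1 gp Z1 = fm Z1 + m Z1 *\<^sub>R axis l (gp - gm)"
  proof (rule vec_eq_iff[THEN iffD2], rule allI)
    fix k
    have "j l Z1 \<bullet> gp = j l Z1 \<bullet> gm" using \<phi>1 by (simp add: \<phi>_def inner_diff_right)
    then show "local_field \<G> j l Z1 gp Z1 $ k = (fm Z1 + m Z1 *\<^sub>R axis l (gp - gm)) $ k"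
      by (cases "k = l") (simp_all add: fm_def local_field_def m_def axis_def algebra_simps)
  qed
  have up_or_down: "0 < \<nu> \<bullet> fm Z1 \<or> \<nu> \<bullet> (fm Z1 + m Z1 *\<^sub>R axis l (gp - gm)) < 0"
    using toward c(1) unfolding fp c(2) fm_def[symmetric]
    by (auto simp: inner_commute[of _ \<nu>] zero_less_mult_iff mult_less_0_iff)
  have dfm: "strictly_differentiable_at fm Z1"
  proof (rule strictly_differentiable_vec)
    fix k
    define d where "d = (if k = l then gm else the_elem (max_dirs \<G> j k Z1))"
    have "strictly_differentiable_at (\<lambda>Z. (j k Z \<bullet> d) *\<^sub>R d) Z1"
      by (rule strictly_differentiable_linear_compose[OF _ diff])
        (rule bounded_linear_compose[OF bounded_linear_scaleR_left bounded_linear_inner_left])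
    then show "strictly_differentiable_at (\<lambda>Z. fm Z $ k) Z1"
      by (simp add: fm_def local_field_def Let_def d_def)
  qed
  have dm: "strictly_differentiable_at m Z1"
    unfolding m_def by (rule strictly_differentiable_linear_compose[OF bounded_linear_inner_left diff])
  obtain \<rho>f Lf where f_lip: "0 < \<rho>f" "0 \<le> Lf" "\<forall>x\<in>ball Z1 \<rho>f. \<forall>y\<in>ball Z1 \<rho>f. norm (fm x - fm y) \<le> Lf * norm (x - y)"
    using strictly_differentiable_lipschitz[OF dfm] by blast
  obtain \<rho>m Lm where m_lip: "0 < \<rho>m" "0 \<le> Lm" "\<forall>x\<in>ball Z1 \<rho>m. \<forall>y\<in>ball Z1 \<rho>m. norm (m x - m y) \<le> Lm * norm (x - y)"
    using strictly_differentiable_lipschitz[OF dm] by blast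
  define \<delta>0 where "\<delta>0 = min \<rho>s (min \<rho>f \<rho>m)"
  define K where "K = max Lf Lm"
  have K: "Lf * norm (x - y) \<le> K * norm (x - y)" "Lm * norm (x - y) \<le> K * norm (x - y)" for x y :: "(real^2)^'n"
    unfolding K_def by (intro mult_right_mono; simp)+
  have "\<exists>\<delta>>0. \<delta> \<le> \<delta>0 \<and> unique_from (\<lambda>Z v. v \<in> convex hull (glide_velocities \<G> j Z)) (ball Z1 \<delta>) t1 Z1"
  proof (rule one_sided_uniqueness[where f = fm and m = m and \<phi> = \<phi> and \<nu> = \<nu> and E = "axis l (gp - gm)"
        and e = "axis l gp" and K = K])
    show "0 < \<delta>0" using \<rho>s(1) f_lip(1) m_lip(1) by (simp add: \<delta>0_def)
    show "0 \<le> K" using f_lip(2) by (simp add: K_def)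
    fix x y assume "x \<in> ball Z1 \<delta>0" "y \<in> ball Z1 \<delta>0"
    then have "x \<in> ball Z1 \<rho>f" "y \<in> ball Z1 \<rho>f" "x \<in> ball Z1 \<rho>m" "y \<in> ball Z1 \<rho>m" by (auto simp: \<delta>0_def)
    then have "norm (fm x - fm y) \<le> Lf * norm (x - y)" "norm (m x - m y) \<le> Lm * norm (x - y)"
      using f_lip(3) m_lip(3) by blast+
    then show "norm (fm x - fm y) \<le> K * norm (x - y)" "\<bar>m x - m y\<bar> \<le> K * norm (x - y)"
      using K[of x y] by auto
  next
    fix Z v assume Z: "Z \<in> ball Z1 \<delta>0" and v: "v \<in> convex hull (glide_velocities \<G> j Z)"
    have Zs: "Z \<in> ball Z1 \<rho>s" using Z by (simp add: \<delta>0_def)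
    show "side_mixture fm m \<phi> (axis l (gp - gm)) (axis l gp) Z v"
      unfolding fm_def m_def \<phi>_def
    proof (rule glide_velocity_side_mixture[OF _ _ gs(1,2) v])
      show "max_dirs \<G> j l Z \<subseteq> {gp, gm}" using \<rho>s(2)[OF Zs] labels by blast
      show "max_dirs \<G> j k Z \<subseteq> {the_elem (max_dirs \<G> j k Z1)}" if "k \<noteq> l" for k
        using \<rho>s(2)[OF Zs, of k] max_dirs_other_singleton[OF G Z1 that] by simp
    qed
  next
    show "0 < \<nu> \<bullet> fm Z1 \<or> \<nu> \<bullet> (fm Z1 + m Z1 *\<^sub>R axis l (gp - gm)) < 0" by (rule up_or_down)
  qed (use \<phi>1 m1 \<open>\<nu> \<noteq> 0\<close> grad in auto)
  then show ?thesis using unique_from_imp_right_uniqueness by blast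
qed

section \<open>Constant boundary values and the maximum principle\<close>

text \<open>Inside the chart the domain is the negativity set of \<open>\<Phi> x = (x - p) \<bullet> \<nu> - h ((x - p) \<bullet> \<tau>)\<close>, whose
  gradient at \<open>q\<close> is \<open>m\<close>. A curve in the boundary keeps \<open>\<Phi> = 0\<close>, hence its velocity is orthogonal to \<open>m\<close>.\<close>
lemma graph_boundary_point:
  fixes \<Omega> :: "(real^2) set"
  assumes "open \<Omega>" and ortho: "norm \<tau> = 1" "norm \<nu> = 1" "\<tau> \<bullet> \<nu> = 0"
    and dh: "\<And>s. s \<in> {-r<..<r} \<Longrightarrow> (h has_real_derivative h' s) (at s)"
    and graph: "\<Omega> \<inter> ball p r = {x \<in> ball p r. (x - p) \<bullet> \<nu> < h ((x - p) \<bullet> \<tau>)}"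
    and q: "q \<in> ball p r" "(q - p) \<bullet> \<nu> = h ((q - p) \<bullet> \<tau>)"
  defines "m \<equiv> \<nu> - h' ((q - p) \<bullet> \<tau>) *\<^sub>R \<tau>"
  shows "q \<in> frontier \<Omega>" and "outer_unit_normal \<Omega> q (m /\<^sub>R norm m)"
proof -
  define \<Phi> where "\<Phi> x = (x - p) \<bullet> \<nu> - h ((x - p) \<bullet> \<tau>)" for x
  define B where "B = ball p r"
  have inside: "x \<in> \<Omega> \<longleftrightarrow> \<Phi> x < 0" if "x \<in> B" for x
  proof -
    have "x \<in> \<Omega> \<inter> ball p r \<longleftrightarrow> x \<in> {x \<in> ball p r. (x - p) \<bullet> \<nu> < h ((x - p) \<bullet> \<tau>)}" by (simp only: graph)
    then show ?thesis using that unfolding B_def \<Phi>_def by simp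
  qed
  have param: "(x - p) \<bullet> \<tau> \<in> {-r<..<r}" if "x \<in> B" for x
  proof -
    have "\<bar>(x - p) \<bullet> \<tau>\<bar> \<le> norm (x - p)" using Cauchy_Schwarz_ineq2[of "x - p" \<tau>] ortho(1) by simp
    also have "\<dots> < r" using that by (simp add: B_def dist_norm norm_minus_commute)
    finally show ?thesis by auto
  qed
  have d\<Phi>: "(\<Phi> has_derivative (\<lambda>v. v \<bullet> (\<nu> - h' ((x - p) \<bullet> \<tau>) *\<^sub>R \<tau>))) (at x)" if "x \<in> B" for x
  proof -
    have "(h has_derivative (\<lambda>t. t * h' ((x - p) \<bullet> \<tau>))) (at ((x - p) \<bullet> \<tau>))"
      using dh[OF param[OF that]] by (simp add: has_field_derivative_def mult_commute_abs)
    then have "((\<lambda>x. h ((x - p) \<bullet> \<tau>)) has_derivative (\<lambda>v. (v \<bullet> \<tau>) * h' ((x - p) \<bullet> \<tau>))) (at x)"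
      by (rule has_derivative_compose[rotated]) (auto intro!: derivative_eq_intros)
    then show ?thesis unfolding \<Phi>_def
      by (auto intro!: derivative_eq_intros simp: inner_diff_right)
  qed
  have cont: "continuous_on B \<Phi>"
    using d\<Phi> has_derivative_continuous continuous_at_imp_continuous_on by blast
  have "open B" by (simp add: B_def)
  have qB: "q \<in> B" and \<Phi>q: "\<Phi> q = 0" using q by (auto simp: B_def \<Phi>_def)
  have frontier_zero: "\<Phi> x = 0" if "x \<in> B" "x \<in> frontier \<Omega>" for x
  proof (rule ccontr)
    assume "\<Phi> x \<noteq> 0"
    then consider "\<Phi> x < 0" | "0 < \<Phi> x" by linarith
    then show False
    proof cases
      case 1
      then show False using inside[OF \<open>x \<in> B\<close>] \<open>open \<Omega>\<close> that(2) by (simp add: frontier_def interior_open)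
    next
      case 2
      have "open (B \<inter> \<Phi> -` {0<..})" by (rule continuous_open_preimage[OF cont \<open>open B\<close> open_greaterThan])
      moreover have "B \<inter> \<Phi> -` {0<..} \<inter> \<Omega> = {}" using inside by fastforce
      ultimately have "B \<inter> \<Phi> -` {0<..} \<inter> closure \<Omega> = {}" by (simp add: open_Int_closure_eq_empty)
      then show False using 2 that by (auto simp: frontier_def)
    qed
  qed
  have mm: "m \<bullet> m = 1 + (h' ((q - p) \<bullet> \<tau>))\<^sup>2"
  proof -
    have "\<nu> \<bullet> \<tau> = 0" "\<tau> \<bullet> \<tau> = 1" "\<nu> \<bullet> \<nu> = 1" using ortho by (simp_all add: inner_commute norm_eq_1)
    then show ?thesis unfolding m_def
      using ortho(3) by (simp add: inner_diff_left inner_diff_right power2_eq_square)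
  qed
  then have "0 < m \<bullet> m" by (simp add: add_pos_nonneg)
  then have "m \<noteq> 0" by auto
  define n where "n = m /\<^sub>R norm m"
  have "norm n = 1" using \<open>m \<noteq> 0\<close> by (simp add: n_def)
  have nm: "n \<bullet> m = norm m" using \<open>m \<noteq> 0\<close>
    by (simp add: n_def power2_norm_eq_inner[symmetric] power2_eq_square)
  have dline: "((\<lambda>t. \<Phi> (q + t *\<^sub>R n)) has_real_derivative norm m) (at 0)"
  proof -
    have "((\<lambda>t. q + t *\<^sub>R n) has_derivative (\<lambda>t. t *\<^sub>R n)) (at (0::real))" by (auto intro!: derivative_eq_intros)
    moreover have "(\<Phi> has_derivative (\<lambda>v. v \<bullet> m)) (at (q + 0 *\<^sub>R n))" using d\<Phi>[OF qB] by (simp add: m_def)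
    ultimately have "((\<lambda>t. \<Phi> (q + t *\<^sub>R n)) has_derivative (\<lambda>t. (t *\<^sub>R n) \<bullet> m)) (at 0)"
      by (rule has_derivative_compose)
    then show ?thesis using nm by (simp add: has_field_derivative_def mult_commute_abs)
  qed
  obtain d1 where d1: "0 < d1" "\<And>t. 0 < t \<Longrightarrow> t < d1 \<Longrightarrow> \<Phi> q < \<Phi> (q + t *\<^sub>R n)"
    using DERIV_pos_inc_right[OF dline] \<open>m \<noteq> 0\<close> by auto
  obtain d2 where d2: "0 < d2" "\<And>t. 0 < t \<Longrightarrow> t < d2 \<Longrightarrow> \<Phi> (q - t *\<^sub>R n) < \<Phi> q"
    using DERIV_pos_inc_left[OF dline] \<open>m \<noteq> 0\<close> by auto
  obtain e where e: "0 < e" "ball q e \<subseteq> B" using \<open>open B\<close> qB by (meson openE)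
  define d where "d = min (min d1 d2) e"
  have "0 < d" using d1(1) d2(1) e(1) by (simp add: d_def)
  have side: "q - t *\<^sub>R n \<in> \<Omega> \<and> q + t *\<^sub>R n \<in> - closure \<Omega>" if t: "0 < t" "t < d" for t
  proof -
    have B: "q - t *\<^sub>R n \<in> B" "q + t *\<^sub>R n \<in> B"
      using t e(2) \<open>norm n = 1\<close> by (auto simp: d_def dist_norm intro!: subsetD[OF e(2)])
    have "\<Phi> (q - t *\<^sub>R n) < 0" "0 < \<Phi> (q + t *\<^sub>R n)" using d1(2)[of t] d2(2)[of t] t \<Phi>q by (auto simp: d_def)
    then have "q - t *\<^sub>R n \<in> \<Omega>" "q + t *\<^sub>R n \<notin> \<Omega>" "q + t *\<^sub>R n \<notin> frontier \<Omega>"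
      using inside[OF B(1)] inside[OF B(2)] frontier_zero[OF B(2)] by auto
    then show ?thesis using closure_Un_frontier[of \<Omega>] by auto
  qed
  have ev: "\<forall>\<^sub>F t in at_right 0. q - t *\<^sub>R n \<in> \<Omega> \<and> q + t *\<^sub>R n \<in> - closure \<Omega>"
    using side \<open>0 < d\<close> by (intro eventually_at_rightI[of 0 d]) auto
  show "q \<in> frontier \<Omega>"
  proof -
    have "((\<lambda>t. q - t *\<^sub>R n) \<longlongrightarrow> q - 0 *\<^sub>R n) (at_right 0)" by (intro tendsto_intros)
    moreover have "\<forall>\<^sub>F t in at_right 0. q - t *\<^sub>R n \<in> closure \<Omega>"
      using ev by eventually_elim (use closure_subset in blast)
    ultimately have "q \<in> closure \<Omega>"
      using Lim_in_closed_set[OF closed_closure, of "\<lambda>t. q - t *\<^sub>R n" \<Omega> "at_right (0::real)" q] by simp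
    moreover have "q \<notin> \<Omega>" using inside[OF qB] \<Phi>q by simp
    ultimately show ?thesis using \<open>open \<Omega>\<close> by (simp add: frontier_def interior_open)
  qed
  have "v \<bullet> n = 0" if "v \<in> tangent_vectors (frontier \<Omega>) q" for v
  proof -
    have "\<exists>c :: real \<Rightarrow> real^2. c 0 = q \<and> (\<forall>\<^sub>F t in nhds 0. c t \<in> frontier \<Omega>) \<and> (c has_vector_derivative v) (at 0)"
      using that by (simp add: tangent_vectors_def)
    then obtain c :: "real \<Rightarrow> real^2" where c: "c 0 = q" "\<forall>\<^sub>F t in nhds 0. c t \<in> frontier \<Omega>" "(c has_vector_derivative v) (at 0)"
      by (elim exE conjE) (rule that; assumption)
    have dc: "(c has_derivative (\<lambda>t. t *\<^sub>R v)) (at 0)" using c(3) by (simp add: has_vector_derivative_def)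
    have "isCont c 0" using has_derivative_continuous[OF dc] .
    then have "(c \<longlongrightarrow> c 0) (nhds 0)" by (simp add: continuous_at tendsto_at_iff_tendsto_nhds)
    then have "(c \<longlongrightarrow> q) (nhds 0)" using c(1) by simp
    then have "\<forall>\<^sub>F t in nhds 0. c t \<in> B" using \<open>open B\<close> qB by (rule topological_tendstoD)
    with c(2) have zero: "\<forall>\<^sub>F t in nhds 0. \<Phi> (c t) = 0"
      by eventually_elim (rule frontier_zero)
    have "(\<Phi> has_derivative (\<lambda>v. v \<bullet> m)) (at (c 0))" using d\<Phi>[OF qB] c(1) by (simp add: m_def)
    with dc have "((\<lambda>t. \<Phi> (c t)) has_derivative (\<lambda>t. (t *\<^sub>R v) \<bullet> m)) (at 0)" by (rule has_derivative_compose)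
    moreover have "((\<lambda>t. \<Phi> (c t)) has_derivative (\<lambda>t. 0)) (at 0)"
      by (rule has_derivative_transform_eventually[where f = "\<lambda>t. 0"])
        (use zero \<Phi>q c(1) in \<open>auto simp: eventually_at_filter elim!: eventually_mono\<close>)
    ultimately have "(\<lambda>t::real. (t *\<^sub>R v) \<bullet> m) = (\<lambda>t. 0)" by (rule has_derivative_unique)
    then have "(1 *\<^sub>R v) \<bullet> m = 0" by (rule fun_cong)
    then show ?thesis by (simp add: n_def)
  qed
  then show "outer_unit_normal \<Omega> q (m /\<^sub>R norm m)"
    unfolding outer_unit_normal_def unit_normal_def n_def[symmetric] using \<open>norm n = 1\<close> ev by blast
qed

lemma orthonormal_expansion_2:
  fixes \<tau> \<nu> x :: "real^2"
  assumes "norm \<tau> = 1" "norm \<nu> = 1" "\<tau> \<bullet> \<nu> = 0"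
  shows "x = (x \<bullet> \<tau>) *\<^sub>R \<tau> + (x \<bullet> \<nu>) *\<^sub>R \<nu>"
proof -
  define d where "d = x - (x \<bullet> \<tau>) *\<^sub>R \<tau> - (x \<bullet> \<nu>) *\<^sub>R \<nu>"
  have 1: "\<tau> \<bullet> \<tau> = 1" "\<nu> \<bullet> \<nu> = 1" using assms by (simp_all add: norm_eq_1)
  have "\<nu> \<bullet> \<tau> = 0" using assms(3) by (simp add: inner_commute)
  then have d: "d \<bullet> \<tau> = 0" "d \<bullet> \<nu> = 0"
    using 1 assms(3) by (simp_all add: d_def inner_diff_left)
  have coords: "a \<bullet> c = a $ 1 * c $ 1 + a $ 2 * c $ 2" for a c :: "real^2" by (simp add: inner_vec_def sum_2)
  define D where "D = \<tau> $ 1 * \<nu> $ 2 - \<tau> $ 2 * \<nu> $ 1"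
  have "D\<^sup>2 = (\<tau> \<bullet> \<tau>) * (\<nu> \<bullet> \<nu>) - (\<tau> \<bullet> \<nu>)\<^sup>2"
    unfolding D_def coords by (simp add: power2_eq_square algebra_simps)
  then have "D \<noteq> 0" using 1 assms(3) by auto
  moreover have "D * d $ 1 = (d \<bullet> \<tau>) * \<nu> $ 2 - (d \<bullet> \<nu>) * \<tau> $ 2" "D * d $ 2 = (d \<bullet> \<nu>) * \<tau> $ 1 - (d \<bullet> \<tau>) * \<nu> $ 1"
    unfolding D_def coords by (simp_all add: algebra_simps)
  ultimately have "d $ 1 = 0" "d $ 2 = 0" using d by auto
  then have "d = 0" by (simp add: vec_eq_iff forall_2)
  then show ?thesis by (simp add: d_def algebra_simps)
qed

text \<open>The curves \<open>pt \<epsilon>\<close> are the boundary in a chart, lowered by \<open>\<epsilon>\<close>. By uniform continuity of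
  \<open>V\<close> the derivative of \<open>\<psi>\<close> along them tends to the tangential component of \<open>V\<close> at the boundary, which is
  zero, so \<open>\<psi>\<close> is nearly constant on each curve. Across the curves \<open>\<psi>\<close> is Lipschitz, and therefore
  converges as \<open>\<epsilon>\<close> tends to \<open>0\<close>.\<close>
lemma locally_constant_boundary_values:
  fixes \<Omega> :: "(real^2) set" and V :: "real^2 \<Rightarrow> real^2"
  assumes "open \<Omega>" "bounded \<Omega>" and C2: "C2_holder_boundary \<gamma> \<Omega>"
    and "finite S" "S \<subseteq> \<Omega>"
    and grad: "\<And>x. x \<in> \<Omega> - S \<Longrightarrow> GDERIV \<psi> x :> V x"
    and cont: "continuous_on (closure \<Omega> - S) V"
    and tangential: "\<And>q n w. q \<in> frontier \<Omega> \<Longrightarrow> outer_unit_normal \<Omega> q n \<Longrightarrow> w \<bullet> n = 0 \<Longrightarrow> V q \<bullet> w = 0"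
    and p: "p \<in> frontier \<Omega>"
  shows "\<exists>c. \<exists>\<rho>>0. \<forall>q\<in>frontier \<Omega> \<inter> ball p \<rho>. (\<psi> \<longlongrightarrow> c) (at q within \<Omega>)"
proof -
  from C2 p have "\<exists>r>0. \<exists>\<tau> \<nu> h h' h''.
        norm \<tau> = 1 \<and> norm \<nu> = 1 \<and> \<tau> \<bullet> \<nu> = 0 \<and> h 0 = 0 \<and>
        (\<forall>s\<in>{-r<..<r}. (h has_real_derivative h' s) (at s) \<and> (h' has_real_derivative h'' s) (at s)) \<and>
        holder_on \<gamma> {-r<..<r} h'' \<and>
        \<Omega> \<inter> ball p r = {x \<in> ball p r. (x - p) \<bullet> \<nu> < h ((x - p) \<bullet> \<tau>)}"
    unfolding C2_holder_boundary_def by (rule bspec)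
  then obtain r \<tau> \<nu> h h' h'' where "0 < r" and ortho: "norm \<tau> = 1" "norm \<nu> = 1" "\<tau> \<bullet> \<nu> = 0" and "h 0 = 0"
    and d2: "\<forall>s\<in>{-r<..<r}. (h has_real_derivative h' s) (at s) \<and> (h' has_real_derivative h'' s) (at s)"
    and graph: "\<Omega> \<inter> ball p r = {x \<in> ball p r. (x - p) \<bullet> \<nu> < h ((x - p) \<bullet> \<tau>)}"
    by (elim exE conjE) (rule that; assumption)
  have dh: "(h has_real_derivative h' s) (at s)" and dh': "(h' has_real_derivative h'' s) (at s)"
    if "s \<in> {-r<..<r}" for s using d2 that by blast+
  have inside: "x \<in> \<Omega> \<longleftrightarrow> (x - p) \<bullet> \<nu> < h ((x - p) \<bullet> \<tau>)" if "x \<in> ball p r" for x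
  proof -
    have "x \<in> \<Omega> \<inter> ball p r \<longleftrightarrow> x \<in> {x \<in> ball p r. (x - p) \<bullet> \<nu> < h ((x - p) \<bullet> \<tau>)}" by (simp only: graph)
    then show ?thesis using that by simp
  qed
  have "p \<notin> \<Omega>" using p \<open>open \<Omega>\<close> by (simp add: frontier_def interior_open)
  then have "p \<in> - S" "open (- S)" using \<open>S \<subseteq> \<Omega>\<close> \<open>finite S\<close> by (auto simp: finite_imp_closed)
  then obtain r1 where r1: "0 < r1" "ball p r1 \<subseteq> - S" by (meson openE)
  define \<rho>1 where "\<rho>1 = min r r1 / 2"
  have \<rho>1: "0 < \<rho>1" "\<rho>1 < r" "\<rho>1 < r1" using \<open>0 < r\<close> r1(1) by (auto simp: \<rho>1_def)
  define K where "K = closure \<Omega> \<inter> cball p \<rho>1"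
  have "compact K" using \<open>bounded \<Omega>\<close> by (simp add: K_def compact_Int_closed compact_closure)
  have KS: "K \<subseteq> closure \<Omega> - S"
  proof
    fix x assume "x \<in> K"
    then have "x \<in> closure \<Omega>" "x \<in> ball p r1" using \<rho>1(3) by (auto simp: K_def)
    then show "x \<in> closure \<Omega> - S" using r1(2) by blast
  qed
  have contK: "continuous_on K V" by (rule continuous_on_subset[OF cont KS])
  have ucV: "uniformly_continuous_on K V" by (rule compact_uniformly_continuous[OF contK \<open>compact K\<close>])
  have "bounded (V ` K)" using compact_continuous_image[OF contK \<open>compact K\<close>] by (rule compact_imp_bounded)
  then obtain M where M: "0 < M" "\<And>x. x \<in> K \<Longrightarrow> norm (V x) \<le> M" by (auto simp: bounded_pos)
  have "isCont h 0" using dh[of 0] \<open>0 < r\<close> by (auto intro: DERIV_isCont)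
  moreover have "0 < \<rho>1 / 4" using \<rho>1(1) by simp
  ultimately obtain a0 where "0 < a0" "\<forall>s. dist s 0 < a0 \<longrightarrow> dist (h s) (h 0) < \<rho>1 / 4"
    unfolding continuous_at_eps_delta by blast
  then have a0: "0 < a0" "\<And>s. \<bar>s\<bar> < a0 \<Longrightarrow> \<bar>h s\<bar> < \<rho>1 / 4"
    using \<open>h 0 = 0\<close> by (auto simp: dist_real_def)
  define a where "a = min (a0 / 2) (\<rho>1 / 4)"
  define e0 where "e0 = \<rho>1 / 4"
  have "0 < a" "0 < e0" "a < r" using a0(1) \<rho>1 by (auto simp: a_def e0_def)
  have ips: "\<tau> \<bullet> \<tau> = 1" "\<nu> \<bullet> \<nu> = 1" "\<tau> \<bullet> \<nu> = 0" "\<nu> \<bullet> \<tau> = 0"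
    using ortho by (simp_all add: norm_eq_1 inner_commute)
  define pt where "pt \<epsilon> s = p + s *\<^sub>R \<tau> + (h s - \<epsilon>) *\<^sub>R \<nu>" for \<epsilon> s
  have coord: "(pt \<epsilon> s - p) \<bullet> \<tau> = s" "(pt \<epsilon> s - p) \<bullet> \<nu> = h s - \<epsilon>" for \<epsilon> s
    using ips by (simp_all add: pt_def inner_add_left)
  have in_ball: "pt \<epsilon> s \<in> ball p \<rho>1" if "\<bar>s\<bar> \<le> a" "0 \<le> \<epsilon>" "\<epsilon> \<le> e0" for \<epsilon> s
  proof -
    have "\<bar>h s\<bar> < \<rho>1 / 4" using a0(2)[of s] that(1) a0(1) by (auto simp: a_def)
    then have b: "\<bar>s\<bar> + \<bar>h s - \<epsilon>\<bar> < \<rho>1" using that \<rho>1(1) unfolding a_def e0_def by linarith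
    have "norm (s *\<^sub>R \<tau> + (h s - \<epsilon>) *\<^sub>R \<nu>) \<le> \<bar>s\<bar> + \<bar>h s - \<epsilon>\<bar>"
      using ortho by (intro norm_triangle_le) simp
    moreover have "dist p (pt \<epsilon> s) = norm (s *\<^sub>R \<tau> + (h s - \<epsilon>) *\<^sub>R \<nu>)"
      unfolding dist_commute[of p] by (simp add: pt_def dist_norm)
    ultimately show ?thesis using b by simp
  qed
  have in_r: "pt \<epsilon> s \<in> ball p r" if "\<bar>s\<bar> \<le> a" "0 \<le> \<epsilon>" "\<epsilon> \<le> e0" for \<epsilon> s
    using in_ball[OF that] \<rho>1(2) by auto
  have in_\<Omega>: "pt \<epsilon> s \<in> \<Omega>" if "\<bar>s\<bar> \<le> a" "0 < \<epsilon>" "\<epsilon> \<le> e0" for \<epsilon> s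
    using inside[OF in_r[of s \<epsilon>]] that coord by simp
  have bdry: "pt 0 s \<in> frontier \<Omega>" and V0: "V (pt 0 s) \<bullet> (\<tau> + h' s *\<^sub>R \<nu>) = 0" if s: "\<bar>s\<bar> \<le> a" for s
  proof -
    define m where "m = \<nu> - h' s *\<^sub>R \<tau>"
    have B: "pt 0 s \<in> ball p r" "(pt 0 s - p) \<bullet> \<nu> = h ((pt 0 s - p) \<bullet> \<tau>)"
      using in_r[of s 0] s \<open>0 < e0\<close> coord by auto
    note gb = graph_boundary_point[OF \<open>open \<Omega>\<close> ortho dh graph B]
    show F: "pt 0 s \<in> frontier \<Omega>" by (rule gb(1))
    have N: "outer_unit_normal \<Omega> (pt 0 s) (m /\<^sub>R norm m)" using gb(2) by (simp add: coord m_def)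
    have "(\<tau> + h' s *\<^sub>R \<nu>) \<bullet> m = 0"
      using ips by (simp add: m_def inner_add_left inner_diff_right)
    then show "V (pt 0 s) \<bullet> (\<tau> + h' s *\<^sub>R \<nu>) = 0" by (intro tangential[OF F N]) simp
  qed
  have in_K: "pt \<epsilon> s \<in> K" if "\<bar>s\<bar> \<le> a" "0 \<le> \<epsilon>" "\<epsilon> \<le> e0" for \<epsilon> s
  proof -
    have "pt \<epsilon> s \<in> closure \<Omega>"
      using in_\<Omega>[of s \<epsilon>] bdry[of s] that closure_Un_frontier[of \<Omega>] by (cases "\<epsilon> = 0") auto
    then show ?thesis using in_ball[OF that] by (auto simp: K_def)
  qed
  have d\<psi>: "(\<psi> has_derivative (\<lambda>v. v \<bullet> V (pt \<epsilon> s))) (at (pt \<epsilon> s))" if "\<bar>s\<bar> \<le> a" "0 < \<epsilon>" "\<epsilon> \<le> e0" for \<epsilon> s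
  proof -
    have "pt \<epsilon> s \<in> \<Omega> - S" using in_\<Omega>[OF that] in_K[of s \<epsilon>] KS that by auto
    from grad[OF this] show ?thesis by (simp add: gderiv_def)
  qed
  have "continuous_on {-a..a} h'"
    using dh' \<open>a < r\<close> by (intro DERIV_continuous_on[where D = h'']) (auto intro: DERIV_subset has_field_derivative_at_within)
  then have "bounded (h' ` {-a..a})" by (intro compact_imp_bounded compact_continuous_image) auto
  then obtain H where H: "0 < H" "\<And>s. s \<in> {-a..a} \<Longrightarrow> \<bar>h' s\<bar> \<le> H" by (auto simp: bounded_pos)
  have horizontal: "\<exists>e>0. \<forall>\<epsilon> s. 0 < \<epsilon> \<and> \<epsilon> < e \<and> \<epsilon> \<le> e0 \<and> \<bar>s\<bar> \<le> a \<longrightarrow> \<bar>\<psi> (pt \<epsilon> s) - \<psi> (pt \<epsilon> 0)\<bar> \<le> \<delta>" if "0 < \<delta>" for \<delta>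
  proof -
    \<comment> \<open>The curves have speed at most \<open>1 + H\<close> and parameter length \<open>a\<close> on each side.\<close>
    define \<delta>' where "\<delta>' = \<delta> / (a * (1 + H))"
    have "0 < \<delta>'" using \<open>0 < \<delta>\<close> \<open>0 < a\<close> H(1) by (simp add: \<delta>'_def)
    then obtain e where e: "0 < e" "\<forall>x\<in>K. \<forall>y\<in>K. dist y x < e \<longrightarrow> dist (V y) (V x) < \<delta>'"
      using ucV unfolding uniformly_continuous_on_def by blast
    have "\<bar>\<psi> (pt \<epsilon> s) - \<psi> (pt \<epsilon> 0)\<bar> \<le> \<delta>" if \<epsilon>: "0 < \<epsilon>" "\<epsilon> < e" "\<epsilon> \<le> e0" and s: "\<bar>s\<bar> \<le> a" for \<epsilon> s
    proof -
      have "norm (\<psi> (pt \<epsilon> s) - \<psi> (pt \<epsilon> 0)) \<le> (\<delta>' * (1 + H)) * norm (s - 0)"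
      proof (rule differentiable_bound[where S = "{-a..a}" and f = "\<lambda>s. \<psi> (pt \<epsilon> s)"
            and f' = "\<lambda>s t. t * ((\<tau> + h' s *\<^sub>R \<nu>) \<bullet> V (pt \<epsilon> s))"])
        fix t assume "t \<in> {-a..a}"
        then have t: "\<bar>t\<bar> \<le> a" "t \<in> {-r<..<r}" using \<open>a < r\<close> by auto
        have "(h has_derivative (\<lambda>x. x * h' t)) (at t)"
          using dh[OF t(2)] by (simp add: has_field_derivative_def mult_commute_abs)
        then have "(pt \<epsilon> has_derivative (\<lambda>x. x *\<^sub>R (\<tau> + h' t *\<^sub>R \<nu>))) (at t)"
          unfolding pt_def by (auto intro!: derivative_eq_intros simp: algebra_simps)
        from has_derivative_compose[OF this d\<psi>[OF t(1) \<epsilon>(1,3)]]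
        show "((\<lambda>s. \<psi> (pt \<epsilon> s)) has_derivative (\<lambda>x. x * ((\<tau> + h' t *\<^sub>R \<nu>) \<bullet> V (pt \<epsilon> t)))) (at t within {-a..a})"
          by (simp add: has_derivative_at_withinI)
        have kk: "pt \<epsilon> t \<in> K" "pt 0 t \<in> K" using in_K[of t \<epsilon>] in_K[of t 0] t \<epsilon> \<open>0 < e0\<close> by auto
        have "pt \<epsilon> t - pt 0 t = - (\<epsilon> *\<^sub>R \<nu>)" by (simp add: pt_def algebra_simps)
        then have "dist (pt \<epsilon> t) (pt 0 t) < e" using \<epsilon> ortho(2) by (simp add: dist_norm)
        then have "dist (V (pt \<epsilon> t)) (V (pt 0 t)) < \<delta>'" using e(2) kk by blast
        moreover have "norm (\<tau> + h' t *\<^sub>R \<nu>) \<le> 1 + H"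
          using ortho H(2)[OF \<open>t \<in> {-a..a}\<close>] by (intro norm_triangle_le) simp
        ultimately have "norm (\<tau> + h' t *\<^sub>R \<nu>) * norm (V (pt \<epsilon> t) - V (pt 0 t)) \<le> (1 + H) * \<delta>'"
          using H(1) by (intro mult_mono) (auto simp: dist_norm)
        moreover have "(\<tau> + h' t *\<^sub>R \<nu>) \<bullet> V (pt \<epsilon> t) = (\<tau> + h' t *\<^sub>R \<nu>) \<bullet> (V (pt \<epsilon> t) - V (pt 0 t))"
          using V0[OF t(1)] by (simp add: inner_diff_right inner_commute)
        ultimately have b: "\<bar>(\<tau> + h' t *\<^sub>R \<nu>) \<bullet> V (pt \<epsilon> t)\<bar> \<le> \<delta>' * (1 + H)"
          using Cauchy_Schwarz_ineq2[of "\<tau> + h' t *\<^sub>R \<nu>" "V (pt \<epsilon> t) - V (pt 0 t)"] by (simp add: mult.commute)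
        show "onorm (\<lambda>x. x * ((\<tau> + h' t *\<^sub>R \<nu>) \<bullet> V (pt \<epsilon> t))) \<le> \<delta>' * (1 + H)"
        proof (rule onorm_le)
          fix x :: real
          show "norm (x * ((\<tau> + h' t *\<^sub>R \<nu>) \<bullet> V (pt \<epsilon> t))) \<le> \<delta>' * (1 + H) * norm x"
            using mult_left_mono[OF b abs_ge_zero[of x]] by (simp add: abs_mult mult.commute)
        qed
      qed (use s \<open>0 < a\<close> in auto)
      also have "\<dots> \<le> (\<delta>' * (1 + H)) * a" using s \<open>0 < \<delta>'\<close> H(1) by (intro mult_left_mono) auto
      also have "\<dots> = \<delta>' * (a * (1 + H))" by simp
      also have "\<dots> = \<delta>" unfolding \<delta>'_def
        by (rule nonzero_eq_divide_eq[THEN iffD1, OF _ refl]) (use \<open>0 < a\<close> H(1) in simp)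
      finally show ?thesis by simp
    qed
    then show ?thesis using e(1) by (intro exI[of _ e]) auto
  qed
  have "uniformly_continuous_on {0<..e0} (\<lambda>\<epsilon>. \<psi> (pt \<epsilon> 0))"
  proof (rule lipschitz_on_uniformly_continuous[of M], rule lipschitz_onI)
    fix x y assume xy: "x \<in> {0<..e0}" "y \<in> {0<..e0}"
    have "norm (\<psi> (pt x 0) - \<psi> (pt y 0)) \<le> M * norm (x - y)"
    proof (rule differentiable_bound[where S = "{0<..e0}" and f = "\<lambda>\<epsilon>. \<psi> (pt \<epsilon> 0)" and f' = "\<lambda>\<epsilon> t. (- t *\<^sub>R \<nu>) \<bullet> V (pt \<epsilon> 0)"])
      fix t assume t: "t \<in> {0<..e0}"
      have "((\<lambda>\<epsilon>. pt \<epsilon> 0) has_derivative (\<lambda>x. - x *\<^sub>R \<nu>)) (at t)"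
        unfolding pt_def by (auto intro!: derivative_eq_intros)
      moreover have "(\<psi> has_derivative (\<lambda>v. v \<bullet> V (pt t 0))) (at (pt t 0))" using d\<psi>[of 0 t] t \<open>0 < a\<close> by auto
      ultimately have "((\<lambda>\<epsilon>. \<psi> (pt \<epsilon> 0)) has_derivative (\<lambda>x. (- x *\<^sub>R \<nu>) \<bullet> V (pt t 0))) (at t)"
        by (rule has_derivative_compose)
      then show "((\<lambda>\<epsilon>. \<psi> (pt \<epsilon> 0)) has_derivative (\<lambda>x. (- x *\<^sub>R \<nu>) \<bullet> V (pt t 0))) (at t within {0<..e0})"
        by (rule has_derivative_at_withinI)
      have "norm (V (pt t 0)) \<le> M" using M(2) in_K[of 0 t] t \<open>0 < a\<close> by auto
      then have nV: "\<bar>\<nu> \<bullet> V (pt t 0)\<bar> \<le> M" using Cauchy_Schwarz_ineq2[of \<nu> "V (pt t 0)"] ortho(2) by simp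
      show "onorm (\<lambda>x. (- x *\<^sub>R \<nu>) \<bullet> V (pt t 0)) \<le> M"
      proof (rule onorm_le)
        fix x :: real
        show "norm ((- x *\<^sub>R \<nu>) \<bullet> V (pt t 0)) \<le> M * norm x"
          using mult_left_mono[OF nV abs_ge_zero[of x]] by (simp add: abs_mult mult.commute)
      qed
    qed (use xy in auto)
    then show "dist (\<psi> (pt x 0)) (\<psi> (pt y 0)) \<le> M * dist x y" by (simp add: dist_norm)
  qed (use M(1) in simp)
  moreover have "0 \<in> closure {0<..e0}" using \<open>0 < e0\<close> by (simp add: closure_greaterThanAtMost)
  ultimately obtain c where c: "((\<lambda>\<epsilon>. \<psi> (pt \<epsilon> 0)) \<longlongrightarrow> c) (at 0 within {0<..e0})"
    using uniformly_continuous_on_extension_at_closure by blast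
  have near: "\<exists>e>0. \<forall>\<epsilon> s. 0 < \<epsilon> \<and> \<epsilon> < e \<and> \<bar>s\<bar> \<le> a \<longrightarrow> dist (\<psi> (pt \<epsilon> s)) c < \<delta>" if "0 < \<delta>" for \<delta>
  proof -
    have "0 < \<delta> / 2" using \<open>0 < \<delta>\<close> by simp
    from horizontal[OF this] obtain e1 where e1: "0 < e1"
      "\<forall>\<epsilon> s. 0 < \<epsilon> \<and> \<epsilon> < e1 \<and> \<epsilon> \<le> e0 \<and> \<bar>s\<bar> \<le> a \<longrightarrow> \<bar>\<psi> (pt \<epsilon> s) - \<psi> (pt \<epsilon> 0)\<bar> \<le> \<delta> / 2" by blast
    from c \<open>0 < \<delta> / 2\<close> have "\<forall>\<^sub>F \<epsilon> in at 0 within {0<..e0}. dist (\<psi> (pt \<epsilon> 0)) c < \<delta> / 2" by (rule tendstoD)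
    then obtain e2 where e2: "0 < e2" "\<forall>\<epsilon>\<in>{0<..e0}. \<epsilon> \<noteq> 0 \<and> dist \<epsilon> 0 < e2 \<longrightarrow> dist (\<psi> (pt \<epsilon> 0)) c < \<delta> / 2"
      unfolding eventually_at by blast
    show ?thesis
    proof (intro exI[of _ "min e0 (min e1 e2)"] conjI allI impI)
      fix \<epsilon> s assume *: "0 < \<epsilon> \<and> \<epsilon> < min e0 (min e1 e2) \<and> \<bar>s\<bar> \<le> a"
      then have "\<bar>\<psi> (pt \<epsilon> s) - \<psi> (pt \<epsilon> 0)\<bar> \<le> \<delta> / 2" using e1(2) by auto
      moreover have "dist (\<psi> (pt \<epsilon> 0)) c < \<delta> / 2" using e2(2) * by auto
      ultimately show "dist (\<psi> (pt \<epsilon> s)) c < \<delta>" unfolding dist_real_def by linarith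
    qed (use \<open>0 < e0\<close> e1(1) e2(1) in auto)
  qed
  show ?thesis
  proof (rule exI[of _ c], rule exI[of _ a], intro conjI ballI)
    show "0 < a" by fact
    fix q assume q: "q \<in> frontier \<Omega> \<inter> ball p a"
    have "a \<le> \<rho>1" using \<rho>1(1) by (simp add: a_def)
    then have qr: "q \<in> ball p r" using q \<rho>1(2) by auto
    define \<Phi> where "\<Phi> x = h ((x - p) \<bullet> \<tau>) - (x - p) \<bullet> \<nu>" for x
    have small: "\<bar>(x - p) \<bullet> \<tau>\<bar> < a" if "x \<in> ball p a" for x
      using that Cauchy_Schwarz_ineq2[of "x - p" \<tau>] ortho(1) by (simp add: dist_norm norm_minus_commute)
    have "isCont h ((q - p) \<bullet> \<tau>)"
      using small[of q] q \<open>a < r\<close> by (intro DERIV_isCont[OF dh]) auto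
    then have "((\<lambda>x. h ((x - p) \<bullet> \<tau>)) \<longlongrightarrow> h ((q - p) \<bullet> \<tau>)) (at q within \<Omega>)"
      by (rule isCont_tendsto_compose) (intro tendsto_intros)
    then have lim: "(\<Phi> \<longlongrightarrow> \<Phi> q) (at q within \<Omega>)"
      unfolding \<Phi>_def by (intro tendsto_intros)
    have "(q - p) \<bullet> \<nu> \<ge> h ((q - p) \<bullet> \<tau>)"
    proof (rule ccontr)
      assume "\<not> ?thesis"
      then have "q \<in> \<Omega>" using inside[OF qr] by simp
      then show False using q \<open>open \<Omega>\<close> by (simp add: frontier_def interior_open)
    qed
    then have "\<Phi> q \<le> 0" by (simp add: \<Phi>_def)
    have ev_in: "\<forall>\<^sub>F x in at q within \<Omega>. x \<in> ball p a \<and> x \<in> \<Omega>"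
      unfolding eventually_at_topological using q by (intro exI[of _ "ball p a"]) auto
    show "(\<psi> \<longlongrightarrow> c) (at q within \<Omega>)"
    proof (rule tendstoI)
      fix \<delta> :: real assume "0 < \<delta>"
      from near[OF this] obtain e where e: "0 < e" "\<forall>\<epsilon> s. 0 < \<epsilon> \<and> \<epsilon> < e \<and> \<bar>s\<bar> \<le> a \<longrightarrow> dist (\<psi> (pt \<epsilon> s)) c < \<delta>" by blast
      have "\<forall>\<^sub>F x in at q within \<Omega>. \<Phi> x < e" by (rule order_tendstoD(2)[OF lim]) (use \<open>\<Phi> q \<le> 0\<close> e(1) in linarith)
      with ev_in show "\<forall>\<^sub>F x in at q within \<Omega>. dist (\<psi> x) c < \<delta>"
      proof eventually_elim
        case (elim x)
        have "x \<in> ball p r" using elim(1) \<open>a \<le> \<rho>1\<close> \<rho>1(2) by auto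
        then have "0 < \<Phi> x" using inside elim(1) by (simp add: \<Phi>_def)
        have "pt (\<Phi> x) ((x - p) \<bullet> \<tau>) = x"
          using orthonormal_expansion_2[OF ortho, of "x - p"] by (simp add: pt_def \<Phi>_def algebra_simps)
        moreover have "\<bar>(x - p) \<bullet> \<tau>\<bar> \<le> a" using small[of x] elim(1) by simp
        ultimately show ?case using e(2) \<open>0 < \<Phi> x\<close> elim(2) by metis
      qed
    qed
  qed
qed

text \<open>The boundary value is unique and locally constant on the connected boundary.\<close>
lemma constant_boundary_values:
  fixes \<Omega> :: "(real^2) set" and V :: "real^2 \<Rightarrow> real^2"
  assumes "open \<Omega>" "bounded \<Omega>" "connected (frontier \<Omega>)" and C2: "C2_holder_boundary \<gamma> \<Omega>"
    and "finite S" "S \<subseteq> \<Omega>"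
    and grad: "\<And>x. x \<in> \<Omega> - S \<Longrightarrow> GDERIV \<psi> x :> V x"
    and cont: "continuous_on (closure \<Omega> - S) V"
    and tangential: "\<And>q n w. q \<in> frontier \<Omega> \<Longrightarrow> outer_unit_normal \<Omega> q n \<Longrightarrow> w \<bullet> n = 0 \<Longrightarrow> V q \<bullet> w = 0"
  shows "\<exists>c. \<forall>q\<in>frontier \<Omega>. (\<psi> \<longlongrightarrow> c) (at q within \<Omega>)"
proof -
  have loc: "\<exists>c. \<exists>\<rho>>0. \<forall>q\<in>frontier \<Omega> \<inter> ball p \<rho>. (\<psi> \<longlongrightarrow> c) (at q within \<Omega>)" if "p \<in> frontier \<Omega>" for p
    by (rule locally_constant_boundary_values[OF assms(1,2) C2 assms(5,6) grad cont tangential that])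
  define L where "L q = Lim (at q within \<Omega>) \<psi>" for q
  have nontriv: "at q within \<Omega> \<noteq> bot" if "q \<in> frontier \<Omega>" for q
  proof -
    have "q \<in> closure \<Omega>" "q \<notin> \<Omega>" using that \<open>open \<Omega>\<close> by (auto simp: frontier_def interior_open)
    then show ?thesis by (simp add: closure_def trivial_limit_within)
  qed
  have Leq: "L q = c" if "q \<in> frontier \<Omega>" "(\<psi> \<longlongrightarrow> c) (at q within \<Omega>)" for q c
    unfolding L_def by (rule tendsto_Lim[OF nontriv[OF that(1)] that(2)])
  have limL: "(\<psi> \<longlongrightarrow> L q) (at q within \<Omega>)" if q: "q \<in> frontier \<Omega>" for q
  proof -
    obtain c \<rho> where "0 < \<rho>" "\<forall>x\<in>frontier \<Omega> \<inter> ball q \<rho>. (\<psi> \<longlongrightarrow> c) (at x within \<Omega>)" using loc[OF q] by blast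
    then have "(\<psi> \<longlongrightarrow> c) (at q within \<Omega>)" using q by simp
    then show ?thesis using Leq[OF q] by simp
  qed
  have "L a = L b" if "a \<in> frontier \<Omega>" "b \<in> frontier \<Omega>" for a b
  proof (rule connected_local_const[OF assms(3) that], rule ballI)
    fix p assume p: "p \<in> frontier \<Omega>"
    obtain c \<rho> where \<rho>: "0 < \<rho>" "\<forall>x\<in>frontier \<Omega> \<inter> ball p \<rho>. (\<psi> \<longlongrightarrow> c) (at x within \<Omega>)" using loc[OF p] by blast
    have "L x = c" if "x \<in> frontier \<Omega> \<inter> ball p \<rho>" for x using Leq \<rho>(2) that by blast
    then show "\<forall>\<^sub>F b in at p within frontier \<Omega>. L p = L b"
      unfolding eventually_at_topological using p \<rho>(1) by (intro exI[of _ "ball p \<rho>"]) auto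
  qed
  then have "\<forall>q\<in>frontier \<Omega>. \<forall>a\<in>frontier \<Omega>. (\<psi> \<longlongrightarrow> L a) (at q within \<Omega>)" using limL by metis
  then show ?thesis by (cases "frontier \<Omega> = {}") (simp, blast)
qed

text \<open>The modulus of \<open>exp (- \<i> * f z)\<close> is \<open>exp (Im (f z))\<close>. If \<open>Im f\<close> exceeded \<open>c\<close> somewhere, it would attain its
  supremum in \<open>S\<close>, and the maximum modulus principle would make it constant.\<close>
lemma imaginary_part_le_boundary_value:
  assumes hol: "f holomorphic_on S" and S: "open S" "connected S" "bounded S"
    and bdry: "\<And>q. q \<in> frontier S \<Longrightarrow> ((\<lambda>z. Im (f z)) \<longlongrightarrow> c) (at q within S)"
    and z0: "z0 \<in> S"
  shows "Im (f z0) \<le> c"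
proof (rule ccontr)
  assume above: "\<not> Im (f z0) \<le> c"
  \<comment> \<open>A level strictly above the boundary value, so that the superlevel set \<open>K\<close> is compact in \<open>S\<close>.\<close>
  define d where "d = (c + Im (f z0)) / 2"
  have d: "c < d" "d < Im (f z0)" using above by (auto simp: d_def)
  define K where "K = {z \<in> S. d \<le> Im (f z)}"
  have cf: "continuous_on S f" using hol by (rule holomorphic_on_imp_continuous_on)
  have "closed K"
    unfolding closed_limpt
  proof (intro allI impI)
    fix x assume x: "x islimpt K"
    have KS: "K \<subseteq> S" by (auto simp: K_def)
    have "x \<in> closure S" using islimpt_subset[OF x KS] by (simp add: closure_def)
    have nb: "at x within K \<noteq> bot" using x by (simp add: trivial_limit_within)
    have ev: "\<forall>\<^sub>F z in at x within K. d \<le> Im (f z)" by (auto simp: eventually_at_filter K_def)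
    show "x \<in> K"
    proof (cases "x \<in> S")
      case True
      then have "((\<lambda>z. Im (f z)) \<longlongrightarrow> Im (f x)) (at x within K)"
        using cf KS by (auto intro!: tendsto_intros simp: continuous_on_def intro: tendsto_within_subset)
      then have "d \<le> Im (f x)" using ev nb by (rule tendsto_lowerbound)
      then show ?thesis using True by (simp add: K_def)
    next
      case False
      then have "x \<in> frontier S" using \<open>x \<in> closure S\<close> S(1) by (simp add: frontier_def interior_open)
      then have "((\<lambda>z. Im (f z)) \<longlongrightarrow> c) (at x within K)" using bdry KS tendsto_within_subset by blast
      then have "d \<le> c" using ev nb by (rule tendsto_lowerbound)
      then show ?thesis using d by simp
    qed
  qed
  moreover have "bounded K" using S(3) by (rule bounded_subset) (auto simp: K_def)
  ultimately have "compact K" by (simp add: compact_eq_bounded_closed)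
  moreover have "z0 \<in> K" using z0 d by (simp add: K_def)
  moreover have "continuous_on K (\<lambda>z. Im (f z))"
    by (intro continuous_intros continuous_on_subset[OF cf]) (auto simp: K_def)
  ultimately obtain \<xi> where \<xi>: "\<xi> \<in> K" "\<And>z. z \<in> K \<Longrightarrow> Im (f z) \<le> Im (f \<xi>)"
    using continuous_attains_sup[of K "\<lambda>z. Im (f z)"] by blast
  have "\<xi> \<in> S" using \<xi>(1) by (simp add: K_def)
  have max: "Im (f z) \<le> Im (f \<xi>)" if "z \<in> S" for z
    using \<xi>(2)[of z] \<xi>(1) that by (cases "d \<le> Im (f z)") (auto simp: K_def)
  have "(\<lambda>z. exp (- \<i> * f z)) constant_on S"
  proof (rule maximum_modulus_principle[where U = S and \<xi> = \<xi>])
    show "(\<lambda>z. exp (- \<i> * f z)) holomorphic_on S" by (intro holomorphic_intros hol)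
    show "norm (exp (- \<i> * f z)) \<le> norm (exp (- \<i> * f \<xi>))" if "z \<in> S" for z
      using max[OF that] by simp
  qed (use S \<open>\<xi> \<in> S\<close> in auto)
  then have const: "exp (- \<i> * f z) = exp (- \<i> * f \<xi>)" if "z \<in> S" for z
    using that \<open>\<xi> \<in> S\<close> by (auto simp: constant_on_def)
  have Imc: "Im (f z) = Im (f \<xi>)" if "z \<in> S" for z
    using arg_cong[OF const[OF that], of norm] by simp
  have "frontier S \<noteq> {}" using S(3) z0 not_bounded_UNIV by (auto simp: frontier_eq_empty)
  then obtain q where q: "q \<in> frontier S" by blast
  then have "at q within S \<noteq> bot" using S(1) by (auto simp: trivial_limit_within frontier_def interior_open closure_def)
  moreover have "((\<lambda>z. Im (f z)) \<longlongrightarrow> Im (f \<xi>)) (at q within S)"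
    by (rule tendsto_eventually) (use Imc in \<open>auto simp: eventually_at_filter\<close>)
  ultimately have "Im (f \<xi>) = c" using bdry[OF q] tendsto_unique by blast
  then show False using \<xi>(1) d by (simp add: K_def)
qed

lemma deriv_eq_0_of_constant_boundary_imaginary_part:
  assumes hol: "f holomorphic_on S" and S: "open S" "connected S" "bounded S"
    and bdry: "\<And>q. q \<in> frontier S \<Longrightarrow> ((\<lambda>z. Im (f z)) \<longlongrightarrow> c) (at q within S)"
    and z: "z \<in> S"
  shows "deriv f z = 0"
proof -
  have le: "Im (f w) \<le> c" if "w \<in> S" for w
    using imaginary_part_le_boundary_value[OF hol S bdry that] .
  have "((\<lambda>w. Im (- f w)) \<longlongrightarrow> - c) (at q within S)" if "q \<in> frontier S" for q
    using tendsto_minus[OF bdry[OF that]] by simp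
  then have "Im (- f w) \<le> - c" if "w \<in> S" for w
    using imaginary_part_le_boundary_value[of "\<lambda>w. - f w" S "- c" w] hol S that
    by (auto intro: holomorphic_intros)
  then have eq: "Im (f w) = c" if "w \<in> S" for w using le[OF that] that by force
  have "(\<lambda>z. exp (- \<i> * f z)) constant_on S"
  proof (rule maximum_modulus_principle[where U = S and \<xi> = z])
    show "(\<lambda>z. exp (- \<i> * f z)) holomorphic_on S" by (intro holomorphic_intros hol)
    show "norm (exp (- \<i> * f w)) \<le> norm (exp (- \<i> * f z))" if "w \<in> S" for w
      using eq[OF that] eq[OF z] by simp
  qed (use S z in auto)
  then obtain k where k: "\<And>w. w \<in> S \<Longrightarrow> exp (- \<i> * f w) = k" by (auto simp: constant_on_def)
  have "((\<lambda>w. exp (- \<i> * f w)) has_field_derivative exp (- \<i> * f z) * (- \<i> * deriv f z)) (at z)"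
    by (rule derivative_eq_intros holomorphic_derivI[OF hol S(1) z] refl)+ simp
  moreover have "((\<lambda>w. exp (- \<i> * f w)) has_field_derivative 0) (at z)"
    by (rule has_field_derivative_transform_within_open[where f = "\<lambda>w. k" and S = S]) (use k S(1) z in auto)
  ultimately have "exp (- \<i> * f z) * (- \<i> * deriv f z) = 0" by (rule DERIV_unique)
  then show ?thesis by simp
qed

section \<open>From the Neumann problem to holomorphic functions\<close>

text \<open>The mean value theorem in the direction \<open>a\<close> turns the second difference of \<open>u\<close> into a first difference
  of the gradient, which differentiability at \<open>x\<close> evaluates.\<close>
lemma second_difference_estimate:
  fixes u :: "'a::real_inner \<Rightarrow> real" and G :: "'a \<Rightarrow> 'a"
  assumes d: "0 < d" and grad: "\<And>y. y \<in> ball x d \<Longrightarrow> GDERIV u y :> G y"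
    and "bounded_linear G'"
    and lin: "\<And>y. y \<in> ball x d \<Longrightarrow> norm (G y - G x - G' (y - x)) \<le> \<epsilon> * norm (y - x)" and "0 \<le> \<epsilon>"
    and h: "0 < h" "h * (norm a + norm b) < d"
  shows "\<bar>(u (x + h *\<^sub>R a + h *\<^sub>R b) - u (x + h *\<^sub>R a) - u (x + h *\<^sub>R b) + u x) / h\<^sup>2 - a \<bullet> G' b\<bar>
          \<le> 2 * \<epsilon> * norm a * (norm a + norm b)"
proof -
  interpret G': bounded_linear G' by fact
  define N where "N = norm a + norm b"
  have small: "norm (s *\<^sub>R a + t *\<^sub>R b) \<le> h * N" if "0 \<le> s" "s \<le> h" "0 \<le> t" "t \<le> h" for s t
  proof -
    have "norm (s *\<^sub>R a + t *\<^sub>R b) \<le> s * norm a + t * norm b" using that by (intro norm_triangle_le) simp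
    also have "\<dots> \<le> h * norm a + h * norm b" using that by (intro add_mono mult_right_mono) auto
    finally show ?thesis by (simp add: N_def algebra_simps)
  qed
  have inb: "x + s *\<^sub>R a + t *\<^sub>R b \<in> ball x d" if "0 \<le> s" "s \<le> h" "0 \<le> t" "t \<le> h" for s t
  proof -
    have "dist x (x + s *\<^sub>R a + t *\<^sub>R b) = norm (s *\<^sub>R a + t *\<^sub>R b)"
      unfolding dist_commute[of x] by (simp add: dist_norm)
    then show ?thesis using small[OF that] h(2) by (simp add: N_def)
  qed
  define f where "f s = u (x + s *\<^sub>R a + h *\<^sub>R b) - u (x + s *\<^sub>R a + 0 *\<^sub>R b)" for s
  define f' where "f' s = a \<bullet> G (x + s *\<^sub>R a + h *\<^sub>R b) - a \<bullet> G (x + s *\<^sub>R a + 0 *\<^sub>R b)" for s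
  have df: "(f has_real_derivative f' s) (at s)" if s: "0 \<le> s" "s \<le> h" for s
  proof -
    have du: "((\<lambda>s. u (x + s *\<^sub>R a + t *\<^sub>R b)) has_derivative (\<lambda>k. (k *\<^sub>R a) \<bullet> G (x + s *\<^sub>R a + t *\<^sub>R b))) (at s)"
      if t: "0 \<le> t" "t \<le> h" for t
    proof -
      have "((\<lambda>s. x + s *\<^sub>R a + t *\<^sub>R b) has_derivative (\<lambda>k. k *\<^sub>R a)) (at s)"
        by (auto intro!: derivative_eq_intros)
      moreover have "(u has_derivative (\<lambda>k. k \<bullet> G (x + s *\<^sub>R a + t *\<^sub>R b))) (at (x + s *\<^sub>R a + t *\<^sub>R b))"
        using grad[OF inb[OF s t]] by (simp add: gderiv_def)
      ultimately show ?thesis by (rule has_derivative_compose)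
    qed
    show ?thesis
      unfolding has_field_derivative_def f_def
      by (rule has_derivative_eq_rhs[OF has_derivative_diff[OF du[of h] du[of 0]]])
        (use h in \<open>auto simp: f'_def fun_eq_iff algebra_simps\<close>)
  qed
  obtain \<xi> where \<xi>: "0 < \<xi>" "\<xi> < h" "f h - f 0 = (h - 0) * f' \<xi>"
    using MVT2[OF h(1), of f f'] df by blast
  let ?p = "x + \<xi> *\<^sub>R a + h *\<^sub>R b" and ?q = "x + \<xi> *\<^sub>R a + 0 *\<^sub>R b"
  have pq: "?p \<in> ball x d" "?q \<in> ball x d" using inb[of \<xi> h] inb[of \<xi> 0] \<xi> h by auto
  have np: "norm (?p - x) \<le> h * N" "norm (?q - x) \<le> h * N"
    using small[of \<xi> h] small[of \<xi> 0] \<xi> h by (auto simp: algebra_simps)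
  have e: "norm (G ?p - G x - G' (?p - x)) \<le> \<epsilon> * (h * N)" "norm (G ?q - G x - G' (?q - x)) \<le> \<epsilon> * (h * N)"
    using order_trans[OF lin[OF pq(1)] mult_left_mono[OF np(1) \<open>0 \<le> \<epsilon>\<close>]]
      order_trans[OF lin[OF pq(2)] mult_left_mono[OF np(2) \<open>0 \<le> \<epsilon>\<close>]] by auto
  have "f' \<xi> - a \<bullet> G' (h *\<^sub>R b) = a \<bullet> ((G ?p - G x - G' (?p - x)) - (G ?q - G x - G' (?q - x)))"
  proof -
    have "G' (?p - x) - G' (?q - x) = G' (h *\<^sub>R b)" unfolding G'.diff[symmetric] by simp
    then have "(G ?p - G x - G' (?p - x)) - (G ?q - G x - G' (?q - x)) = G ?p - G ?q - G' (h *\<^sub>R b)"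
      by (simp add: algebra_simps)
    then show ?thesis unfolding f'_def by (simp only: inner_diff_right)
  qed
  then have "\<bar>f' \<xi> - a \<bullet> G' (h *\<^sub>R b)\<bar> \<le> norm a * norm ((G ?p - G x - G' (?p - x)) - (G ?q - G x - G' (?q - x)))"
    using Cauchy_Schwarz_ineq2 by simp
  also have "\<dots> \<le> norm a * (\<epsilon> * (h * N) + \<epsilon> * (h * N))"
    using e norm_triangle_ineq4[of "G ?p - G x - G' (?p - x)" "G ?q - G x - G' (?q - x)"]
    by (intro mult_left_mono) (linarith, simp)
  finally have est: "\<bar>f' \<xi> - h * (a \<bullet> G' b)\<bar> \<le> h * (2 * \<epsilon> * norm a * N)"
    by (simp add: G'.scaleR algebra_simps)
  have "(u (x + h *\<^sub>R a + h *\<^sub>R b) - u (x + h *\<^sub>R a) - u (x + h *\<^sub>R b) + u x) = h * f' \<xi>"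
    using \<xi>(3) by (simp add: f_def)
  then have "(u (x + h *\<^sub>R a + h *\<^sub>R b) - u (x + h *\<^sub>R a) - u (x + h *\<^sub>R b) + u x) / h\<^sup>2 - a \<bullet> G' b =
      (f' \<xi> - h * (a \<bullet> G' b)) / h"
    using h(1) by (simp add: field_simps power2_eq_square)
  then show ?thesis using est h(1) by (simp add: N_def pos_divide_le_eq mult.commute)
qed

text \<open>Schwarz's theorem at a point where the gradient is differentiable: the second difference is symmetric
  in \<open>a\<close> and \<open>b\<close>.\<close>
lemma gradient_derivative_symmetric:
  fixes u :: "'a::real_inner \<Rightarrow> real" and G :: "'a \<Rightarrow> 'a"
  assumes "open \<Omega>" "x \<in> \<Omega>" and grad: "\<And>y. y \<in> \<Omega> \<Longrightarrow> GDERIV u y :> G y"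
    and dG: "(G has_derivative G') (at x)"
  shows "a \<bullet> G' b = b \<bullet> G' a"
proof -
  define N where "N = norm a + norm b"
  have "0 \<le> N" by (simp add: N_def)
  have bl: "bounded_linear G'" using dG by (rule has_derivative_bounded_linear)
  have "\<bar>a \<bullet> G' b - b \<bullet> G' a\<bar> \<le> \<epsilon> * (2 * N * N)" if "0 < \<epsilon>" for \<epsilon>
  proof -
    obtain d1 where d1: "0 < d1" "\<And>y. norm (y - x) < d1 \<Longrightarrow> norm (G y - G x - G' (y - x)) \<le> \<epsilon> * norm (y - x)"
      using dG \<open>0 < \<epsilon>\<close> unfolding has_derivative_at_alt by blast
    obtain d2 where d2: "0 < d2" "ball x d2 \<subseteq> \<Omega>" using assms(1,2) by (meson openE)
    define d where "d = min d1 d2"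
    have "0 < d" using d1(1) d2(1) by (simp add: d_def)
    have grad': "GDERIV u y :> G y" and lin: "norm (G y - G x - G' (y - x)) \<le> \<epsilon> * norm (y - x)" if "y \<in> ball x d" for y
      using that d2(2) d1(2)[of y] by (auto simp: d_def dist_norm norm_minus_commute intro!: grad)
    define h where "h = d / (2 * (N + 1))"
    have "0 < h" using \<open>0 < d\<close> \<open>0 \<le> N\<close> by (simp add: h_def)
    have "h * N \<le> h * (N + 1)" using \<open>0 < h\<close> by simp
    also have "\<dots> = d / 2" using \<open>0 \<le> N\<close> by (simp add: h_def field_simps)
    finally have hN: "h * N < d" using \<open>0 < d\<close> by simp
    define \<Delta> where "\<Delta> = (u (x + h *\<^sub>R a + h *\<^sub>R b) - u (x + h *\<^sub>R a) - u (x + h *\<^sub>R b) + u x) / h\<^sup>2"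
    have 1: "\<bar>\<Delta> - a \<bullet> G' b\<bar> \<le> 2 * \<epsilon> * norm a * N"
      unfolding \<Delta>_def N_def
      by (rule second_difference_estimate[OF \<open>0 < d\<close> grad' bl lin _ \<open>0 < h\<close>])
        (use hN \<open>0 < \<epsilon>\<close> in \<open>auto simp: N_def\<close>)
    have "\<bar>(u (x + h *\<^sub>R b + h *\<^sub>R a) - u (x + h *\<^sub>R b) - u (x + h *\<^sub>R a) + u x) / h\<^sup>2 - b \<bullet> G' a\<bar>
          \<le> 2 * \<epsilon> * norm b * (norm b + norm a)"
      by (rule second_difference_estimate[OF \<open>0 < d\<close> grad' bl lin _ \<open>0 < h\<close>])
        (use hN \<open>0 < \<epsilon>\<close> in \<open>auto simp: N_def add.commute\<close>)
    moreover have "(u (x + h *\<^sub>R b + h *\<^sub>R a) - u (x + h *\<^sub>R b) - u (x + h *\<^sub>R a) + u x) / h\<^sup>2 = \<Delta>"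
      by (simp add: \<Delta>_def algebra_simps)
    ultimately have 2: "\<bar>\<Delta> - b \<bullet> G' a\<bar> \<le> 2 * \<epsilon> * norm b * N" by (simp add: N_def add.commute)
    have "2 * \<epsilon> * norm a * N + 2 * \<epsilon> * norm b * N = \<epsilon> * (2 * N * N)"
      by (simp add: N_def algebra_simps)
    then show ?thesis using 1 2 by linarith
  qed
  then have "\<forall>\<^sub>F \<epsilon> in at_right 0. \<bar>a \<bullet> G' b - b \<bullet> G' a\<bar> \<le> \<epsilon> * (2 * N * N)"
    by (intro eventually_at_rightI[of 0 1]) auto
  moreover have "((\<lambda>\<epsilon>. \<epsilon> * (2 * N * N)) \<longlongrightarrow> 0 * (2 * N * N)) (at_right 0)" by (intro tendsto_intros)
  ultimately have "\<bar>a \<bullet> G' b - b \<bullet> G' a\<bar> \<le> 0 * (2 * N * N)"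
    by (intro tendsto_lowerbound[where F = "at_right (0::real)"]) simp_all
  then show ?thesis by simp
qed

text \<open>In the coordinate \<open>stretch lam x\<close> the operator \<open>div (L grad)\<close> is a multiple of the Laplacian, and the gradient
  of a solution corresponds to a holomorphic function \<open>P\<close>, namely \<open>field_of_complex lam P\<close>.\<close>
definition stretch :: "real \<Rightarrow> real^2 \<Rightarrow> complex" where
  "stretch lam x = Complex (lam * x $ 1) (x $ 2)"

definition unstretch :: "real \<Rightarrow> complex \<Rightarrow> real^2" where
  "unstretch lam w = vector [Re w / lam, Im w]"

definition field_of_complex :: "real \<Rightarrow> complex \<Rightarrow> real^2" where
  "field_of_complex lam w = vector [lam * Re w, - Im w]"

lemma unstretch_stretch: "lam \<noteq> 0 \<Longrightarrow> unstretch lam (stretch lam x) = x"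
  by (simp add: stretch_def unstretch_def vec_eq_iff forall_2)

lemma stretch_unstretch: "lam \<noteq> 0 \<Longrightarrow> stretch lam (unstretch lam w) = w"
  by (simp add: stretch_def unstretch_def complex_eq_iff)

lemma bounded_linear_stretch: "bounded_linear (stretch lam)"
proof (rule linear_conv_bounded_linear[THEN iffD1], rule linearI)
  show "stretch lam (x + y) = stretch lam x + stretch lam y" for x y
    by (simp add: stretch_def complex_eq_iff algebra_simps)
  show "stretch lam (r *\<^sub>R x) = r *\<^sub>R stretch lam x" for r x
    by (simp add: stretch_def complex_eq_iff algebra_simps)
qed

lemma bounded_linear_unstretch: "bounded_linear (unstretch lam)"
proof (rule linear_conv_bounded_linear[THEN iffD1], rule linearI)
  show "unstretch lam (x + y) = unstretch lam x + unstretch lam y" for x y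
    by (simp add: unstretch_def vec_eq_iff forall_2 add_divide_distrib)
  show "unstretch lam (r *\<^sub>R x) = r *\<^sub>R unstretch lam x" for r x
    by (simp add: unstretch_def vec_eq_iff forall_2)
qed

lemma bounded_linear_field_of_complex: "bounded_linear (field_of_complex lam)"
proof (rule linear_conv_bounded_linear[THEN iffD1], rule linearI)
  show "field_of_complex lam (x + y) = field_of_complex lam x + field_of_complex lam y" for x y
    by (simp add: field_of_complex_def vec_eq_iff forall_2 algebra_simps)
  show "field_of_complex lam (r *\<^sub>R x) = r *\<^sub>R field_of_complex lam x" for r x
    by (simp add: field_of_complex_def vec_eq_iff forall_2)
qed

lemma stretch_eq_iff: "lam \<noteq> 0 \<Longrightarrow> stretch lam x = stretch lam y \<longleftrightarrow> x = y"
  by (metis unstretch_stretch)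

text \<open>The field of a dislocation has a simple pole with imaginary residue.\<close>
lemma kfield_complex:
  assumes "lam \<noteq> 0" "x \<noteq> y"
  shows "kfield lam \<beta> x y = field_of_complex lam (- \<i> * of_real (\<beta> / (2 * pi)) / (stretch lam x - stretch lam y))"
proof -
  define a c where "a = (x - y) $ 1" and "c = (x - y) $ 2"
  define N where "N = (lam * a)\<^sup>2 + c\<^sup>2"
  have mv: "matLambda lam *v (x - y) = vector [lam * a, c]"
    by (simp add: matLambda_def matrix_vector_mult_def vec_eq_iff forall_2 sum_2 a_def c_def)
  have n: "(norm (matLambda lam *v (x - y)))\<^sup>2 = N"
    unfolding mv power2_norm_eq_inner by (simp add: inner_vec_def sum_2 N_def power2_eq_square)
  have "stretch lam x \<noteq> stretch lam y" using assms stretch_eq_iff by blast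
  then have "N \<noteq> 0"
    using assms by (simp add: N_def a_def c_def stretch_def sum_power2_eq_zero_iff)
  have s: "stretch lam x - stretch lam y = Complex (lam * a) c"
    by (simp add: stretch_def a_def c_def complex_eq_iff algebra_simps)
  have inv: "- \<i> * of_real t / Complex (lam * a) c = Complex (- t * c / N) (- t * (lam * a) / N)" for t
    by (simp add: complex_eq_iff Re_divide Im_divide N_def)
  have jt: "transpose matJ *v (x - y) = vector [- c, a]"
    by (simp add: matJ_def transpose_def matrix_vector_mult_def vec_eq_iff forall_2 sum_2 a_def c_def)
  show ?thesis
    unfolding s inv kfield_def n jt by (simp add: field_of_complex_def vec_eq_iff forall_2)
qed

lemma matL_mult: "matL \<mu> lam *v y = vector [\<mu> * y $ 1, \<mu> * lam\<^sup>2 * y $ 2]"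
  by (simp add: matL_def matrix_vector_mult_def vec_eq_iff forall_2 sum_2)

text \<open>Symmetry of the second derivatives of \<open>u\<close> and the equation for the divergence are the Cauchy-Riemann
  equations for \<open>P\<close>.\<close>
lemma complex_gradient_holomorphic:
  fixes u :: "real^2 \<Rightarrow> real"
  assumes "open \<Omega>" "lam \<noteq> 0" "\<mu> \<noteq> 0"
    and grad: "\<And>x. x \<in> \<Omega> \<Longrightarrow> GDERIV u x :> G x"
    and diff: "\<And>x. x \<in> \<Omega> \<Longrightarrow> G differentiable (at x)"
    and div: "\<And>x. x \<in> \<Omega> \<Longrightarrow> divergence (\<lambda>y. matL \<mu> lam *v G y) x = 0"
  defines "P \<equiv> \<lambda>w. Complex (G (unstretch lam w) $ 1 / lam) (- (G (unstretch lam w) $ 2))"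
  shows "P holomorphic_on stretch lam ` \<Omega>"
    and "\<And>x. field_of_complex lam (P (stretch lam x)) = G x"
proof -
  show "field_of_complex lam (P (stretch lam x)) = G x" for x
    using \<open>lam \<noteq> 0\<close> by (simp add: P_def unstretch_stretch field_of_complex_def vec_eq_iff forall_2)
  have "\<exists>D. (P has_field_derivative D) (at (stretch lam x))" if x: "x \<in> \<Omega>" for x
  proof -
    define A where "A = jacobian G (at x)"
    have dG: "(G has_derivative (\<lambda>h. A *v h)) (at x)"
      unfolding A_def using diff[OF x] by (simp add: jacobian_works)
    have comp: "(A *v h) $ 1 = A $ 1 $ 1 * h $ 1 + A $ 1 $ 2 * h $ 2" "(A *v h) $ 2 = A $ 2 $ 1 * h $ 1 + A $ 2 $ 2 * h $ 2" for h
      by (simp_all add: matrix_vector_mult_def sum_2)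
    have "axis 1 1 \<bullet> (A *v axis 2 1) = axis 2 1 \<bullet> (A *v axis 1 1)"
      by (rule gradient_derivative_symmetric[OF \<open>open \<Omega>\<close> x grad dG])
    then have "(A *v axis 2 1) $ 1 = (A *v axis 1 1) $ 2" by (simp add: inner_axis')
    then have sym: "A $ 1 $ 2 = A $ 2 $ 1" by (simp add: comp axis_def)
    have "((\<lambda>y. matL \<mu> lam *v G y) has_derivative (\<lambda>h. matL \<mu> lam *v (A *v h))) (at x)"
      by (rule bounded_linear.has_derivative[OF matrix_vector_mul_bounded_linear dG])
    then have "frechet_derivative (\<lambda>y. matL \<mu> lam *v G y) (at x) = (\<lambda>h. matL \<mu> lam *v (A *v h))"
      by (rule frechet_derivative_at[symmetric])
    then have "jacobian (\<lambda>y. matL \<mu> lam *v G y) (at x) = matrix (\<lambda>h. matL \<mu> lam *v (A *v h))"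
      by (simp add: jacobian_def)
    then have "divergence (\<lambda>y. matL \<mu> lam *v G y) x = \<mu> * A $ 1 $ 1 + \<mu> * lam\<^sup>2 * A $ 2 $ 2"
      by (simp add: divergence_def trace_def sum_2 matrix_def matL_mult comp axis_def)
    then have "\<mu> * (A $ 1 $ 1 + lam\<^sup>2 * A $ 2 $ 2) = 0" using div[OF x] by (simp add: algebra_simps)
    then have harm: "A $ 1 $ 1 = - lam\<^sup>2 * A $ 2 $ 2" using \<open>\<mu> \<noteq> 0\<close> by simp
    have "(G has_derivative (\<lambda>h. A *v h)) (at (unstretch lam (stretch lam x)))"
      using dG \<open>lam \<noteq> 0\<close> by (simp add: unstretch_stretch)
    from has_derivative_compose[OF bounded_linear.has_derivative[OF bounded_linear_unstretch has_derivative_ident] this]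
    have dGu: "((\<lambda>w. G (unstretch lam w)) has_derivative (\<lambda>k. A *v unstretch lam k)) (at (stretch lam x))" .
    have blP: "bounded_linear (\<lambda>y::real^2. Complex (y $ 1 / lam) (- y $ 2))"
      by (rule linear_conv_bounded_linear[THEN iffD1], rule linearI)
        (simp_all add: complex_eq_iff add_divide_distrib)
    have "(P has_derivative (\<lambda>k. Complex ((A *v unstretch lam k) $ 1 / lam) (- (A *v unstretch lam k) $ 2))) (at (stretch lam x))"
      unfolding P_def by (rule bounded_linear.has_derivative[OF blP dGu])
    moreover have "(\<lambda>k. Complex ((A *v unstretch lam k) $ 1 / lam) (- (A *v unstretch lam k) $ 2)) =
        (\<lambda>k. Complex (A $ 1 $ 1 / lam\<^sup>2) (- A $ 2 $ 1 / lam) * k)"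
      using \<open>lam \<noteq> 0\<close> unfolding fun_eq_iff comp
      by (simp add: complex_eq_iff unstretch_def sym harm field_simps power2_eq_square)
    ultimately show ?thesis unfolding has_field_derivative_def by auto
  qed
  then show "P holomorphic_on stretch lam ` \<Omega>"
    unfolding holomorphic_on_def field_differentiable_def
    using has_field_derivative_at_within by (metis imageE)
qed

section \<open>Green's function of a simply connected domain\<close>

text \<open>The inverse maps each closed disc \<open>cball 0 a\<close> with \<open>a < 1\<close> to a compact subset of \<open>S\<close>, which a point
  approaching the boundary leaves; hence the modulus of the map tends to \<open>1\<close>.\<close>
lemma riemann_map:
  fixes S :: "complex set"
  assumes "open S" "simply_connected S" "bounded S" "S \<noteq> {}"
  obtains f where "f holomorphic_on S" "inj_on f S" "\<And>z. z \<in> S \<Longrightarrow> norm (f z) < 1"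
    "\<And>z. z \<in> S \<Longrightarrow> deriv f z \<noteq> 0"
    "\<And>q. q \<in> frontier S \<Longrightarrow> ((\<lambda>z. norm (f z)) \<longlongrightarrow> 1) (at q within S)"
proof -
  have "S \<noteq> UNIV" using \<open>bounded S\<close> not_bounded_UNIV by auto
  then obtain f g where f: "f holomorphic_on S" "g holomorphic_on ball 0 1"
    and fg: "\<forall>z\<in>S. f z \<in> ball 0 1 \<and> g (f z) = z" "\<forall>z\<in>ball 0 1. g z \<in> S \<and> f (g z) = z"
    using Riemann_mapping_theorem[of S] assms by blast
  have inj: "inj_on f S" using fg(1) by (metis inj_onI)
  have lt: "norm (f z) < 1" if "z \<in> S" for z using fg(1) that by auto
  have bdry: "((\<lambda>z. norm (f z)) \<longlongrightarrow> 1) (at q within S)" if q: "q \<in> frontier S" for q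
  proof (rule order_tendstoI)
    fix a :: real assume "1 < a"
    then show "\<forall>\<^sub>F z in at q within S. norm (f z) < a" using lt by (auto simp: eventually_at_filter intro!: always_eventually less_trans[OF lt])
  next
    fix a :: real assume "a < 1"
    have "cball 0 a \<subseteq> ball (0::complex) 1" using \<open>a < 1\<close> by auto
    then have "compact (g ` cball 0 a)" "g ` cball 0 a \<subseteq> S"
      using fg(2) f(2) by (auto intro!: compact_continuous_image holomorphic_on_imp_continuous_on intro: holomorphic_on_subset)
    moreover have "q \<notin> S" using q \<open>open S\<close> by (simp add: frontier_def interior_open)
    ultimately have "open (- g ` cball 0 a)" "q \<in> - g ` cball 0 a" by (auto simp: compact_imp_closed open_Compl)
    then have "\<forall>\<^sub>F z in at q within S. z \<in> - g ` cball 0 a" unfolding eventually_at_topological by blast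
    moreover have "\<forall>\<^sub>F z in at q within S. z \<in> S" by (auto simp: eventually_at_filter)
    ultimately show "\<forall>\<^sub>F z in at q within S. a < norm (f z)"
    proof eventually_elim
      case (elim z)
      show ?case
      proof (rule ccontr)
        assume "\<not> a < norm (f z)"
        then have "f z \<in> cball 0 a" by simp
        then have "g (f z) \<in> g ` cball 0 a" by blast
        then show False using elim fg(1) by simp
      qed
    qed
  qed
  show ?thesis
    by (rule that[OF f(1) inj lt holomorphic_injective_imp_regular[OF f(1) \<open>open S\<close> inj] bdry])
qed

lemma one_minus_cnj_mult_neq_0: "norm a < 1 \<Longrightarrow> norm w < 1 \<Longrightarrow> 1 - cnj a * w \<noteq> 0"
proof
  assume "norm a < 1" "norm w < 1" "1 - cnj a * w = 0"
  then have "norm (cnj a * w) = 1" by (metis eq_iff_diff_eq_0 norm_one)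
  moreover have "norm (cnj a * w) < 1" using mult_strict_mono'[OF \<open>norm a < 1\<close> \<open>norm w < 1\<close>] by (simp add: norm_mult)
  ultimately show False by simp
qed

text \<open>One minus the square of the modulus of a Blaschke factor is
  \<open>(1 - (norm a)\<^sup>2) * (1 - (norm w)\<^sup>2) / (norm (1 - cnj a * w))\<^sup>2\<close>.\<close>
lemma blaschke_boundary_modulus:
  assumes "norm a < 1" and lt: "\<And>z. z \<in> S \<Longrightarrow> norm (f z) < 1"
    and lim: "((\<lambda>z. norm (f z)) \<longlongrightarrow> 1) (at q within S)"
  shows "((\<lambda>z. norm ((f z - a) / (1 - cnj a * f z))) \<longlongrightarrow> 1) (at q within S)"
proof -
  define B where "B z = (norm ((f z - a) / (1 - cnj a * f z)))\<^sup>2" for z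
  have id: "(norm (1 - cnj a * w))\<^sup>2 - (norm (w - a))\<^sup>2 = (1 - (norm a)\<^sup>2) * (1 - (norm w)\<^sup>2)" for w
    unfolding cmod_power2 by (simp add: power2_eq_square algebra_simps)
  have est: "\<bar>B z - 1\<bar> \<le> (1 - (norm (f z))\<^sup>2) / (1 - norm a)\<^sup>2" if "z \<in> S" for z
  proof -
    define d where "d = norm (1 - cnj a * f z)"
    have "norm (cnj a * f z) \<le> norm a * 1" unfolding norm_mult using lt[OF that] by (intro mult_mono) auto
    then have d: "1 - norm a \<le> d" using norm_triangle_ineq2[of 1 "cnj a * f z"] by (simp add: d_def)
    then have "0 < d" using assms(1) by linarith
    have "B z - 1 = - ((1 - (norm a)\<^sup>2) * (1 - (norm (f z))\<^sup>2)) / d\<^sup>2"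
      using id[of "f z"] \<open>0 < d\<close> by (simp add: B_def norm_divide power_divide d_def[symmetric] field_simps)
    then have "\<bar>B z - 1\<bar> = \<bar>1 - (norm a)\<^sup>2\<bar> * \<bar>1 - (norm (f z))\<^sup>2\<bar> / d\<^sup>2" by (simp add: abs_mult abs_divide)
    also have "\<dots> \<le> 1 * (1 - (norm (f z))\<^sup>2) / (1 - norm a)\<^sup>2"
    proof (rule frac_le)
      have "(norm a)\<^sup>2 \<le> 1" "(norm (f z))\<^sup>2 \<le> 1" using assms(1) lt[OF that] by (simp_all add: power_le_one)
      then show "\<bar>1 - (norm a)\<^sup>2\<bar> * \<bar>1 - (norm (f z))\<^sup>2\<bar> \<le> 1 * (1 - (norm (f z))\<^sup>2)" "0 \<le> 1 * (1 - (norm (f z))\<^sup>2)"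
        using mult_right_mono[of "1 - (norm a)\<^sup>2" 1 "1 - (norm (f z))\<^sup>2"] by simp_all
      show "0 < (1 - norm a)\<^sup>2" using assms(1) by simp
      show "(1 - norm a)\<^sup>2 \<le> d\<^sup>2" using d assms(1) by (intro power_mono) auto
    qed
    finally show ?thesis by simp
  qed
  have "((\<lambda>z. (1 - (norm (f z))\<^sup>2) / (1 - norm a)\<^sup>2) \<longlongrightarrow> (1 - 1\<^sup>2) / (1 - norm a)\<^sup>2) (at q within S)"
    using assms(1) by (intro tendsto_intros lim) simp
  then have "((\<lambda>z. (1 - (norm (f z))\<^sup>2) / (1 - norm a)\<^sup>2) \<longlongrightarrow> 0) (at q within S)" by simp
  moreover have "\<forall>\<^sub>F z in at q within S. norm (B z - 1) \<le> (1 - (norm (f z))\<^sup>2) / (1 - norm a)\<^sup>2"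
    using est by (auto simp: eventually_at_filter intro!: always_eventually)
  ultimately have "((\<lambda>z. B z - 1) \<longlongrightarrow> 0) (at q within S)" by (rule Lim_null_comparison[rotated])
  then have "(B \<longlongrightarrow> 1) (at q within S)" by (simp add: LIM_zero_iff)
  then have "((\<lambda>z. sqrt (B z)) \<longlongrightarrow> sqrt 1) (at q within S)" by (rule tendsto_real_sqrt)
  then show ?thesis by (simp add: B_def)
qed

text \<open>The logarithmic derivative at \<open>z\<close> of the Blaschke factor \<open>(f z - f w) / (1 - cnj (f w) * f z)\<close>.\<close>
definition pair_term :: "(complex \<Rightarrow> complex) \<Rightarrow> complex \<Rightarrow> complex \<Rightarrow> complex" where
  "pair_term f z w = deriv f z / (f z - f w) + cnj (f w) * deriv f z / (1 - cnj (f w) * f z)"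

text \<open>The value at \<open>z = w\<close> of the regular function \<open>pair_term f z w - 1 / (z - w)\<close> of \<open>z\<close>.\<close>
definition self_term :: "(complex \<Rightarrow> complex) \<Rightarrow> complex \<Rightarrow> complex" where
  "self_term f z = deriv (deriv f) z / (2 * deriv f z) + cnj (f z) * deriv f z / (1 - cnj (f z) * f z)"

text \<open>A holomorphic logarithm of the Blaschke factor of \<open>a\<close> divided by its zero \<open>w - a\<close>. Its real part is the regular
  part of the Green's function of \<open>S\<close> with pole \<open>a\<close>, up to a constant factor.\<close>
definition log_regular_part :: "(complex \<Rightarrow> complex) \<Rightarrow> complex set \<Rightarrow> complex \<Rightarrow> (complex \<Rightarrow> complex) \<Rightarrow> bool" where
  "log_regular_part f S a \<Lambda> \<longleftrightarrow> \<Lambda> holomorphic_on S \<and>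
     (\<forall>w\<in>S. exp (\<Lambda> w) * (w - a) = (f w - f a) / (1 - cnj (f a) * f w))"

text \<open>The quotient \<open>q\<close> of \<open>f w - f a\<close> by \<open>w - a\<close> extends holomorphically to \<open>a\<close>, and the logarithm exists because \<open>S\<close> is
  simply connected. The derivative of \<open>q\<close> at \<open>a\<close> comes from differentiating \<open>f w - f a = q w * (w - a)\<close> twice.\<close>
lemma log_regular_part_exists:
  fixes S :: "complex set"
  assumes S: "open S" "simply_connected S" and f: "f holomorphic_on S" "inj_on f S" "\<And>z. z \<in> S \<Longrightarrow> norm (f z) < 1"
    and reg: "\<And>z. z \<in> S \<Longrightarrow> deriv f z \<noteq> 0" and a: "a \<in> S"
  shows "\<exists>\<Lambda>. log_regular_part f S a \<Lambda> \<and>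
      (\<forall>w\<in>S. w \<noteq> a \<longrightarrow> deriv \<Lambda> w = pair_term f w a - 1 / (w - a)) \<and> deriv \<Lambda> a = self_term f a"
proof -
  define q where "q w = (if w = a then deriv f a else (f w - f a) / (w - a))" for w
  have holq: "q holomorphic_on S" unfolding q_def using pole_lemma_open[OF f(1) S(1)] .
  have den: "1 - cnj (f a) * f w \<noteq> 0" if "w \<in> S" for w
    using one_minus_cnj_mult_neq_0 f(3) a that by blast
  have qw: "q w * (w - a) = f w - f a" for w by (simp add: q_def)
  have q0: "q w \<noteq> 0" if "w \<in> S" for w
    using f(2) a that reg[OF a] by (auto simp: q_def inj_on_def)
  have "(\<lambda>w. q w / (1 - cnj (f a) * f w)) holomorphic_on S"
    by (intro holomorphic_intros holq f(1)) (use den in auto)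
  moreover have "\<forall>w\<in>S. q w / (1 - cnj (f a) * f w) \<noteq> 0" using q0 den by auto
  moreover have "\<forall>g. g holomorphic_on S \<and> (\<forall>z\<in>S. g z \<noteq> 0) \<longrightarrow> (\<exists>h. h holomorphic_on S \<and> (\<forall>z\<in>S. g z = exp (h z)))"
    using simply_connected_eq_holomorphic_log[OF S(1)] S(2) by simp
  ultimately have "\<exists>h. h holomorphic_on S \<and> (\<forall>z\<in>S. q z / (1 - cnj (f a) * f z) = exp (h z))" by blast
  then obtain \<Lambda> where \<Lambda>: "\<Lambda> holomorphic_on S" "\<And>w. w \<in> S \<Longrightarrow> q w / (1 - cnj (f a) * f w) = exp (\<Lambda> w)"
    by blast
  have df: "(f has_field_derivative deriv f w) (at w)" and dq: "(q has_field_derivative deriv q w) (at w)"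
    and d\<Lambda>: "(\<Lambda> has_field_derivative deriv \<Lambda> w) (at w)" if "w \<in> S" for w
    using holomorphic_derivI[OF f(1) S(1) that] holomorphic_derivI[OF holq S(1) that] holomorphic_derivI[OF \<Lambda>(1) S(1) that] by auto
  have prod: "deriv q w * (w - a) + q w = deriv f w" if w: "w \<in> S" for w
  proof -
    have "((\<lambda>w. q w * (w - a)) has_field_derivative deriv q w * (w - a) + q w) (at w)"
      by (rule derivative_eq_intros dq[OF w] refl)+ simp
    moreover have "((\<lambda>w. q w * (w - a)) has_field_derivative deriv f w) (at w)"
      unfolding qw by (rule derivative_eq_intros df[OF w] refl)+ simp
    ultimately show ?thesis by (rule DERIV_unique)
  qed
  have logd: "deriv \<Lambda> w = deriv q w / q w + cnj (f a) * deriv f w / (1 - cnj (f a) * f w)" if w: "w \<in> S" for w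
  proof -
    let ?c = "1 - cnj (f a) * f w"
    have "((\<lambda>w. exp (\<Lambda> w) * (1 - cnj (f a) * f w)) has_field_derivative
        exp (\<Lambda> w) * deriv \<Lambda> w * ?c - exp (\<Lambda> w) * (cnj (f a) * deriv f w)) (at w)"
      by (rule derivative_eq_intros df[OF w] d\<Lambda>[OF w] refl)+ (simp add: algebra_simps)
    moreover have "((\<lambda>w. exp (\<Lambda> w) * (1 - cnj (f a) * f w)) has_field_derivative deriv q w) (at w)"
    proof (rule has_field_derivative_transform_within_open[OF dq[OF w] S(1) w])
      fix z assume "z \<in> S"
      then show "q z = exp (\<Lambda> z) * (1 - cnj (f a) * f z)" using \<Lambda>(2)[of z] den[of z] by (simp add: field_simps)
    qed
    ultimately have "exp (\<Lambda> w) * deriv \<Lambda> w * ?c - exp (\<Lambda> w) * (cnj (f a) * deriv f w) = deriv q w"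
      by (rule DERIV_unique)
    moreover have "q w = exp (\<Lambda> w) * ?c" using \<Lambda>(2)[OF w] den[OF w] by (simp add: field_simps)
    ultimately have "deriv q w / q w =
        (exp (\<Lambda> w) * deriv \<Lambda> w * ?c - exp (\<Lambda> w) * (cnj (f a) * deriv f w)) / (exp (\<Lambda> w) * ?c)" by simp
    also have "\<dots> = deriv \<Lambda> w - cnj (f a) * deriv f w / ?c"
      using den[OF w] by (simp add: diff_divide_distrib)
    finally show ?thesis by simp
  qed
  show ?thesis
    unfolding log_regular_part_def
  proof (intro exI[of _ \<Lambda>] conjI ballI impI \<Lambda>(1))
    fix w assume w: "w \<in> S"
    show "exp (\<Lambda> w) * (w - a) = (f w - f a) / (1 - cnj (f a) * f w)"
      unfolding \<Lambda>(2)[OF w, symmetric] qw[of w, symmetric] by simp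
    show "deriv \<Lambda> w = pair_term f w a - 1 / (w - a)" if "w \<noteq> a"
    proof -
      have "deriv q w = (deriv f w - q w) / (w - a)" using prod[OF w] that by (simp add: field_simps)
      then have "deriv q w / q w = (deriv f w - q w) / (q w * (w - a))" by (simp add: mult.commute)
      also have "\<dots> = deriv f w / (q w * (w - a)) - 1 / (w - a)"
        using q0[OF w] by (simp add: diff_divide_distrib)
      finally have "deriv q w / q w = deriv f w / (q w * (w - a)) - 1 / (w - a)" .
      then show ?thesis unfolding logd[OF w] qw pair_term_def by simp
    qed
  next
    have holq': "deriv q holomorphic_on S" by (rule holomorphic_deriv[OF holq S(1)])
    have "((\<lambda>w. deriv q w * (w - a) + q w) has_field_derivative deriv (deriv q) a * (a - a) + deriv q a + deriv q a) (at a)"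
      by (rule derivative_eq_intros dq[OF a] holomorphic_derivI[OF holq' S(1) a] refl)+ simp
    moreover have "((\<lambda>w. deriv q w * (w - a) + q w) has_field_derivative deriv (deriv f) a) (at a)"
      by (rule has_field_derivative_transform_within_open[OF holomorphic_derivI[OF holomorphic_deriv[OF f(1) S(1)] S(1) a] S(1) a])
        (use prod in auto)
    ultimately have "deriv (deriv q) a * (a - a) + deriv q a + deriv q a = deriv (deriv f) a" by (rule DERIV_unique)
    then have dq_a: "deriv q a = deriv (deriv f) a / 2" by (simp add: eq_divide_eq mult.commute)
    show "deriv \<Lambda> a = self_term f a"
      unfolding logd[OF a] dq_a self_term_def by (simp add: q_def)
  qed
qed

section \<open>The force in terms of a Riemann map\<close>

lemma stretch_image_vimage: "lam \<noteq> 0 \<Longrightarrow> stretch lam ` \<Omega> = unstretch lam -` \<Omega>"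
  using unstretch_stretch stretch_unstretch by (auto simp: image_iff) (metis)

lemma frontier_stretch_image:
  assumes "lam \<noteq> 0" "open \<Omega>"
  shows "open (stretch lam ` \<Omega>)" and "frontier (stretch lam ` \<Omega>) = stretch lam ` frontier \<Omega>"
proof -
  have c: "continuous_on UNIV (unstretch lam)"
    by (rule linear_continuous_on[OF bounded_linear_unstretch])
  show op: "open (stretch lam ` \<Omega>)"
    unfolding stretch_image_vimage[OF assms(1)] using c assms(2) by (simp add: open_vimage)
  have cl: "closure (stretch lam ` \<Omega>) = stretch lam ` closure \<Omega>"
  proof
    show "stretch lam ` closure \<Omega> \<subseteq> closure (stretch lam ` \<Omega>)"
      by (rule closure_bounded_linear_image_subset[OF bounded_linear_stretch])
    have "unstretch lam ` closure (stretch lam ` \<Omega>) \<subseteq> closure (unstretch lam ` (stretch lam ` \<Omega>))"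
      by (rule closure_bounded_linear_image_subset[OF bounded_linear_unstretch])
    also have "unstretch lam ` (stretch lam ` \<Omega>) = \<Omega>"
      by (simp add: image_image unstretch_stretch[OF assms(1)])
    finally have "stretch lam ` (unstretch lam ` closure (stretch lam ` \<Omega>)) \<subseteq> stretch lam ` closure \<Omega>"
      by (rule image_mono)
    then show "closure (stretch lam ` \<Omega>) \<subseteq> stretch lam ` closure \<Omega>"
      by (simp add: image_image stretch_unstretch[OF assms(1)])
  qed
  have "inj (stretch lam)" using stretch_eq_iff[OF assms(1)] by (auto simp: inj_def)
  then have "stretch lam ` closure \<Omega> - stretch lam ` \<Omega> = stretch lam ` (closure \<Omega> - \<Omega>)"
    by (rule image_set_diff[symmetric])
  then show "frontier (stretch lam ` \<Omega>) = stretch lam ` frontier \<Omega>"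
    using op assms(2) by (simp add: frontier_def interior_open cl)
qed

lemma simply_connected_stretch_image:
  assumes "lam \<noteq> 0" "simply_connected \<Omega>"
  shows "simply_connected (stretch lam ` \<Omega>)"
proof -
  have "\<Omega> homeomorphic stretch lam ` \<Omega>"
    unfolding homeomorphic_def homeomorphism_def
    using unstretch_stretch[OF assms(1)]
    by (intro exI[of _ "stretch lam"] exI[of _ "unstretch lam"])
      (auto intro: linear_continuous_on bounded_linear_stretch bounded_linear_unstretch simp: image_image)
  then show ?thesis using assms(2) homeomorphic_simply_connected_eq by blast
qed

lemma has_derivative_ln_norm:
  fixes z :: complex
  assumes "z \<noteq> 0"
  shows "((\<lambda>z. ln (norm z)) has_derivative (\<lambda>h. Re (h / z))) (at z)"
proof -
  have "((\<lambda>z. ln (norm z)) has_derivative (\<lambda>h. (h \<bullet> sgn z) * inverse (norm z))) (at z)"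
    using has_derivative_compose[OF has_derivative_norm[OF assms], of ln "\<lambda>h. h * inverse (norm z)"] DERIV_ln[of "norm z"] assms
    by (simp add: has_field_derivative_def mult_commute_abs)
  moreover have "(h \<bullet> sgn z) * inverse (norm z) = Re (h / z)" for h
    using assms by (simp add: Re_divide inner_complex_def sgn_div_norm cmod_def[symmetric] field_simps
        power2_eq_square[symmetric] cmod_power2)
  ultimately show ?thesis by simp
qed

text \<open>Let \<open>F\<close> be a primitive of the holomorphic function \<open>P\<close> that belongs to the gradient. The function \<open>\<psi>\<close> is the
  conjugate potential of the total field, that is, the imaginary part of \<open>F\<close> minus the logarithms of the
  distances to the dislocations; its gradient \<open>V\<close> is the total flux, rotated by a right angle and scaled, so the
  Neumann condition makes \<open>V\<close> normal to the boundary and \<open>\<psi>\<close> constant on it. Adding the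
  logarithms of the moduli of the Blaschke factors removes the singularities without changing the boundary
  values. The sum is the imaginary part of the holomorphic function \<open>W\<close>, so \<open>W\<close> is constant.\<close>
lemma neumann_gradient_formula:
  fixes b :: "'n::finite \<Rightarrow> real"
  assumes \<Omega>: "open \<Omega>" "bounded \<Omega>" "simply_connected \<Omega>" and C2: "C2_holder_boundary \<gamma> \<Omega>"
    and "0 < \<mu>" "lam \<noteq> 0" and Y: "Y \<in> configs \<Omega>" and u: "neumann_solution \<Omega> \<mu> lam b Y u"
    and f: "\<And>z. z \<in> stretch lam ` \<Omega> \<Longrightarrow> norm (f z) < 1"
      "\<And>q. q \<in> frontier (stretch lam ` \<Omega>) \<Longrightarrow> ((\<lambda>z. norm (f z)) \<longlongrightarrow> 1) (at q within stretch lam ` \<Omega>)"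
    and reg: "\<And>i. log_regular_part f (stretch lam ` \<Omega>) (stretch lam (Y $ i)) (\<Lambda> i)"
    and x: "x \<in> \<Omega>"
  shows "grad u x = field_of_complex lam (- \<i> * (\<Sum>i\<in>UNIV. of_real (b i / (2 * pi)) * deriv (\<Lambda> i) (stretch lam x)))"
proof -
  define S where "S = stretch lam ` \<Omega>"
  define \<zeta> where "\<zeta> i = stretch lam (Y $ i)" for i
  define t where "t i = b i / (2 * pi)" for i
  have "open S" and frS: "frontier S = stretch lam ` frontier \<Omega>"
    using frontier_stretch_image[OF \<open>lam \<noteq> 0\<close> \<Omega>(1)] by (simp_all add: S_def)
  have scS: "simply_connected S" unfolding S_def by (rule simply_connected_stretch_image[OF \<open>lam \<noteq> 0\<close> \<Omega>(3)])
  have bS: "bounded S" unfolding S_def by (rule bounded_linear_image[OF \<Omega>(2) bounded_linear_stretch])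
  have "connected (frontier S)"
    using simply_connected_eq_frontier_properties[OF \<open>open S\<close>] scS bS by simp
  then have "connected (unstretch lam ` frontier S)"
    by (intro connected_continuous_image linear_continuous_on[OF bounded_linear_unstretch])
  then have con: "connected (frontier \<Omega>)" by (simp add: frS image_image unstretch_stretch[OF \<open>lam \<noteq> 0\<close>])
  have \<zeta>S: "\<zeta> i \<in> S" for i using Y by (auto simp: \<zeta>_def S_def configs_def)
  have hol: "\<Lambda> i holomorphic_on S" for i
    using reg[of i] by (simp add: log_regular_part_def S_def)
  have \<Lambda>: "exp (\<Lambda> i w) * (w - \<zeta> i) = (f w - f (\<zeta> i)) / (1 - cnj (f (\<zeta> i)) * f w)" if "w \<in> S" for i w
    using reg[of i] that unfolding log_regular_part_def S_def \<zeta>_def by blast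
  obtain G where grad': "\<forall>x\<in>\<Omega>. GDERIV u x :> G x" and contG: "continuous_on (closure \<Omega>) G"
    and diffG': "\<forall>x\<in>\<Omega>. G differentiable (at x)"
    and div': "\<forall>x\<in>\<Omega>. divergence (\<lambda>y. matL \<mu> lam *v G y) x = 0"
    and bc: "\<forall>x\<in>frontier \<Omega>. \<forall>n. outer_unit_normal \<Omega> x n \<longrightarrow>
             (matL \<mu> lam *v (G x + (\<Sum>i\<in>UNIV. kfield lam (b i) x (Y $ i)))) \<bullet> n = 0"
    using u unfolding neumann_solution_def by (elim exE conjE) (rule that; assumption)
  have grad: "GDERIV u x :> G x" and diffG: "G differentiable (at x)"
    and div: "divergence (\<lambda>y. matL \<mu> lam *v G y) x = 0" if "x \<in> \<Omega>" for x
    using that grad' diffG' div' by blast+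
  have "\<mu> \<noteq> 0" using \<open>0 < \<mu>\<close> by simp
  define P where "P w = Complex (G (unstretch lam w) $ 1 / lam) (- (G (unstretch lam w) $ 2))" for w
  note cg = complex_gradient_holomorphic[OF \<Omega>(1) \<open>lam \<noteq> 0\<close> \<open>\<mu> \<noteq> 0\<close> grad diffG div, folded P_def S_def]
  have holP: "P holomorphic_on S" and GP: "\<And>x. G x = field_of_complex lam (P (stretch lam x))"
    using cg by auto
  have "\<forall>g. g holomorphic_on S \<longrightarrow> (\<exists>h. \<forall>z. z \<in> S \<longrightarrow> (h has_field_derivative g z) (at z))"
    using simply_connected_eq_global_primitive[OF \<open>open S\<close>] scS by simp
  then obtain F where F: "\<And>z. z \<in> S \<Longrightarrow> (F has_field_derivative P z) (at z)" using holP by blast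
  define \<psi> where "\<psi> x = Im (F (stretch lam x)) - (\<Sum>i\<in>UNIV. t i * ln (norm (stretch lam x - \<zeta> i)))" for x
  define Q where "Q x = P (stretch lam x) + (\<Sum>i\<in>UNIV. - \<i> * of_real (t i) / (stretch lam x - \<zeta> i))" for x
  define g where "g x = G x + (\<Sum>i\<in>UNIV. kfield lam (b i) x (Y $ i))" for x
  \<comment> \<open>The conjugate of the field \<open>g\<close>; in complex form it is the covector \<open>Im (Q x * stretch lam h)\<close>.\<close>
  define V :: "real^2 \<Rightarrow> real^2" where "V x = vector [- lam * g x $ 2, g x $ 1 / lam]" for x
  define sing where "sing = range (\<lambda>i. Y $ i)"
  have away: "x \<noteq> Y $ i" "stretch lam x - \<zeta> i \<noteq> 0" if "x \<notin> sing" for x i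
    using that stretch_eq_iff[OF \<open>lam \<noteq> 0\<close>, of x "Y $ i"] by (auto simp: sing_def \<zeta>_def)
  have gQ: "g x = field_of_complex lam (Q x)" if "x \<notin> sing" for x
  proof -
    have "kfield lam (b i) x (Y $ i) = field_of_complex lam (- \<i> * of_real (t i) / (stretch lam x - \<zeta> i))" for i
      unfolding t_def \<zeta>_def by (rule kfield_complex[OF \<open>lam \<noteq> 0\<close> away(1)[OF that]])
    then show ?thesis
      unfolding g_def Q_def GP[of x]
      by (simp add: linear_add[OF bounded_linear.linear[OF bounded_linear_field_of_complex]]
          linear_sum[OF bounded_linear.linear[OF bounded_linear_field_of_complex]])
  qed
  have VQ: "h \<bullet> V x = Im (Q x * stretch lam h)" if "x \<notin> sing" for x h
    unfolding V_def gQ[OF that] using \<open>lam \<noteq> 0\<close>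
    by (simp add: field_of_complex_def stretch_def inner_vec_def sum_2 algebra_simps)
  have gradV: "GDERIV \<psi> x :> V x" if "x \<in> \<Omega> - sing" for x
  proof -
    have st: "(stretch lam has_derivative stretch lam) (at x)"
      by (rule bounded_linear.has_derivative[OF bounded_linear_stretch has_derivative_ident])
    have "(F has_derivative (\<lambda>h. P (stretch lam x) * h)) (at (stretch lam x))"
      using F[of "stretch lam x"] that by (simp add: has_field_derivative_def S_def)
    then have 1: "((\<lambda>x. Im (F (stretch lam x))) has_derivative (\<lambda>h. Im (P (stretch lam x) * stretch lam h))) (at x)"
      by (intro has_derivative_Im has_derivative_compose[OF st])
    have 2: "((\<lambda>x. ln (norm (stretch lam x - \<zeta> i))) has_derivative (\<lambda>h. Re (stretch lam h / (stretch lam x - \<zeta> i)))) (at x)" for i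
    proof -
      have "((\<lambda>x. stretch lam x - \<zeta> i) has_derivative stretch lam) (at x)"
        using has_derivative_diff[OF st has_derivative_const[of "\<zeta> i"]] by simp
      then show ?thesis using that by (intro has_derivative_compose[OF _ has_derivative_ln_norm]) (use away in auto)
    qed
    have "(\<psi> has_derivative (\<lambda>h. Im (P (stretch lam x) * stretch lam h) -
        (\<Sum>i\<in>UNIV. t i * Re (stretch lam h / (stretch lam x - \<zeta> i))))) (at x)"
      unfolding \<psi>_def by (intro has_derivative_diff 1 has_derivative_sum has_derivative_mult_right 2)
    moreover have "Im (P (stretch lam x) * stretch lam h) - (\<Sum>i\<in>UNIV. t i * Re (stretch lam h / (stretch lam x - \<zeta> i))) = h \<bullet> V x" for h
    proof -
      have im: "Im (- \<i> * of_real (t i) / (stretch lam x - \<zeta> i) * stretch lam h) = - (t i * Re (stretch lam h / (stretch lam x - \<zeta> i)))" for i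
      proof -
        have "- \<i> * of_real (t i) / (stretch lam x - \<zeta> i) * stretch lam h = - \<i> * (of_real (t i) * (stretch lam h / (stretch lam x - \<zeta> i)))"
          by simp
        then show ?thesis by (simp only: minus_mult_left[symmetric] Im_i_times uminus_complex.sel Re_complex_of_real times_complex.sel Im_complex_of_real) simp
      qed
      have "x \<notin> sing" using that by simp
      show ?thesis
        unfolding VQ[OF \<open>x \<notin> sing\<close>] Q_def distrib_right sum_distrib_right plus_complex.sel Im_sum im
        by (simp add: sum_negf)
    qed
    ultimately show ?thesis by (simp add: gderiv_def)
  qed
  have contV: "continuous_on (closure \<Omega> - sing) V"
  proof -
    have "continuous_on (closure \<Omega> - sing) (\<lambda>x. kfield lam (b i) x (Y $ i))" for i
    proof (rule continuous_on_eq)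
      show "continuous_on (closure \<Omega> - sing) (\<lambda>x. field_of_complex lam (- \<i> * of_real (t i) / (stretch lam x - \<zeta> i)))"
        by (intro bounded_linear.continuous_on[OF bounded_linear_field_of_complex] continuous_intros
            bounded_linear.continuous_on[OF bounded_linear_stretch]) (use away in auto)
      show "field_of_complex lam (- \<i> * of_real (t i) / (stretch lam x - \<zeta> i)) = kfield lam (b i) x (Y $ i)"
        if "x \<in> closure \<Omega> - sing" for x
        unfolding t_def \<zeta>_def using kfield_complex[OF \<open>lam \<noteq> 0\<close> away(1)] that by simp
    qed
    then have "continuous_on (closure \<Omega> - sing) g"
      unfolding g_def by (intro continuous_intros continuous_on_subset[OF contG]) auto
    moreover have "bounded_linear (\<lambda>y::real^2. vector [- lam * y $ 2, y $ 1 / lam] :: real^2)"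
      by (rule linear_conv_bounded_linear[THEN iffD1], rule linearI)
        (simp_all add: vec_eq_iff forall_2 algebra_simps add_divide_distrib)
    ultimately show ?thesis unfolding V_def by (rule bounded_linear.continuous_on[rotated])
  qed
  have tang: "V q \<bullet> w = 0" if q: "q \<in> frontier \<Omega>" and n: "outer_unit_normal \<Omega> q n" and w: "w \<bullet> n = 0" for q n w
  proof -
    define A B where "A = g q $ 1" and "B = lam\<^sup>2 * g q $ 2"
    have "(matL \<mu> lam *v g q) \<bullet> n = 0" using bc q n by (simp add: g_def)
    then have "\<mu> * (A * n $ 1 + B * n $ 2) = 0"
      by (simp add: matL_mult inner_vec_def sum_2 A_def B_def algebra_simps)
    then have AB: "A * n $ 1 + B * n $ 2 = 0" using \<open>\<mu> \<noteq> 0\<close> by simp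
    have wn: "w $ 1 * n $ 1 + w $ 2 * n $ 2 = 0" using w by (simp add: inner_vec_def sum_2)
    have "(A * w $ 2 - B * w $ 1) * n $ 1 = w $ 2 * (A * n $ 1 + B * n $ 2) - B * (w $ 1 * n $ 1 + w $ 2 * n $ 2)"
      "(A * w $ 2 - B * w $ 1) * n $ 2 = A * (w $ 1 * n $ 1 + w $ 2 * n $ 2) - w $ 1 * (A * n $ 1 + B * n $ 2)"
      by (simp_all add: algebra_simps)
    then have "(A * w $ 2 - B * w $ 1) * n $ 1 = 0" "(A * w $ 2 - B * w $ 1) * n $ 2 = 0" by (simp_all add: AB wn)
    moreover have "norm n = 1" using n by (simp add: outer_unit_normal_def unit_normal_def)
    then have "n \<noteq> 0" by auto
    then have "n $ 1 \<noteq> 0 \<or> n $ 2 \<noteq> 0" by (simp add: vec_eq_iff forall_2)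
    ultimately have "A * w $ 2 - B * w $ 1 = 0" by auto
    then have "lam * (V q \<bullet> w) = 0"
      using \<open>lam \<noteq> 0\<close> by (simp add: V_def inner_vec_def sum_2 A_def B_def algebra_simps power2_eq_square)
    then show ?thesis using \<open>lam \<noteq> 0\<close> by simp
  qed
  have "finite sing" "sing \<subseteq> \<Omega>" using Y by (auto simp: sing_def configs_def)
  then have "\<exists>c. \<forall>q\<in>frontier \<Omega>. (\<psi> \<longlongrightarrow> c) (at q within \<Omega>)"
    by (rule constant_boundary_values[OF \<Omega>(1,2) con C2 _ _ gradV contV tang])
  then obtain c where c: "\<And>q. q \<in> frontier \<Omega> \<Longrightarrow> (\<psi> \<longlongrightarrow> c) (at q within \<Omega>)" by blast
  define W where "W w = F w + \<i> * (\<Sum>i\<in>UNIV. of_real (t i) * \<Lambda> i w)" for w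
  have holF: "F holomorphic_on S" using F \<open>open S\<close> by (auto simp: holomorphic_on_open)
  have holW: "W holomorphic_on S"
    unfolding W_def by (intro holomorphic_intros holF hol)
  define Bl where "Bl i w = (f w - f (\<zeta> i)) / (1 - cnj (f (\<zeta> i)) * f w)" for i w
  have ImW: "Im (W w) = \<psi> (unstretch lam w) + (\<Sum>i\<in>UNIV. t i * ln (norm (Bl i w)))"
    if w: "w \<in> S" "\<And>i. w \<noteq> \<zeta> i" for w
  proof -
    have "Re (\<Lambda> i w) = ln (norm (Bl i w)) - ln (norm (w - \<zeta> i))" for i
    proof -
      have "norm (Bl i w) = exp (Re (\<Lambda> i w)) * norm (w - \<zeta> i)"
        using \<Lambda>[of w i] w(1) unfolding Bl_def by (metis norm_exp_eq_Re norm_mult)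
      moreover have "0 < norm (w - \<zeta> i)" using w(2) by simp
      ultimately show ?thesis by (simp add: ln_mult)
    qed
    then show ?thesis
      by (simp add: W_def \<psi>_def stretch_unstretch[OF \<open>lam \<noteq> 0\<close>] Im_sum Re_sum right_diff_distrib sum_subtractf)
  qed
  have bdryW: "((\<lambda>w. Im (W w)) \<longlongrightarrow> c) (at q within S)" if q: "q \<in> frontier S" for q
  proof -
    have "q \<notin> S" using q \<open>open S\<close> by (simp add: frontier_def interior_open)
    have uq: "unstretch lam q \<in> frontier \<Omega>" using q unfolding frS by (auto simp: unstretch_stretch[OF \<open>lam \<noteq> 0\<close>])
    have "filterlim (unstretch lam) (at (unstretch lam q) within \<Omega>) (at q within S)"
      unfolding filterlim_at
    proof
      have "isCont (unstretch lam) q" by (rule linear_continuous_at[OF bounded_linear_unstretch])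
      then show "(unstretch lam \<longlongrightarrow> unstretch lam q) (at q within S)"
        using continuous_at_imp_continuous_at_within continuous_within by blast
      have "unstretch lam w \<in> \<Omega> \<and> unstretch lam w \<noteq> unstretch lam q" if "w \<in> S" for w
        using that \<open>q \<notin> S\<close> stretch_unstretch[OF \<open>lam \<noteq> 0\<close>] by (auto simp: S_def unstretch_stretch[OF \<open>lam \<noteq> 0\<close>]) (metis imageI)
      then show "\<forall>\<^sub>F w in at q within S. unstretch lam w \<in> \<Omega> \<and> unstretch lam w \<noteq> unstretch lam q"
        by (auto simp: eventually_at_filter)
    qed
    then have l1: "((\<lambda>w. \<psi> (unstretch lam w)) \<longlongrightarrow> c) (at q within S)"
      by (rule filterlim_compose[OF c[OF uq]])
    have "((\<lambda>w. norm (Bl i w)) \<longlongrightarrow> 1) (at q within S)" for i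
      unfolding Bl_def by (rule blaschke_boundary_modulus) (use f \<zeta>S q in \<open>auto simp: S_def\<close>)
    then have "((\<lambda>w. \<Sum>i\<in>UNIV. t i * ln (norm (Bl i w))) \<longlongrightarrow> (\<Sum>i\<in>UNIV. t i * ln 1)) (at q within S)"
      by (intro tendsto_intros) auto
    with l1 have "((\<lambda>w. \<psi> (unstretch lam w) + (\<Sum>i\<in>UNIV. t i * ln (norm (Bl i w)))) \<longlongrightarrow> c + (\<Sum>i\<in>UNIV. t i * ln 1)) (at q within S)"
      by (rule tendsto_add)
    then have lim: "((\<lambda>w. \<psi> (unstretch lam w) + (\<Sum>i\<in>UNIV. t i * ln (norm (Bl i w)))) \<longlongrightarrow> c) (at q within S)" by simp
    have "\<forall>\<^sub>F w in at q within S. \<forall>i. w \<noteq> \<zeta> i"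
      by (rule eventually_all_finite) (rule eventually_neq_at_within)
    moreover have "\<forall>\<^sub>F w in at q within S. w \<in> S" by (auto simp: eventually_at_filter)
    ultimately have "\<forall>\<^sub>F w in at q within S. \<psi> (unstretch lam w) + (\<Sum>i\<in>UNIV. t i * ln (norm (Bl i w))) = Im (W w)"
      by eventually_elim (simp add: ImW)
    with lim show ?thesis by (rule Lim_transform_eventually)
  qed
  define w where "w = stretch lam x"
  have wS: "w \<in> S" using x by (simp add: w_def S_def)
  have "deriv W w = 0"
    by (rule deriv_eq_0_of_constant_boundary_imaginary_part[OF holW \<open>open S\<close> simply_connected_imp_connected[OF scS] bS bdryW wS])
  moreover have "(W has_field_derivative P w + \<i> * (\<Sum>i\<in>UNIV. of_real (t i) * deriv (\<Lambda> i) w)) (at w)"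
    unfolding W_def using holomorphic_derivI[OF hol \<open>open S\<close> wS]
    by (intro DERIV_add F[OF wS] DERIV_cmult DERIV_sum)
  ultimately have "P w + \<i> * (\<Sum>i\<in>UNIV. of_real (t i) * deriv (\<Lambda> i) w) = 0" using DERIV_imp_deriv by metis
  then have Pw: "P w = - \<i> * (\<Sum>i\<in>UNIV. of_real (t i) * deriv (\<Lambda> i) w)" by (simp add: add_eq_0_iff)
  have "grad u x = G x"
    unfolding grad_def
  proof (rule the_equality)
    show "GDERIV u x :> G x" by (rule grad[OF x])
    fix D assume "GDERIV u x :> D"
    then have "(\<lambda>h. h \<bullet> D) = (\<lambda>h. h \<bullet> G x)"
      using grad[OF x] unfolding gderiv_def by (rule has_derivative_unique)
    then show "D = G x" by (metis vector_eq_ldot)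
  qed
  then show ?thesis using GP[of x] Pw by (simp add: w_def t_def)
qed

lemma open_configs:
  assumes "open \<Omega>"
  shows "open (configs \<Omega> :: ((real^2)^'n::finite) set)"
proof -
  have "configs \<Omega> = (\<Inter>i. {Z :: (real^2)^'n. Z $ i \<in> \<Omega>}) \<inter> (\<Inter>(j, k)\<in>{(j, k). j \<noteq> k}. {Z. Z $ j \<noteq> Z $ k})"
    by (auto simp: configs_def)
  moreover have "open {Z :: (real^2)^'n. Z $ i \<in> \<Omega>}" for i
    using open_vimage_vec_nth[OF assms, of i] by (simp add: vimage_def)
  moreover have "open {Z :: (real^2)^'n. Z $ j \<noteq> Z $ k}" for j k
    by (intro open_Collect_neq continuous_intros)
  ultimately show ?thesis
    by (auto intro!: open_Int open_INT)
qed

text \<open>The Peach-Koehler force before the linear maps that turn a complex gradient into a force.\<close>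
definition complex_force :: "real \<Rightarrow> ('n \<Rightarrow> real) \<Rightarrow> (complex \<Rightarrow> complex) \<Rightarrow> 'n::finite \<Rightarrow> (real^2)^'n \<Rightarrow> complex" where
  "complex_force lam b f l Y =
     - \<i> * ((\<Sum>i\<in>UNIV - {l}. of_real (b i / (2 * pi)) * pair_term f (stretch lam (Y $ l)) (stretch lam (Y $ i)))
        + of_real (b l / (2 * pi)) * self_term f (stretch lam (Y $ l)))"

text \<open>The poles of the direct interactions cancel against those in \<open>pair_term f z w - 1 / (z - w)\<close>.\<close>
lemma peach_koehler_force_formula:
  fixes b :: "'n::finite \<Rightarrow> real"
  assumes \<Omega>: "open \<Omega>" "bounded \<Omega>" "simply_connected \<Omega>" and C2: "C2_holder_boundary \<gamma> \<Omega>"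
    and "0 < \<mu>" "lam \<noteq> 0" and Y: "Y \<in> configs \<Omega>" and u: "neumann_solution \<Omega> \<mu> lam b Y (u0 Y)"
    and f: "f holomorphic_on stretch lam ` \<Omega>" "inj_on f (stretch lam ` \<Omega>)"
      "\<And>z. z \<in> stretch lam ` \<Omega> \<Longrightarrow> norm (f z) < 1"
      "\<And>z. z \<in> stretch lam ` \<Omega> \<Longrightarrow> deriv f z \<noteq> 0"
      "\<And>q. q \<in> frontier (stretch lam ` \<Omega>) \<Longrightarrow> ((\<lambda>z. norm (f z)) \<longlongrightarrow> 1) (at q within stretch lam ` \<Omega>)"
  shows "peach_koehler_force \<mu> lam b u0 l Y =
           b l *\<^sub>R (matJ *v (matL \<mu> lam *v field_of_complex lam (complex_force lam b f l Y)))"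
proof -
  define S where "S = stretch lam ` \<Omega>"
  define \<zeta> where "\<zeta> i = stretch lam (Y $ i)" for i
  define t where "t i = b i / (2 * pi)" for i
  have "open S" unfolding S_def by (rule frontier_stretch_image(1)[OF \<open>lam \<noteq> 0\<close> \<Omega>(1)])
  have scS: "simply_connected S" unfolding S_def by (rule simply_connected_stretch_image[OF \<open>lam \<noteq> 0\<close> \<Omega>(3)])
  have Y\<Omega>: "Y $ i \<in> \<Omega>" for i using Y by (simp add: configs_def)
  then have \<zeta>S: "\<zeta> i \<in> S" for i by (simp add: \<zeta>_def S_def)
  have ne: "Y $ l \<noteq> Y $ i" "\<zeta> l \<noteq> \<zeta> i" if "i \<noteq> l" for i
    using Y that stretch_eq_iff[OF \<open>lam \<noteq> 0\<close>] by (auto simp: configs_def \<zeta>_def)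
  have "\<exists>\<Lambda>. log_regular_part f S (\<zeta> i) \<Lambda> \<and>
      (\<forall>w\<in>S. w \<noteq> \<zeta> i \<longrightarrow> deriv \<Lambda> w = pair_term f w (\<zeta> i) - 1 / (w - \<zeta> i)) \<and>
      deriv \<Lambda> (\<zeta> i) = self_term f (\<zeta> i)" for i
    by (rule log_regular_part_exists[OF \<open>open S\<close> scS _ _ _ _ \<zeta>S]) (use f in \<open>auto simp: S_def\<close>)
  then have "\<exists>\<Lambda>. \<forall>i. log_regular_part f S (\<zeta> i) (\<Lambda> i) \<and>
      (\<forall>w\<in>S. w \<noteq> \<zeta> i \<longrightarrow> deriv (\<Lambda> i) w = pair_term f w (\<zeta> i) - 1 / (w - \<zeta> i)) \<and>
      deriv (\<Lambda> i) (\<zeta> i) = self_term f (\<zeta> i)"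
    by (intro choice allI)
  then obtain \<Lambda> where "\<forall>i. log_regular_part f S (\<zeta> i) (\<Lambda> i) \<and>
      (\<forall>w\<in>S. w \<noteq> \<zeta> i \<longrightarrow> deriv (\<Lambda> i) w = pair_term f w (\<zeta> i) - 1 / (w - \<zeta> i)) \<and>
      deriv (\<Lambda> i) (\<zeta> i) = self_term f (\<zeta> i)" ..
  then have \<Lambda>: "\<And>i. log_regular_part f S (\<zeta> i) (\<Lambda> i)"
    and d\<Lambda>: "\<And>i w. w \<in> S \<Longrightarrow> w \<noteq> \<zeta> i \<Longrightarrow> deriv (\<Lambda> i) w = pair_term f w (\<zeta> i) - 1 / (w - \<zeta> i)"
    and d\<Lambda>0: "\<And>i. deriv (\<Lambda> i) (\<zeta> i) = self_term f (\<zeta> i)"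
    by blast+
  have "grad (u0 Y) (Y $ l) = field_of_complex lam (- \<i> * (\<Sum>i\<in>UNIV. of_real (t i) * deriv (\<Lambda> i) (\<zeta> l)))"
    unfolding t_def \<zeta>_def
    by (rule neumann_gradient_formula[OF \<Omega> C2 \<open>0 < \<mu>\<close> \<open>lam \<noteq> 0\<close> Y u f(3,5)])
      (use \<Lambda> Y\<Omega> in \<open>auto simp: S_def \<zeta>_def\<close>)
  also have "(\<Sum>i\<in>UNIV. of_real (t i) * deriv (\<Lambda> i) (\<zeta> l)) =
      of_real (t l) * self_term f (\<zeta> l) + (\<Sum>i\<in>UNIV - {l}. of_real (t i) * (pair_term f (\<zeta> l) (\<zeta> i) - 1 / (\<zeta> l - \<zeta> i)))"
    by (subst sum.remove[of _ l]) (auto simp: d\<Lambda>0 d\<Lambda>[OF \<zeta>S] ne intro!: sum.cong)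
  finally have g: "grad (u0 Y) (Y $ l) = field_of_complex lam (- \<i> * (of_real (t l) * self_term f (\<zeta> l) +
      (\<Sum>i\<in>UNIV - {l}. of_real (t i) * (pair_term f (\<zeta> l) (\<zeta> i) - 1 / (\<zeta> l - \<zeta> i)))))" .
  have k: "(\<Sum>i\<in>UNIV - {l}. kfield lam (b i) (Y $ l) (Y $ i)) =
      field_of_complex lam (\<Sum>i\<in>UNIV - {l}. - \<i> * of_real (t i) / (\<zeta> l - \<zeta> i))"
    unfolding linear_sum[OF bounded_linear.linear[OF bounded_linear_field_of_complex]]
    by (intro sum.cong refl) (simp add: kfield_complex[OF \<open>lam \<noteq> 0\<close> ne(1)] t_def \<zeta>_def)
  have "(\<Sum>i\<in>UNIV - {l}. - \<i> * of_real (t i) / (\<zeta> l - \<zeta> i)) +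
      - \<i> * (of_real (t l) * self_term f (\<zeta> l) + (\<Sum>i\<in>UNIV - {l}. of_real (t i) * (pair_term f (\<zeta> l) (\<zeta> i) - 1 / (\<zeta> l - \<zeta> i))))
      = complex_force lam b f l Y"
    unfolding complex_force_def t_def[symmetric] \<zeta>_def[symmetric]
    by (simp add: right_diff_distrib sum_subtractf sum_negf sum_distrib_left algebra_simps)
  then show ?thesis
    unfolding peach_koehler_force_def g k
    by (simp add: linear_add[OF bounded_linear.linear[OF bounded_linear_field_of_complex], symmetric])
qed

lemma complex_force_strictly_differentiable:
  fixes b :: "'n::finite \<Rightarrow> real"
  assumes "open \<Omega>" "lam \<noteq> 0" and Y: "Y \<in> configs \<Omega>"
    and f: "f holomorphic_on stretch lam ` \<Omega>" "inj_on f (stretch lam ` \<Omega>)"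
      "\<And>z. z \<in> stretch lam ` \<Omega> \<Longrightarrow> norm (f z) < 1"
      "\<And>z. z \<in> stretch lam ` \<Omega> \<Longrightarrow> deriv f z \<noteq> 0"
  shows "strictly_differentiable_at (complex_force lam b f l) Y"
proof -
  define S where "S = stretch lam ` \<Omega>"
  have "open S" unfolding S_def by (rule frontier_stretch_image(1)[OF assms(2,1)])
  have \<zeta>S: "stretch lam (Y $ i) \<in> S" for i using Y by (auto simp: configs_def S_def)
  have hf: "f holomorphic_on S" "deriv f holomorphic_on S" "deriv (deriv f) holomorphic_on S"
    using f(1) \<open>open S\<close> by (auto simp: S_def[symmetric] intro: holomorphic_deriv)
  have comp: "strictly_differentiable_at (\<lambda>Y. g (stretch lam (Y $ i))) Y" if "g holomorphic_on S" for g i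
  proof (rule strictly_differentiable_compose[where f = "\<lambda>Y. stretch lam (Y $ i)" and g = g])
    show "strictly_differentiable_at (\<lambda>Y. stretch lam (Y $ i)) Y"
      by (rule strictly_differentiable_linear, rule bounded_linear_compose[OF bounded_linear_stretch bounded_linear_vec_nth])
    show "strictly_differentiable_at g (stretch lam (Y $ i))"
      by (rule holomorphic_strictly_differentiable[OF that \<open>open S\<close> \<zeta>S])
  qed
  note sd = comp[OF hf(1)] comp[OF hf(2)] comp[OF hf(3)]
  have cnj: "strictly_differentiable_at (\<lambda>Y. cnj (f (stretch lam (Y $ i)))) Y" for i
    by (rule strictly_differentiable_linear_compose[OF bounded_linear_cnj sd(1)])
  have den: "1 - cnj (f (stretch lam (Y $ i))) * f (stretch lam (Y $ k)) \<noteq> 0" for i k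
    using one_minus_cnj_mult_neq_0 f(3) \<zeta>S by (auto simp: S_def)
  have inj: "f (stretch lam (Y $ l)) - f (stretch lam (Y $ i)) \<noteq> 0" if "i \<noteq> l" for i
    using f(2) \<zeta>S[of i] \<zeta>S[of l] Y that stretch_eq_iff[OF \<open>lam \<noteq> 0\<close>, of "Y $ l" "Y $ i"]
    by (auto simp: S_def configs_def dest: inj_onD)
  have reg: "2 * deriv f (stretch lam (Y $ l)) \<noteq> 0" using f(4) \<zeta>S by (auto simp: S_def)
  have "strictly_differentiable_at (\<lambda>Y. pair_term f (stretch lam (Y $ l)) (stretch lam (Y $ i))) Y" if "i \<noteq> l" for i
    unfolding pair_term_def
    by (intro strictly_differentiable_add strictly_differentiable_divide strictly_differentiable_diff
        strictly_differentiable_mult strictly_differentiable_const sd cnj den inj that)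
  moreover have "strictly_differentiable_at (\<lambda>Y. self_term f (stretch lam (Y $ l))) Y"
    unfolding self_term_def
    by (intro strictly_differentiable_add strictly_differentiable_divide strictly_differentiable_diff
        strictly_differentiable_mult strictly_differentiable_const sd cnj den reg)
  ultimately show ?thesis
    unfolding complex_force_def
    by (intro strictly_differentiable_mult strictly_differentiable_add strictly_differentiable_sum
        strictly_differentiable_const) auto
qed

text \<open>The formula holds on the whole open set of configurations, with one and the same Riemann map.\<close>
lemma peach_koehler_force_strictly_differentiable:
  fixes b :: "'n::finite \<Rightarrow> real"
  assumes \<Omega>: "open \<Omega>" "bounded \<Omega>" "simply_connected \<Omega>" and C2: "C2_holder_boundary \<gamma> \<Omega>"
    and "0 < \<mu>" "lam \<noteq> 0"
    and u0: "\<And>Y. Y \<in> configs \<Omega> \<Longrightarrow> neumann_solution \<Omega> \<mu> lam b Y (u0 Y)"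
    and Z: "Z \<in> configs \<Omega>"
  shows "strictly_differentiable_at (peach_koehler_force \<mu> lam b u0 l) Z"
proof -
  define S where "S = stretch lam ` \<Omega>"
  have "open S" unfolding S_def by (rule frontier_stretch_image(1)[OF \<open>lam \<noteq> 0\<close> \<Omega>(1)])
  have scS: "simply_connected S" unfolding S_def by (rule simply_connected_stretch_image[OF \<open>lam \<noteq> 0\<close> \<Omega>(3)])
  have bS: "bounded S" unfolding S_def by (rule bounded_linear_image[OF \<Omega>(2) bounded_linear_stretch])
  have "S \<noteq> {}" using Z by (auto simp: S_def configs_def)
  obtain f where f: "f holomorphic_on S" "inj_on f S" "\<And>z. z \<in> S \<Longrightarrow> norm (f z) < 1"
    "\<And>z. z \<in> S \<Longrightarrow> deriv f z \<noteq> 0"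
    "\<And>q. q \<in> frontier S \<Longrightarrow> ((\<lambda>z. norm (f z)) \<longlongrightarrow> 1) (at q within S)"
    by (rule riemann_map[OF \<open>open S\<close> scS bS \<open>S \<noteq> {}\<close>]) (rule that)
  have bl: "bounded_linear (\<lambda>w. b l *\<^sub>R (matJ *v (matL \<mu> lam *v field_of_complex lam w)))"
    by (intro bounded_linear_compose[OF bounded_linear_scaleR_right]
        bounded_linear_compose[OF matrix_vector_mul_bounded_linear] bounded_linear_field_of_complex)
  have "strictly_differentiable_at (\<lambda>Y. b l *\<^sub>R (matJ *v (matL \<mu> lam *v field_of_complex lam (complex_force lam b f l Y)))) Z"
    by (rule strictly_differentiable_linear_compose[OF bl
          complex_force_strictly_differentiable[OF \<Omega>(1) \<open>lam \<noteq> 0\<close> Z f(1-4)[unfolded S_def]]])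
  then show ?thesis
    by (rule strictly_differentiable_transform[OF _ open_configs[OF \<Omega>(1)] Z])
      (rule peach_koehler_force_formula[OF \<Omega> C2 \<open>0 < \<mu>\<close> \<open>lam \<noteq> 0\<close> _ u0 f[unfolded S_def]])
qed

theorem theorem2p19:
  fixes \<Omega> :: "(real^2) set" and \<gamma> \<mu> lam :: real
    and b :: "'n::finite \<Rightarrow> real"
    and u0 :: "(real^2)^'n \<Rightarrow> real^2 \<Rightarrow> real"
    and \<G> :: "(real^2) set"
    and D :: "((real^2)^'n) set"
    and j :: "'n \<Rightarrow> (real^2)^'n \<Rightarrow> real^2"
    and T t1 r :: real
    and Z :: "real \<Rightarrow> (real^2)^'n"
    and Z0 Z1 n :: "(real^2)^'n"
    and l :: 'n
    and gp gm :: "real^2"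
  assumes "open \<Omega>" and "bounded \<Omega>" and "simply_connected \<Omega>"
    and "0 < \<gamma>" and "\<gamma> < 1" and "C2_holder_boundary \<gamma> \<Omega>"
    and "0 < \<mu>" and "lam \<noteq> 0"
    and "glide_directions \<G>"
    and D: "D = configs \<Omega>"
    and u0: "\<And>Y. Y \<in> D \<Longrightarrow> neumann_solution \<Omega> \<mu> lam b Y (u0 Y)"
    and j: "j = peach_koehler_force \<mu> lam b u0"
    and "0 < T" and "Z0 \<in> D"
    and "inclusion_solution D \<G> j {-T..T} Z" and "Z 0 = Z0"
    and "t1 \<in> {-T..<T}" and "Z1 \<in> regular_ambiguity_set D \<G> j l" and "Z t1 = Z1"
    and labels: "max_dirs \<G> j l Z1 = {gp, gm}"
    and "0 < r"
    and normal: "unit_normal (ambiguity_set D \<G> j l \<inter> ball Z1 r)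
                   (side D \<G> j l Z1 r gm) (side D \<G> j l Z1 r gp) Z1 n"
    and "local_field \<G> j l Z1 gm Z1 \<bullet> n > 0 \<or> local_field \<G> j l Z1 gp Z1 \<bullet> n < 0"
  shows "right_uniqueness D \<G> j t1 Z1"
proof (rule right_uniqueness_of_strictly_differentiable_force)
  show "glide_directions \<G>" by fact
  show "open D" unfolding D by (rule open_configs) fact
  show "strictly_differentiable_at (j k) Z1" for k
  proof -
    have "Z1 \<in> configs \<Omega>"
      using \<open>Z1 \<in> regular_ambiguity_set D \<G> j l\<close> D
      by (simp add: regular_ambiguity_set_def ambiguity_set_def)
    moreover have "neumann_solution \<Omega> \<mu> lam b Y (u0 Y)" if "Y \<in> configs \<Omega>" for Y
      using u0 that D by blast
    ultimately show ?thesis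
      unfolding j
      by (intro peach_koehler_force_strictly_differentiable[OF \<open>open \<Omega>\<close> \<open>bounded \<Omega>\<close> \<open>simply_connected \<Omega>\<close>
            \<open>C2_holder_boundary \<gamma> \<Omega>\<close> \<open>0 < \<mu>\<close> \<open>lam \<noteq> 0\<close>])
  qed
qed (fact assms)+

end
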